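(* The collection $\{S_\bot^\circ\}\cup\{S_{\rho_\bullet}^\circ\}_{\rho_\bullet\in\mathfrak{Ch}(L_n^-)}$ is a quasi-affine stratification of $\mathcal{A}_n$ by smooth subvarieties.
   Context: Everything is over $\mathbb{C}$; $[k]=\{0<1<\dots<k\}$. Multiscaled lines. A multiscaled line is a tuple $(\Sigma,p_\infty,\preceq,\omega_\bullet)$ where: (1) $\Sigma$ is a connected (complete) nodal complex curve of arithmetic genus $0$ with a smooth marked point $p_\infty$; its dual graph is a tree with vertex set $V(\Sigma)$, $\Sigma_v$ is the component of $v$, and the root $v_0$ is the vertex whose component contains $p_\infty$. Write $v\subseteq u$ if $v$ lies on the simple path from $u$ to $v_0$; $u\wedge v$ is the $\subseteq$-maximal vertex common to the simple paths from $u$ and from $v$ to $v_0$; terminal vertices are the $\subseteq$-maximal ones. (2) $\preceq$ is a total preorder on $V(\Sigma)$ such that (a) each $v\neq v_0$ has a unique adjacent $w$ with $w\prec v$ (the corresponding node is the descending node of $v$), and (b) any two terminal vertices are equivalent, where $v\sim w$ means $v\preceq w$ and $w\preceq v$. (3) For each $v$, $\omega_v$ is a meromorphic differential on $\Sigma_v$ with a pole of order $2$ at the descending node of $v$ (at $p_\infty$ if $v=v_0$) and no other zeros or poles. An $n$-marked multiscaled line has in addition smooth points $p_1,\dots,p_n$ (which may coincide with each other but not with $p_\infty$) lying on terminal components. It is stable if every terminal component contains at least one $p_i$ and every nonterminal component contains at least $3$ nodes, or at least $2$ nodes and $p_\infty$. A complex projective isomorphism is an isomorphism of curves $f:\Sigma\to\Sigma'$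 preserving preorders and all marked points, with $f^*(\omega'_v)=c_v\omega_v$ for constants $c_v\in\mathbb{C}^*$ such that $c_v=c_w$ if $v\sim w$ and $c_v=1$ if $v$ is terminal. $\mathcal{A}_n$ is the set of complex projective isomorphism classes of stable $n$-marked multiscaled lines. Dual level trees. $\Gamma(\Sigma)$ is the dual tree of $\Sigma$ with root $v_0$, preorder $\preceq$ and marking $h:\{1,\dots,n\}\to V(\Sigma)$, $h(i)=v$ if $p_i\in\Sigma_v$. A dual level tree is any marked preordered rooted tree arising this way. Its level function is the order-preserving map $\lambda: V\to V/{\sim}\cong[\ell]$; $\ell$ is its length. A contraction $\Gamma\twoheadrightarrow\Gamma'$ is a surjection $f$ on vertices, compatible with the markings, such that $v\preceq w\Rightarrow f(v)\preceq' f(w)$, adjacent vertices have equal or adjacent images, and fibers span connected subgraphs. Variety structure. $\Pi_{ij}:\mathcal{A}_n\to\mathbb{P}^1$: $\Pi_{ij}(\Sigma)=\int_{p_i}^{p_j}\omega_v$ (any path in the smooth locus of $\Sigma_v$) if $p_i,p_j$ lie on the same terminal component $\Sigma_v$, and $\Pi_{ij}(\Sigma)=\infty$ otherwise. $I_{ij}(\Sigma)=\int_{n_i}^{n_j}\omega_v$ where $v=h(i)\wedge h(j)$ in $\Gamma(\Sigma)$, and $n_i,n_j$ are $p_i,p_j$ if $h(i)=h(j)$, and otherwise the nodes of $\Sigma_v$ through which $\Sigma_v$ is connected to $\Sigma_{h(i)},\Sigma_{h(j)}$. For a dual level tree $\Gamma$ of length $\ell$ with marking $h$, $U_\Gamma\subset\mathcal{A}_n$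 is the set of $\Sigma$ such that there is a contraction $\Gamma\twoheadrightarrow\Gamma(\Sigma)$ and $\Pi_{ij}(\Sigma)\neq0$ whenever $h(i)\neq h(j)$ in $\Gamma$. Choose, for each $0\le m\le\ell-1$, a pair $(i_m,j_m)$ such that $v_m:=h(i_m)\wedge h(j_m)$ is on level $m$ of $\Gamma$; let $v_\ell$ be any terminal vertex. For $\Sigma\in U_\Gamma$ with (unique) contraction $f:\Gamma\twoheadrightarrow\Gamma(\Sigma)$ put $s_\ell=1$, $s_m=I_{i_mj_m}(\Sigma)$ for $m<\ell$; for $1\le m\le\ell$, $t_m=s_m/s_{m-1}$ if $f(v_m)\sim f(v_{m-1})$ and $t_m=0$ otherwise; $z_{ij}=I_{ij}(\Sigma)/s_m$ if $h(i)\wedge h(j)$ is on level $m$ of $\Gamma$. With $A$ (resp. $B$) the set of pairs $i<j$ with $h(i)\ne h(j)$ (resp. $h(i)=h(j)$) in $\Gamma$, this gives a map $\psi_\Gamma=(z_{ij},t_m):U_\Gamma\to(\mathbb{C}^* )^A\times\mathbb{C}^B\times\mathbb{C}^\ell$. $\mathcal{A}_n$ carries the unique structure of algebraic variety such that all $U_\Gamma$ are Zariski open and all $\psi_\Gamma$ are closed immersions; it is smooth and proper of dimension $n-1$. Partitions and strata. $L_n$ is the set of partitions of $\{1,\dots,n\}$; $i\sim^\rho j$ means $i,j$ are in the same block of $\rho$. $\eta\le\pi$ iff every block of $\pi$ is contained in a block of $\eta$. $\bot$ is the one-block partition, $L_n^-=L_n\setminus\{\bot\}$, and $\mathfrak{Ch}(L_n^-)$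 is the set of (nonempty) chains $\rho_\bullet=\{\rho_1<\dots<\rho_\ell\}$ in $L_n^-$. For $\Sigma\in\mathcal{A}_n$ reducible with level function $\lambda:V(\Sigma)\to[\ell]$, $\mathfrak{c}(\Sigma)=\{\rho_1<\dots<\rho_\ell\}$ where $i\sim^{\rho_k}j$ iff $\lambda(h(i)\wedge h(j))\ge k$. $S_{\rho_\bullet}^\circ=\{\Sigma\in\mathcal{A}_n:\mathfrak{c}(\Sigma)=\rho_\bullet\}$, i.e. the set of $\Sigma$ whose dual level tree is the one corresponding to $\rho_\bullet$; $S_\bot^\circ$ is the set of $\Sigma$ with irreducible underlying curve. A stratification of a space $X$ is a collection $\{S_i\}_{i\in I}$ of locally closed subspaces such that $S_i\cap S_j=\varnothing$ for $i\ne j$, $\bigcup_iS_i=X$, and $S_i\cap\overline{S_j}\neq\varnothing$ implies $S_i\subset\overline{S_j}$. It is quasi-affine if each $S_i$ is a quasi-affine variety. *)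

theory Defs
  imports "HOL-Complex_Analysis.Complex_Analysis" "HOL-Library.Disjoint_Sets"
begin

section \<open>Varieties over the complex numbers\<close>

text \<open>
  Varieties are taken in the classical sense: topological spaces with a sheaf of complex-valued
  functions that are locally isomorphic to closed algebraic subsets of affine space, quasi-compact
  and separated. They need not be irreducible.

  The elements of \<^term>\<open>freg V U\<close> are the regular functions on the open set \<^term>\<open>U\<close>; only their
  values on \<^term>\<open>U\<close> matter, and \<^term>\<open>freg V U\<close> is irrelevant when \<^term>\<open>U\<close> is not open.
\<close>

record 'a fspace =
  ftop :: "'a topology"
  freg :: "'a set \<Rightarrow> ('a \<Rightarrow> complex) set"

text \<open>A sheaf of algebras of complex-valued functions. Gluing includes the fact that membership in
  \<^term>\<open>freg V U\<close> depends only on the values on \<^term>\<open>U\<close>.\<close>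

definition function_space :: "'a fspace \<Rightarrow> bool" where
  "function_space V \<longleftrightarrow>
     (\<forall>U. openin (ftop V) U \<longrightarrow>
        (\<forall>c. (\<lambda>_. c) \<in> freg V U) \<and>
        (\<forall>f\<in>freg V U. \<forall>g\<in>freg V U. (\<lambda>x. f x + g x) \<in> freg V U \<and> (\<lambda>x. f x * g x) \<in> freg V U) \<and>
        (\<forall>f\<in>freg V U. \<forall>W\<subseteq>U. openin (ftop V) W \<longrightarrow> f \<in> freg V W) \<and>
        (\<forall>f. (\<forall>x\<in>U. \<exists>W g. openin (ftop V) W \<and> x \<in> W \<and> W \<subseteq> U \<and> g \<in> freg V W \<and> (\<forall>y\<in>W. f y = g y))
             \<longrightarrow> f \<in> freg V U))"

definition morphism :: "'a fspace \<Rightarrow> 'b fspace \<Rightarrow> ('a \<Rightarrow> 'b) \<Rightarrow> bool" where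
  "morphism V W f \<longleftrightarrow> continuous_map (ftop V) (ftop W) f \<and>
     (\<forall>U g. openin (ftop W) U \<and> g \<in> freg W U \<longrightarrow> g \<circ> f \<in> freg V {x \<in> topspace (ftop V). f x \<in> U})"

definition isomorphism :: "'a fspace \<Rightarrow> 'b fspace \<Rightarrow> ('a \<Rightarrow> 'b) \<Rightarrow> bool" where
  "isomorphism V W f \<longleftrightarrow> morphism V W f \<and>
     (\<exists>g. morphism W V g \<and> (\<forall>x\<in>topspace (ftop V). g (f x) = x) \<and> (\<forall>y\<in>topspace (ftop W). f (g y) = y))"

definition isomorphic :: "'a fspace \<Rightarrow> 'b fspace \<Rightarrow> bool" where
  "isomorphic V W \<longleftrightarrow> (\<exists>f. isomorphism V W f)"

text \<open>The induced reduced structure on a locally closed subset: the regular functions are those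
  that locally extend to regular functions of the ambient space.\<close>

definition subspace_of :: "'a fspace \<Rightarrow> 'a set \<Rightarrow> 'a fspace" where
  "subspace_of V S =
     \<lparr> ftop = subtopology (ftop V) S,
       freg = (\<lambda>U. {f. \<forall>x\<in>U. \<exists>W g. openin (ftop V) W \<and> x \<in> W \<and> g \<in> freg V W \<and> (\<forall>y\<in>W \<inter> U. f y = g y)}) \<rparr>"

definition locally_closed_in :: "'a topology \<Rightarrow> 'a set \<Rightarrow> bool" where
  "locally_closed_in X S \<longleftrightarrow> (\<exists>U C. openin X U \<and> closedin X C \<and> S = U \<inter> C)"

definition closed_immersion :: "'a fspace \<Rightarrow> 'b fspace \<Rightarrow> ('a \<Rightarrow> 'b) \<Rightarrow> bool" where
  "closed_immersion V W f \<longleftrightarrow> closedin (ftop W) (f ` topspace (ftop V)) \<and>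
     isomorphism V (subspace_of W (f ` topspace (ftop V))) f"

text \<open>Affine space with coordinates indexed by a finite set \<^term>\<open>I\<close>; its points are the functions
  vanishing outside \<^term>\<open>I\<close>.\<close>

definition affine_points :: "'i set \<Rightarrow> ('i \<Rightarrow> complex) set" where
  "affine_points I = {x. \<forall>i. i \<notin> I \<longrightarrow> x i = 0}"

inductive_set poly_funs :: "'i set \<Rightarrow> (('i \<Rightarrow> complex) \<Rightarrow> complex) set" for I :: "'i set" where
  poly_const: "(\<lambda>_. c) \<in> poly_funs I"
| poly_coord: "i \<in> I \<Longrightarrow> (\<lambda>x. x i) \<in> poly_funs I"
| poly_add: "p \<in> poly_funs I \<Longrightarrow> q \<in> poly_funs I \<Longrightarrow> (\<lambda>x. p x + q x) \<in> poly_funs I"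
| poly_mult: "p \<in> poly_funs I \<Longrightarrow> q \<in> poly_funs I \<Longrightarrow> (\<lambda>x. p x * q x) \<in> poly_funs I"

definition zariski_open :: "'i set \<Rightarrow> ('i \<Rightarrow> complex) set \<Rightarrow> bool" where
  "zariski_open I U \<longleftrightarrow> (\<exists>F \<subseteq> poly_funs I. U = {x \<in> affine_points I. \<exists>p\<in>F. p x \<noteq> 0})"

lemma istopology_zariski: "istopology (zariski_open I)"
  unfolding istopology_def
proof (intro conjI allI impI)
  fix S T assume "zariski_open I S" "zariski_open I T"
  then obtain F G where F: "F \<subseteq> poly_funs I" "S = {x \<in> affine_points I. \<exists>p\<in>F. p x \<noteq> 0}"
    and G: "G \<subseteq> poly_funs I" "T = {x \<in> affine_points I. \<exists>p\<in>G. p x \<noteq> 0}"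
    unfolding zariski_open_def by blast
  let ?H = "{(\<lambda>x. p x * q x) | p q. p \<in> F \<and> q \<in> G}"
  have "?H \<subseteq> poly_funs I" using F(1) G(1) by (auto intro: poly_mult)
  moreover have "S \<inter> T = {x \<in> affine_points I. \<exists>h\<in>?H. h x \<noteq> 0}"
    unfolding F(2) G(2) by fastforce
  ultimately show "zariski_open I (S \<inter> T)" unfolding zariski_open_def by blast
next
  fix K assume K: "\<forall>S\<in>K. zariski_open I S"
  then have "\<forall>S\<in>K. \<exists>F. F \<subseteq> poly_funs I \<and> S = {x \<in> affine_points I. \<exists>p\<in>F. p x \<noteq> 0}"
    unfolding zariski_open_def by blast
  then obtain F where F: "\<forall>S\<in>K. F S \<subseteq> poly_funs I \<and> S = {x \<in> affine_points I. \<exists>p\<in>F S. p x \<noteq> 0}"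
    by (rule bchoice[THEN exE])
  have "\<Union>K = {x \<in> affine_points I. \<exists>p\<in>(\<Union>S\<in>K. F S). p x \<noteq> 0}"
    using F by fast
  moreover have "(\<Union>S\<in>K. F S) \<subseteq> poly_funs I" using F by blast
  ultimately show "zariski_open I (\<Union>K)" unfolding zariski_open_def by blast
qed

definition zariski :: "'i set \<Rightarrow> ('i \<Rightarrow> complex) topology" where
  "zariski I = topology (zariski_open I)"

lemma openin_zariski: "openin (zariski I) U \<longleftrightarrow> zariski_open I U"
  unfolding zariski_def by (simp add: topology_inverse' istopology_zariski)

definition affine_space :: "'i set \<Rightarrow> ('i \<Rightarrow> complex) fspace" where
  "affine_space I =
     \<lparr> ftop = zariski I,
       freg = (\<lambda>U. {f. \<forall>x\<in>U. \<exists>p\<in>poly_funs I. \<exists>q\<in>poly_funs I. \<exists>W. openin (zariski I) W \<and> x \<in> W \<and> W \<subseteq> U \<and>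
                      (\<forall>y\<in>W. q y \<noteq> 0 \<and> f y = p y / q y)}) \<rparr>"

text \<open>Separatedness is the condition that two morphisms from an affine variety agree on a closed set.\<close>

definition separated :: "'a fspace \<Rightarrow> bool" where
  "separated V \<longleftrightarrow>
     (\<forall>(N::nat) Z f g. closedin (zariski {..<N}) Z \<and>
        morphism (subspace_of (affine_space {..<N}) Z) V f \<and>
        morphism (subspace_of (affine_space {..<N}) Z) V g \<longrightarrow>
        closedin (zariski {..<N}) {x \<in> Z. f x = g x})"

definition variety :: "'a fspace \<Rightarrow> bool" where
  "variety V \<longleftrightarrow> function_space V \<and> compact_space (ftop V) \<and>
     (\<forall>x\<in>topspace (ftop V). \<exists>U (N::nat) Z. openin (ftop V) U \<and> x \<in> U \<and> closedin (zariski {..<N}) Z \<and>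
        isomorphic (subspace_of V U) (subspace_of (affine_space {..<N}) Z)) \<and>
     separated V"

definition quasi_affine_variety :: "'a fspace \<Rightarrow> bool" where
  "quasi_affine_variety V \<longleftrightarrow>
     (\<exists>(N::nat) Q. locally_closed_in (zariski {..<N}) Q \<and>
        isomorphic V (subspace_of (affine_space {..<N}) Q))"

text \<open>A variety is smooth if locally it is cut out in
  an open subset of affine space by finitely many polynomials whose differentials are linearly
  independent at every point of the common zero locus.\<close>

definition pderivative :: "(('i \<Rightarrow> complex) \<Rightarrow> complex) \<Rightarrow> 'i \<Rightarrow> ('i \<Rightarrow> complex) \<Rightarrow> complex" where
  "pderivative p i x = deriv (\<lambda>t. p (x(i := t))) (x i)"

definition smooth_variety :: "'a fspace \<Rightarrow> bool" where
  "smooth_variety V \<longleftrightarrow>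
     (\<forall>x\<in>topspace (ftop V). \<exists>U (N::nat) (c::nat) g W. openin (ftop V) U \<and> x \<in> U \<and>
        openin (zariski {..<N}) W \<and> (\<forall>k<c. g k \<in> poly_funs {..<N}) \<and>
        (\<forall>y\<in>W. (\<forall>k<c. g k y = 0) \<longrightarrow>
           (\<forall>a. (\<forall>i<N. (\<Sum>k<c. a k * pderivative (g k) i y) = 0) \<longrightarrow> (\<forall>k<c. a k = 0))) \<and>
        isomorphic (subspace_of V U)
          (subspace_of (affine_space {..<N}) {y \<in> W. \<forall>k<c. g k y = 0}))"

definition stratification :: "'a topology \<Rightarrow> 'i set \<Rightarrow> ('i \<Rightarrow> 'a set) \<Rightarrow> bool" where
  "stratification X I S \<longleftrightarrow>
     (\<forall>i\<in>I. locally_closed_in X (S i)) \<and>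
     (\<forall>i\<in>I. \<forall>j\<in>I. i \<noteq> j \<longrightarrow> S i \<inter> S j = {}) \<and>
     (\<Union>i\<in>I. S i) = topspace X \<and>
     (\<forall>i\<in>I. \<forall>j\<in>I. S i \<inter> (X closure_of S j) \<noteq> {} \<longrightarrow> S i \<subseteq> X closure_of S j)"

definition quasi_affine_stratification :: "'a fspace \<Rightarrow> 'i set \<Rightarrow> ('i \<Rightarrow> 'a set) \<Rightarrow> bool" where
  "quasi_affine_stratification V I S \<longleftrightarrow>
     stratification (ftop V) I S \<and> (\<forall>i\<in>I. quasi_affine_variety (subspace_of V (S i)))"


section \<open>The projective line and meromorphic differentials\<close>

datatype P1 = Fin (aff_coord: complex) | Inf

fun mobius_map :: "complex \<Rightarrow> complex \<Rightarrow> complex \<Rightarrow> complex \<Rightarrow> P1 \<Rightarrow> P1" where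
  "mobius_map a b c d (Fin z) = (if c * z + d = 0 then Inf else Fin ((a * z + b) / (c * z + d)))"
| "mobius_map a b c d Inf = (if c = 0 then Inf else Fin (a / c))"

definition is_mobius :: "(P1 \<Rightarrow> P1) \<Rightarrow> bool" where
  "is_mobius \<phi> \<longleftrightarrow> (\<exists>a b c d. a * d - b * c \<noteq> 0 \<and> \<phi> = mobius_map a b c d)"

text \<open>A differential \<open>f(z) dz\<close> is given by its coefficient \<open>f\<close> in the affine coordinate, considered
  up to equality outside a discrete set. The coefficient of the pullback under \<^term>\<open>\<phi>\<close> is
  \<open>f(\<phi>(z)) \<phi>'(z)\<close>.\<close>

type_synonym differential = "complex \<Rightarrow> complex"

definition pullback :: "(P1 \<Rightarrow> P1) \<Rightarrow> differential \<Rightarrow> differential" where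
  "pullback \<phi> \<omega> = (\<lambda>z. \<omega> (aff_coord (\<phi> (Fin z))) * deriv (\<lambda>u. aff_coord (\<phi> (Fin u))) z)"

definition diff_eq :: "differential \<Rightarrow> differential \<Rightarrow> bool" where
  "diff_eq \<omega> \<eta> \<longleftrightarrow> (\<forall>\<^sub>\<approx>z\<in>UNIV. \<omega> z = \<eta> z)"

text \<open>A coordinate centred at a point: \<open>z \<mapsto> z + p\<close>, or \<open>z \<mapsto> 1/z\<close> at infinity.\<close>

fun centred_chart :: "P1 \<Rightarrow> P1 \<Rightarrow> P1" where
  "centred_chart (Fin p) = mobius_map 1 p 0 1"
| "centred_chart Inf = mobius_map 0 1 1 0"

definition meromorphic_differential :: "differential \<Rightarrow> bool" where
  "meromorphic_differential \<omega> \<longleftrightarrow> (\<forall>p. pullback (centred_chart p) \<omega> meromorphic_on {0})"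

definition diff_order :: "differential \<Rightarrow> P1 \<Rightarrow> int" where
  "diff_order \<omega> p = zorder (pullback (centred_chart p) \<omega>) 0"

definition double_pole_only :: "differential \<Rightarrow> P1 \<Rightarrow> bool" where
  "double_pole_only \<omega> q \<longleftrightarrow> meromorphic_differential \<omega> \<and> \<not> diff_eq \<omega> (\<lambda>_. 0) \<and>
     diff_order \<omega> q = -2 \<and> (\<forall>p. p \<noteq> q \<longrightarrow> diff_order \<omega> p = 0)"

text \<open>The integral from \<^term>\<open>p\<close> to \<^term>\<open>p'\<close> of a differential whose only pole is a double pole
  \<^term>\<open>q\<close>. A path avoiding \<^term>\<open>q\<close> is a path in the complex plane after a change of coordinate
  moving \<^term>\<open>q\<close> to infinity; there the coefficient is entire up to removable singularities, so the
  value depends neither on the path nor on the coordinate.\<close>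

definition diff_integral :: "differential \<Rightarrow> P1 \<Rightarrow> P1 \<Rightarrow> P1 \<Rightarrow> complex" where
  "diff_integral \<omega> q p p' = (THE I. \<exists>\<phi> \<gamma>. is_mobius \<phi> \<and> \<phi> Inf = q \<and> valid_path \<gamma> \<and>
      \<phi> (Fin (pathstart \<gamma>)) = p \<and> \<phi> (Fin (pathfinish \<gamma>)) = p' \<and>
      (remove_sings (pullback \<phi> \<omega>) has_contour_integral I) \<gamma>)"


section \<open>Rooted trees with a preorder and a marking\<close>

record ltree =
  tverts :: "nat set"
  tadj :: "nat rel"
  troot :: nat
  tle :: "nat rel"
  tmark :: "nat \<Rightarrow> nat"

definition simple_path :: "ltree \<Rightarrow> nat list \<Rightarrow> nat \<Rightarrow> nat \<Rightarrow> bool" where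
  "simple_path T xs u v \<longleftrightarrow> xs \<noteq> [] \<and> hd xs = u \<and> last xs = v \<and> set xs \<subseteq> tverts T \<and> distinct xs \<and>
     successively (\<lambda>x y. (x, y) \<in> tadj T) xs"

definition below :: "ltree \<Rightarrow> nat \<Rightarrow> nat \<Rightarrow> bool" where
  "below T v u \<longleftrightarrow> (\<exists>xs. simple_path T xs u (troot T) \<and> v \<in> set xs)"

definition tmeet :: "ltree \<Rightarrow> nat \<Rightarrow> nat \<Rightarrow> nat" where
  "tmeet T u v = (THE w. below T w u \<and> below T w v \<and>
     (\<forall>x. below T x u \<and> below T x v \<and> below T w x \<longrightarrow> x = w))"

definition terminal :: "ltree \<Rightarrow> nat \<Rightarrow> bool" where
  "terminal T v \<longleftrightarrow> v \<in> tverts T \<and> (\<forall>u\<in>tverts T. below T v u \<longrightarrow> u = v)"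

definition tless :: "ltree \<Rightarrow> nat \<Rightarrow> nat \<Rightarrow> bool" where
  "tless T v w \<longleftrightarrow> (v, w) \<in> tle T \<and> (w, v) \<notin> tle T"

definition tequiv :: "ltree \<Rightarrow> nat \<Rightarrow> nat \<Rightarrow> bool" where
  "tequiv T v w \<longleftrightarrow> (v, w) \<in> tle T \<and> (w, v) \<in> tle T"

definition tclass :: "ltree \<Rightarrow> nat \<Rightarrow> nat set" where
  "tclass T v = {w \<in> tverts T. tequiv T v w}"

text \<open>The order isomorphism from the chain of equivalence classes to \<open>{0 < \<dots> < \<ell>}\<close> sends a class
  to the number of strictly smaller classes.\<close>

definition tlevel :: "ltree \<Rightarrow> nat \<Rightarrow> nat" where
  "tlevel T v = card (tclass T ` {w \<in> tverts T. tless T w v})"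

definition tlength :: "ltree \<Rightarrow> nat" where
  "tlength T = card (tclass T ` tverts T) - 1"

definition contraction :: "nat \<Rightarrow> ltree \<Rightarrow> ltree \<Rightarrow> (nat \<Rightarrow> nat) \<Rightarrow> bool" where
  "contraction n T T' f \<longleftrightarrow>
     f ` tverts T = tverts T' \<and>
     (\<forall>i\<in>{1..n}. f (tmark T i) = tmark T' i) \<and>
     (\<forall>v\<in>tverts T. \<forall>w\<in>tverts T. (v, w) \<in> tle T \<longrightarrow> (f v, f w) \<in> tle T') \<and>
     (\<forall>v\<in>tverts T. \<forall>w\<in>tverts T. (v, w) \<in> tadj T \<longrightarrow> f v = f w \<or> (f v, f w) \<in> tadj T') \<and>
     (\<forall>v\<in>tverts T. \<forall>w\<in>tverts T. f v = f w \<longrightarrow>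
        (\<exists>xs. simple_path T xs v w \<and> (\<forall>x\<in>set xs. f x = f v)))"


section \<open>Multiscaled lines\<close>

text \<open>A connected nodal curve of arithmetic genus 0 has only projective lines as components, so it
  is given by its normalization and the pairs of points glued together: \<^term>\<open>(v, p)\<close> is the point
  \<^term>\<open>p\<close> of the component \<^term>\<open>v\<close>, and a node is a two-element set of such points. The remaining
  fields are the marked point at infinity, the preorder, the differentials and the marked points;
  differentials off the vertex set and marked points off \<open>{1..n}\<close> are irrelevant.\<close>

record mline =
  comps :: "nat set"
  nodes :: "(nat \<times> P1) set set"
  pinf :: "nat \<times> P1"
  mle :: "nat rel"
  mdiff :: "nat \<Rightarrow> differential"
  marks :: "nat \<Rightarrow> nat \<times> P1"

definition dual_tree :: "mline \<Rightarrow> ltree" where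
  "dual_tree S = \<lparr> tverts = comps S,
     tadj = {(v, w). \<exists>a b. {(v, a), (w, b)} \<in> nodes S \<and> (v, a) \<noteq> (w, b)},
     troot = fst (pinf S), tle = mle S, tmark = (\<lambda>i. fst (marks S i)) \<rparr>"

definition smooth_point :: "mline \<Rightarrow> nat \<times> P1 \<Rightarrow> bool" where
  "smooth_point S x \<longleftrightarrow> fst x \<in> comps S \<and> x \<notin> \<Union>(nodes S)"

definition glueing_data :: "mline \<Rightarrow> bool" where
  "glueing_data S \<longleftrightarrow> finite (comps S) \<and> comps S \<noteq> {} \<and> finite (nodes S) \<and>
     (\<forall>e\<in>nodes S. e \<subseteq> comps S \<times> UNIV \<and> card e = 2) \<and> pairwise disjnt (nodes S)"

definition connected_curve :: "mline \<Rightarrow> bool" where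
  "connected_curve S \<longleftrightarrow> (\<forall>v\<in>comps S. \<forall>w\<in>comps S. (v, w) \<in> (tadj (dual_tree S))\<^sup>*)"

text \<open>For a connected nodal curve with rational components.\<close>

definition arithmetic_genus :: "mline \<Rightarrow> int" where
  "arithmetic_genus S = int (card (nodes S)) - int (card (comps S)) + 1"

text \<open>The point on the component \<^term>\<open>v\<close> of the descending node of \<^term>\<open>v\<close>.\<close>

definition descending_point :: "mline \<Rightarrow> nat \<Rightarrow> P1" where
  "descending_point S v = (THE a. \<exists>w b. {(v, a), (w, b)} \<in> nodes S \<and> tless (dual_tree S) w v)"

definition pole_point :: "mline \<Rightarrow> nat \<Rightarrow> P1" where
  "pole_point S v = (if v = fst (pinf S) then snd (pinf S) else descending_point S v)"

definition multiscaled_line :: "mline \<Rightarrow> bool" where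
  "multiscaled_line S \<longleftrightarrow>
     glueing_data S \<and> connected_curve S \<and> arithmetic_genus S = 0 \<and> smooth_point S (pinf S) \<and>
     preorder_on (comps S) (mle S) \<and> total_on (comps S) (mle S) \<and>
     (\<forall>v\<in>comps S. v \<noteq> troot (dual_tree S) \<longrightarrow>
        (\<exists>!w. (v, w) \<in> tadj (dual_tree S) \<and> tless (dual_tree S) w v)) \<and>
     (\<forall>v w. terminal (dual_tree S) v \<and> terminal (dual_tree S) w \<longrightarrow> tequiv (dual_tree S) v w) \<and>
     (\<forall>v\<in>comps S. double_pole_only (mdiff S v) (pole_point S v))"

definition marked_line :: "nat \<Rightarrow> mline \<Rightarrow> bool" where
  "marked_line n S \<longleftrightarrow> multiscaled_line S \<and>
     (\<forall>i\<in>{1..n}. smooth_point S (marks S i) \<and> marks S i \<noteq> pinf S \<and>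
        terminal (dual_tree S) (fst (marks S i)))"

definition num_nodes :: "mline \<Rightarrow> nat \<Rightarrow> nat" where
  "num_nodes S v = card {e \<in> nodes S. \<exists>a. (v, a) \<in> e}"

definition stable_line :: "nat \<Rightarrow> mline \<Rightarrow> bool" where
  "stable_line n S \<longleftrightarrow> marked_line n S \<and>
     (\<forall>v\<in>comps S. if terminal (dual_tree S) v then \<exists>i\<in>{1..n}. fst (marks S i) = v
        else num_nodes S v \<ge> 3 \<or> (num_nodes S v \<ge> 2 \<and> fst (pinf S) = v))"

text \<open>An isomorphism of curves is a bijection of the components with isomorphisms between
  corresponding components that carry nodes to nodes.\<close>

definition proj_isomorphism :: "nat \<Rightarrow> mline \<Rightarrow> mline \<Rightarrow> (nat \<Rightarrow> nat) \<Rightarrow> (nat \<Rightarrow> P1 \<Rightarrow> P1) \<Rightarrow> bool" where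
  "proj_isomorphism n S S' \<sigma> \<phi> \<longleftrightarrow>
     (let \<Phi> = (\<lambda>(v, p). (\<sigma> v, \<phi> v p)) in
       bij_betw \<sigma> (comps S) (comps S') \<and> (\<forall>v\<in>comps S. is_mobius (\<phi> v)) \<and>
       nodes S' = (\<lambda>e. \<Phi> ` e) ` nodes S \<and>
       pinf S' = \<Phi> (pinf S) \<and> (\<forall>i\<in>{1..n}. marks S' i = \<Phi> (marks S i)) \<and>
       (\<forall>v\<in>comps S. \<forall>w\<in>comps S. (v, w) \<in> mle S \<longleftrightarrow> (\<sigma> v, \<sigma> w) \<in> mle S') \<and>
       (\<exists>c. (\<forall>v\<in>comps S. c v \<noteq> 0 \<and> diff_eq (pullback (\<phi> v) (mdiff S' (\<sigma> v))) (\<lambda>z. c v * mdiff S v z)) \<and>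
          (\<forall>v\<in>comps S. \<forall>w\<in>comps S. tequiv (dual_tree S) v w \<longrightarrow> c v = c w) \<and>
          (\<forall>v\<in>comps S. terminal (dual_tree S) v \<longrightarrow> c v = 1)))"

definition proj_iso_rel :: "nat \<Rightarrow> mline rel" where
  "proj_iso_rel n = {(S, S'). stable_line n S \<and> stable_line n S' \<and> (\<exists>\<sigma> \<phi>. proj_isomorphism n S S' \<sigma> \<phi>)}"

definition moduli :: "nat \<Rightarrow> mline set set" where
  "moduli n = {S. stable_line n S} // proj_iso_rel n"

text \<open>The constructions below are made for a representative of an isomorphism class. \<^term>\<open>I_map\<close>
  itself depends on the representative, but \<^term>\<open>Pi_map\<close> and all chart coordinates do not.\<close>

definition representative :: "mline set \<Rightarrow> mline" where
  "representative X = (SOME S. S \<in> X)"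


section \<open>Charts\<close>

definition Pi_map :: "mline \<Rightarrow> nat \<Rightarrow> nat \<Rightarrow> P1" where
  "Pi_map S i j =
     (if fst (marks S i) = fst (marks S j)
      then Fin (diff_integral (mdiff S (fst (marks S i))) (pole_point S (fst (marks S i)))
                  (snd (marks S i)) (snd (marks S j)))
      else Inf)"

text \<open>The point of the component \<^term>\<open>v\<close> lying on the node through which \<^term>\<open>v\<close> is connected to
  the component \<^term>\<open>u\<close>.\<close>

definition node_towards :: "mline \<Rightarrow> nat \<Rightarrow> nat \<Rightarrow> P1" where
  "node_towards S v u = (THE a. \<exists>w b xs. simple_path (dual_tree S) (v # w # xs) v u \<and> {(v, a), (w, b)} \<in> nodes S)"

definition I_map :: "mline \<Rightarrow> nat \<Rightarrow> nat \<Rightarrow> complex" where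
  "I_map S i j =
     (let hi = fst (marks S i); hj = fst (marks S j); v = tmeet (dual_tree S) hi hj
      in diff_integral (mdiff S v) (pole_point S v)
           (if hi = hj then snd (marks S i) else node_towards S v hi)
           (if hi = hj then snd (marks S j) else node_towards S v hj))"

definition dual_level_tree :: "nat \<Rightarrow> ltree \<Rightarrow> bool" where
  "dual_level_tree n \<Gamma> \<longleftrightarrow> (\<exists>S. stable_line n S \<and> \<Gamma> = dual_tree S)"

definition chart_domain :: "nat \<Rightarrow> ltree \<Rightarrow> mline set set" where
  "chart_domain n \<Gamma> = {X \<in> moduli n.
     (\<exists>f. contraction n \<Gamma> (dual_tree (representative X)) f) \<and>
     (\<forall>i\<in>{1..n}. \<forall>j\<in>{1..n}. tmark \<Gamma> i \<noteq> tmark \<Gamma> j \<longrightarrow> Pi_map (representative X) i j \<noteq> Fin 0)}"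

text \<open>The choices entering a chart: the pairs \<open>(i\<^sub>m, j\<^sub>m)\<close> for \<open>m < \<ell>\<close> and the terminal vertex \<open>v\<^sub>\<ell>\<close>.\<close>

definition chart_vertex :: "ltree \<Rightarrow> (nat \<Rightarrow> nat \<times> nat) \<Rightarrow> nat \<Rightarrow> nat \<Rightarrow> nat" where
  "chart_vertex \<Gamma> pr vl m =
     (if m < tlength \<Gamma> then tmeet \<Gamma> (tmark \<Gamma> (fst (pr m))) (tmark \<Gamma> (snd (pr m))) else vl)"

definition chart_choice :: "nat \<Rightarrow> ltree \<Rightarrow> (nat \<Rightarrow> nat \<times> nat) \<Rightarrow> nat \<Rightarrow> bool" where
  "chart_choice n \<Gamma> pr vl \<longleftrightarrow>
     (\<forall>m<tlength \<Gamma>. pr m \<in> {1..n} \<times> {1..n} \<and> tlevel \<Gamma> (chart_vertex \<Gamma> pr vl m) = m) \<and>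
     terminal \<Gamma> vl"

definition chart_scale :: "ltree \<Rightarrow> (nat \<Rightarrow> nat \<times> nat) \<Rightarrow> mline \<Rightarrow> nat \<Rightarrow> complex" where
  "chart_scale \<Gamma> pr S m = (if m < tlength \<Gamma> then I_map S (fst (pr m)) (snd (pr m)) else 1)"

datatype coord = Z nat nat | T nat

definition chart_coords :: "nat \<Rightarrow> ltree \<Rightarrow> coord set" where
  "chart_coords n \<Gamma> = {Z i j | i j. 1 \<le> i \<and> i < j \<and> j \<le> n} \<union> {T m | m. 1 \<le> m \<and> m \<le> tlength \<Gamma>}"

definition chart_target :: "nat \<Rightarrow> ltree \<Rightarrow> (coord \<Rightarrow> complex) set" where
  "chart_target n \<Gamma> = {x \<in> affine_points (chart_coords n \<Gamma>).
     \<forall>i j. 1 \<le> i \<and> i < j \<and> j \<le> n \<and> tmark \<Gamma> i \<noteq> tmark \<Gamma> j \<longrightarrow> x (Z i j) \<noteq> 0}"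

definition chart_map :: "nat \<Rightarrow> ltree \<Rightarrow> (nat \<Rightarrow> nat \<times> nat) \<Rightarrow> nat \<Rightarrow> mline set \<Rightarrow> coord \<Rightarrow> complex" where
  "chart_map n \<Gamma> pr vl X =
     (let S = representative X;
          f = (SOME f. contraction n \<Gamma> (dual_tree S) f);
          s = chart_scale \<Gamma> pr S;
          v = chart_vertex \<Gamma> pr vl
      in (\<lambda>k. if k \<notin> chart_coords n \<Gamma> then 0 else case k of
            Z i j \<Rightarrow> I_map S i j / s (tlevel \<Gamma> (tmeet \<Gamma> (tmark \<Gamma> i) (tmark \<Gamma> j)))
          | T m \<Rightarrow> if tequiv (dual_tree S) (f (v m)) (f (v (m - 1))) then s m / s (m - 1) else 0))"

text \<open>These conditions determine the topology and the regular functions on the moduli space, since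
  the chart domains cover it.\<close>

definition moduli_variety :: "nat \<Rightarrow> mline set fspace \<Rightarrow> bool" where
  "moduli_variety n \<A> \<longleftrightarrow> variety \<A> \<and> topspace (ftop \<A>) = moduli n \<and>
     (\<forall>\<Gamma>. dual_level_tree n \<Gamma> \<longrightarrow> openin (ftop \<A>) (chart_domain n \<Gamma>) \<and>
        (\<forall>pr vl. chart_choice n \<Gamma> pr vl \<longrightarrow>
           closed_immersion (subspace_of \<A> (chart_domain n \<Gamma>))
             (subspace_of (affine_space (chart_coords n \<Gamma>)) (chart_target n \<Gamma>))
             (chart_map n \<Gamma> pr vl)))"


section \<open>Partitions and strata\<close>

definition partitions_minus :: "nat \<Rightarrow> nat set set set" where
  "partitions_minus n = {\<pi>. partition_on {1..n} \<pi>} - {{{1..n}}}"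

text \<open>In the order on partitions \<open>\<eta> \<le> \<pi>\<close> means that \<open>\<pi>\<close> refines \<open>\<eta>\<close>.\<close>

definition partition_chains :: "nat \<Rightarrow> nat set set set set" where
  "partition_chains n = {C. C \<noteq> {} \<and> C \<subseteq> partitions_minus n \<and>
     (\<forall>\<eta>\<in>C. \<forall>\<pi>\<in>C. refines {1..n} \<pi> \<eta> \<or> refines {1..n} \<eta> \<pi>)}"

definition level_partition :: "nat \<Rightarrow> mline \<Rightarrow> nat \<Rightarrow> nat set set" where
  "level_partition n S k = {1..n} // {(i, j). i \<in> {1..n} \<and> j \<in> {1..n} \<and>
     tlevel (dual_tree S) (tmeet (dual_tree S) (fst (marks S i)) (fst (marks S j))) \<ge> k}"

definition chain_of :: "nat \<Rightarrow> mline \<Rightarrow> nat set set set" where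
  "chain_of n S = level_partition n S ` {1..tlength (dual_tree S)}"

definition irreducible_line :: "mline \<Rightarrow> bool" where
  "irreducible_line S \<longleftrightarrow> card (comps S) = 1"

text \<open>The index \<^term>\<open>None\<close> stands for the stratum of irreducible curves.\<close>

definition strata_index :: "nat \<Rightarrow> nat set set set option set" where
  "strata_index n = insert None (Some ` partition_chains n)"

definition stratum :: "nat \<Rightarrow> nat set set set option \<Rightarrow> mline set set" where
  "stratum n i = (case i of
      None \<Rightarrow> {X \<in> moduli n. irreducible_line (representative X)}
    | Some C \<Rightarrow> {X \<in> moduli n. \<not> irreducible_line (representative X) \<and> chain_of n (representative X) = C})"

end

theory Submission
  imports Defs
begin

text \<open>
  A stable line is described by its level function, which sends \<open>i\<close> and \<open>j\<close> to the level of the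
  component on which the branches towards the \<open>i\<close>-th and \<open>j\<close>-th marked points separate, and by the
  positions of these branches on that component. Positions are measured by a primitive of the
  differential: once its pole is moved to infinity, the differential is \<open>K dz\<close> by Liouville's theorem.
  Contractions of level trees are the same as monotone surjections of levels compatible with the
  level functions; the chain of partitions of a line determines its level function; and all positions
  compatible with a level function are realized by a line with the same tree.

  Therefore, in the chart of one of its points, a stratum is the locus where all \<open>t\<^sub>m\<close> vanish, and its
  image is cut out by affine-linear equations in the open set where \<open>z\<^sub>i\<^sub>j\<close> is nonzero for all
  \<open>i\<close>, \<open>j\<close> on different components. So it is locally closed, quasi-affine and smooth. If a chart at a point
  of a stratum meets another stratum, the level function of the latter arises by merging levels.
  Conversely, given such a merging, every point of the former stratum is a limit of points of the
  latter: scale the positions on each level by a power of \<open>s\<close> that grows with the level, add up the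
  positions on merged levels, and let \<open>s\<close> tend to \<open>0\<close>.
\<close>

section \<open>Differentials with a single double pole\<close>

text \<open>The topology and the regular functions of the moduli space are accessible only through
  charts, and a chart evaluates a representative and a contraction that are both picked by
  \<open>SOME\<close>. Two invariance facts remove these choices: an isomorphism multiplies all
  \<open>I_map\<close> on one level by a common factor, which the quotients in the coordinates
  cancel (\<open>proj_isomorphism_invariants\<close>, \<open>chart_formula_scale\<close>), and a
  contraction enters only through the map that it induces on levels, which the two level functions
  determine (\<open>chart_map_eq\<close>).

  Positions satisfy many redundant relations, whereas smoothness asks for linearly independent
  differentials. Since the relations are affine-linear in the coordinates, an independent subsystem
  can be extracted once a common zero is known.

  Closures are Zariski closures, but points are approached by an ordinary limit: every neighbourhood
  of a point contains the locus in its chart where one polynomial is nonzero, and a polynomial that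
  is nonzero at the limit is nonzero nearby.\<close>

lemma pullback_chart_Fin: "pullback (centred_chart (Fin p)) \<omega> = (\<lambda>z. \<omega> (z + p))"
proof
  fix z
  have "deriv (\<lambda>u. u + p) z = 1" by (rule DERIV_imp_deriv) (auto intro!: derivative_eq_intros)
  then show "pullback (centred_chart (Fin p)) \<omega> z = \<omega> (z + p)"
    by (simp add: pullback_def)
qed

lemma pullback_chart_Inf:
  assumes "z \<noteq> 0"
  shows "pullback (centred_chart Inf) \<omega> z = - \<omega> (1 / z) / z\<^sup>2"
proof -
  have "((\<lambda>u. aff_coord (centred_chart Inf (Fin u))) has_field_derivative - 1 / z\<^sup>2) (at z)"
  proof (rule has_field_derivative_transform_within_open)
    show "((\<lambda>u. 1 / u) has_field_derivative - 1 / z\<^sup>2) (at z)"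
      using assms by (auto intro!: derivative_eq_intros simp: power2_eq_square)
    show "open (- {0::complex})" by (rule open_Compl) simp
  qed (use assms in auto)
  then show ?thesis using assms
    by (simp add: pullback_def DERIV_imp_deriv field_simps)
qed

lemma zorder_factor:
  assumes "f meromorphic_on {0}" "\<exists>\<^sub>F z in at 0. f z \<noteq> 0" "zorder f 0 = n"
  shows "\<exists>g r. r > 0 \<and> g holomorphic_on cball 0 r \<and> g 0 \<noteq> 0 \<and>
    (\<forall>w\<in>cball 0 r - {0}. f w = g w * w powi n \<and> g w \<noteq> 0)"
  using zorder_exist[of f 0] assms by (auto simp: meromorphic_at_iff)

text \<open>By the identity theorem a meromorphic function on the plane vanishes off a sparse set or
  is nonzero off one, which settles finite \<open>p\<close>. At infinity, vanishing near
  \<open>0\<close> in the coordinate \<open>1/z\<close> means vanishing for large \<open>z\<close>,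
  hence near some finite point. This is the side condition under which \<open>zorder\<close> gives a
  local factorization.\<close>

lemma frequently_nonzero_differential:
  assumes m: "meromorphic_differential \<omega>" and nz: "\<not> diff_eq \<omega> (\<lambda>_. 0)"
  shows "\<exists>\<^sub>F z in at 0. pullback (centred_chart p) \<omega> z \<noteq> 0"
proof -
  have mero: "\<omega> meromorphic_on UNIV"
    unfolding meromorphic_on_def
  proof
    fix p :: complex
    have "pullback (centred_chart (Fin p)) \<omega> meromorphic_on {0}"
      using m unfolding meromorphic_differential_def by blast
    then show "\<exists>F. (\<lambda>w. \<omega> (p + w)) has_laurent_expansion F"
      unfolding pullback_chart_Fin meromorphic_on_def by (simp add: add.commute)
  qed
  have ev: "\<forall>\<^sub>\<approx>z\<in>UNIV. \<omega> z \<noteq> 0"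
    using meromorphic_imp_constant_or_avoid[OF mero, of 0] nz by (auto simp: diff_eq_def)
  have evp: "\<forall>\<^sub>F z in at q. \<omega> z \<noteq> 0" for q
    using eventually_cosparse_imp_eventually_at[OF ev] by blast
  show ?thesis
  proof (cases p)
    case (Fin q)
    have "\<forall>\<^sub>F z in at 0. \<omega> (z + q) \<noteq> 0"
      using evp[of q] by (simp add: at_to_0'[of q] eventually_filtermap)
    then show ?thesis unfolding Fin pullback_chart_Fin by (simp add: eventually_frequently)
  next
    case Inf
    show ?thesis
    proof (rule ccontr)
      assume "\<not> ?thesis"
      then have "\<forall>\<^sub>F z in at 0. pullback (centred_chart Inf) \<omega> z = 0"
        by (simp add: Inf not_frequently)
      then obtain d where d: "d > 0" "\<And>z. z \<noteq> 0 \<Longrightarrow> norm z < d \<Longrightarrow> pullback (centred_chart Inf) \<omega> z = 0"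
        by (auto simp: eventually_at)
      have *: "\<omega> z = 0" if "norm z > 1 / d" for z
      proof -
        have "z \<noteq> 0" using that d(1) by auto
        moreover have "norm (1 / z) < d" using that d(1) \<open>z \<noteq> 0\<close> by (simp add: norm_divide field_simps)
        ultimately show ?thesis using d(2)[of "1/z"] pullback_chart_Inf[of "1/z" \<omega>] by simp
      qed
      define q :: complex where "q = of_real (1 / d + 1)"
      have "q \<in> {z. norm z > 1 / d}" using d(1) by (simp add: q_def del: of_real_add of_real_divide)
      moreover have "open {z::complex. norm z > 1 / d}"
        by (intro open_Collect_less continuous_intros)
      ultimately have "\<forall>\<^sub>F z in at q. z \<in> {z. norm z > 1 / d}"
        by (meson eventually_at_topological)
      with evp[of q] have "\<forall>\<^sub>F z in at q. False" by eventually_elim (use * in auto)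
      then show False by simp
    qed
  qed
qed

text \<open>The standard differential with a double pole at \<open>q\<close>, and its primitive.\<close>

fun dp :: "P1 \<Rightarrow> differential" where
  "dp Inf z = 1"
| "dp (Fin a) z = 1 / (z - a)\<^sup>2"

fun prim :: "P1 \<Rightarrow> P1 \<Rightarrow> complex" where
  "prim Inf p = aff_coord p"
| "prim (Fin a) (Fin z) = - 1 / (z - a)"
| "prim (Fin a) Inf = 0"

section \<open>Liouville's theorem for differentials\<close>

text \<open>The finite limits make \<open>remove_sings h\<close> entire, and its limit at infinity
  makes it constant by Liouville. Where \<open>h\<close> differs from the constant it is not
  analytic; such points lie in a disc and form a sparse set, so there are finitely many.\<close>

lemma differential_constant_off_finite:
  fixes h :: "complex \<Rightarrow> complex"
  assumes fin: "\<And>p. h meromorphic_on {p} \<and> (\<exists>L. L \<noteq> 0 \<and> h \<midarrow>p\<rightarrow> L)"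
    and inf: "L \<noteq> 0" "(h \<longlongrightarrow> L) at_infinity" "\<forall>\<^sub>F z in at_infinity. h analytic_on {z}"
  shows "finite {z. h z \<noteq> L}"
proof -
  have an: "remove_sings h analytic_on {p}" for p
    using remove_sings_analytic_at fin[of p] by (auto simp: meromorphic_at_iff)
  have hol: "remove_sings h holomorphic_on UNIV"
    using an by (meson analytic_on_analytic_at analytic_imp_holomorphic)
  have "\<forall>\<^sub>F z in at_infinity. h z = remove_sings h z"
    using inf(3) by eventually_elim simp
  then have "(remove_sings h \<longlongrightarrow> L) at_infinity"
    using inf(2) by (rule Lim_transform_eventually[rotated])
  then have const: "remove_sings h z = L" for z
    using Liouville_weak[OF hol] by blast
  obtain b where b: "\<And>z. norm z \<ge> b \<Longrightarrow> h analytic_on {z}"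
    using inf(3) by (auto simp: eventually_at_infinity)
  have sub: "{z. h z \<noteq> L} \<subseteq> cball 0 b \<inter> {z. \<not> h analytic_on {z}}"
  proof
    fix z assume "z \<in> {z. h z \<noteq> L}"
    then have "\<not> h analytic_on {z}" using const[of z] by auto
    with b[of z] show "z \<in> cball 0 b \<inter> {z. \<not> h analytic_on {z}}" by (cases "b \<le> norm z") auto
  qed
  have "h meromorphic_on UNIV" using fin meromorphic_on_meromorphic_at by blast
  then have "{z. \<not> h analytic_on {z}} sparse_in UNIV"
    by (rule meromorphic_on_imp_sparse_singularities)
  then have "{z. \<not> h analytic_on {z}} sparse_in cball 0 b"
    by (rule sparse_in_subset) simp
  then have "finite (cball 0 b \<inter> {z. \<not> h analytic_on {z}})"
    by (rule sparse_in_compact_finite) simp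
  with sub show ?thesis by (rule finite_subset)
qed

text \<open>Clearing the pole of \<open>\<omega>\<close> leaves a function \<open>h\<close> with
  finite nonzero limits everywhere, infinity included, so constant. Equality with
  \<open>K * dp q\<close> holds only off a finite set because a coefficient is determined only up to
  isolated points.\<close>

lemma double_pole_only_form:
  assumes "double_pole_only \<omega> q"
  obtains K where "K \<noteq> 0" "finite {z. \<omega> z \<noteq> K * dp q z}"
proof -
  have m: "meromorphic_differential \<omega>" and nz: "\<not> diff_eq \<omega> (\<lambda>_. 0)"
    and ord: "zorder (pullback (centred_chart p) \<omega>) 0 = (if p = q then -2 else 0)" for p
    using assms unfolding double_pole_only_def diff_order_def by (blast, blast, cases "p = q", simp_all)
  note freq = frequently_nonzero_differential[OF m nz]
  have mp: "pullback (centred_chart p) \<omega> meromorphic_on {0}" for p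
    using m by (auto simp: meromorphic_differential_def)
  define e where "e = (\<lambda>z. case q of Fin a \<Rightarrow> (z - a)\<^sup>2 | Inf \<Rightarrow> 1)"
  define h where "h = (\<lambda>z. \<omega> z * e z)"
  have local: "h meromorphic_on {p} \<and> (\<exists>L. L \<noteq> 0 \<and> h \<midarrow>p\<rightarrow> L)" for p
  proof
    have "(\<lambda>z. \<omega> (z + p)) meromorphic_on {0}" using mp[of "Fin p"] by (simp only: pullback_chart_Fin)
    then have "\<omega> meromorphic_on {p}"
      unfolding meromorphic_on_def by (simp add: add.commute)
    moreover have "e meromorphic_on {p}"
      unfolding e_def by (cases q) (auto intro!: meromorphic_intros)
    ultimately show "h meromorphic_on {p}" unfolding h_def by (intro meromorphic_intros)
    from zorder_factor[OF mp freq ord, of "Fin p", unfolded pullback_chart_Fin]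
    obtain g r where gr: "r > 0" "g holomorphic_on cball 0 r" "g 0 \<noteq> 0"
      "\<forall>w\<in>cball 0 r - {0}. \<omega> (w + p) = g w * w powi (if Fin p = q then -2 else 0) \<and> g w \<noteq> 0"
      by - (elim exE conjE, rule that)
    \<comment> \<open>The factor that \<open>e\<close> contributes to the limit at \<open>p\<close>:
      at the pole it cancels the power \<open>w powi -2\<close> and leaves \<open>1\<close>,
      elsewhere it tends to \<open>e p\<close>.\<close>
    define c where "c = (if Fin p = q then 1 else e p)"
    have c: "c \<noteq> 0" by (cases q) (auto simp: c_def e_def)
    have "isCont g 0"
      using gr(1,2) by (metis centre_in_ball continuous_on_interior holomorphic_on_imp_continuous_on interior_cball)
    then have g0: "g \<midarrow>0\<rightarrow> g 0" by (simp add: isCont_def)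
    have "(\<lambda>w. h (w + p)) \<midarrow>0\<rightarrow> g 0 * c"
    proof (cases "Fin p = q")
      case True
      have "\<forall>\<^sub>F w in at 0. g w * c = h (w + p)"
        unfolding eventually_at
        by (rule exI[of _ r]) (use gr(1,4) True in \<open>auto simp: h_def e_def c_def power_int_minus field_simps\<close>)
      then show ?thesis by (rule Lim_transform_eventually[rotated]) (intro tendsto_intros g0)
    next
      case False
      have ev: "\<forall>\<^sub>F w in at 0. g w * e (w + p) = h (w + p)"
        unfolding eventually_at
        by (rule exI[of _ r]) (use gr(1,4) False in \<open>auto simp: h_def\<close>)
      have "(\<lambda>w. e (w + p)) \<midarrow>0\<rightarrow> e p"
        unfolding e_def by (cases q) (auto intro!: tendsto_eq_intros)
      with g0 have "(\<lambda>w. g w * e (w + p)) \<midarrow>0\<rightarrow> g 0 * e p" by (rule tendsto_mult)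
      from Lim_transform_eventually[OF this ev] show ?thesis using False by (simp add: c_def)
    qed
    then have "h \<midarrow>p\<rightarrow> g 0 * c" by (simp add: at_to_0'[of p] filterlim_filtermap)
    with c gr(3) show "\<exists>L. L \<noteq> 0 \<and> h \<midarrow>p\<rightarrow> L"
      by (intro exI[of _ "g 0 * c"]) simp
  qed
  from zorder_factor[OF mp freq ord, of Inf]
  obtain g r where gr: "r > 0" "g holomorphic_on cball 0 r" "g 0 \<noteq> 0"
      "\<forall>w\<in>cball 0 r - {0}.
        pullback (centred_chart Inf) \<omega> w = g w * w powi (if Inf = q then -2 else 0) \<and> g w \<noteq> 0"
    by - (elim exE conjE, rule that)
  \<comment> \<open>This is \<open>h\<close> in the coordinate \<open>w = 1/z\<close>, extended over
    \<open>w = 0\<close>: the sign comes from \<open>d(1/w) = - dw / w^2\<close>, and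
    \<open>(1/w - a)^2 * w^2 = (1 - a * w)^2\<close>.\<close>
  define k where "k = (\<lambda>w. case q of Fin a \<Rightarrow> - ((1 - a * w)\<^sup>2) * g w | Inf \<Rightarrow> - g w)"
  have hk: "h (1 / w) = k w" if "w \<in> cball 0 r" "w \<noteq> 0" for w
  proof -
    have om: "\<omega> (1/w) = - (g w * w powi (if Inf = q then -2 else 0)) * w\<^sup>2"
      using gr(4) that pullback_chart_Inf[of w \<omega>] by (simp add: field_simps)
    show ?thesis unfolding h_def om using that
      by (cases q) (auto simp: k_def e_def power_int_minus field_simps power2_eq_square)
  qed
  have kh: "k holomorphic_on cball 0 r"
    unfolding k_def by (cases q) (auto intro!: holomorphic_intros gr(2))
  have "isCont k 0"
    using gr(1) kh by (metis centre_in_ball continuous_on_interior holomorphic_on_imp_continuous_on interior_cball)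
  then have k0: "k \<midarrow>0\<rightarrow> k 0" by (simp add: isCont_def)
  have k0nz: "k 0 \<noteq> 0" using gr(3) by (cases q) (auto simp: k_def)
  have "\<forall>\<^sub>F w in at 0. k w = h (inverse w)"
    unfolding eventually_at
    by (rule exI[of _ r]) (use gr(1) hk in \<open>auto simp: inverse_eq_divide dist_norm\<close>)
  then have lim: "(h \<longlongrightarrow> k 0) at_infinity"
    unfolding lim_at_infinity_0 o_def by (rule Lim_transform_eventually[OF k0])
  have ana: "h analytic_on {z}" if "norm z > 1 / r" for z
  proof -
    have z: "norm z > 1 / r \<Longrightarrow> z \<noteq> 0 \<and> norm (1/z) < r" for z :: complex using gr(1)
        by (auto simp: norm_divide divide_simps mult.commute split: if_splits)
    have "(k \<circ> (\<lambda>z. 1 / z)) holomorphic_on {z. norm z > 1 / r}"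
      by (rule holomorphic_on_compose_gen[where t = "cball 0 r"])
        (use kh z in \<open>auto intro!: holomorphic_intros simp: less_imp_le\<close>)
    moreover have "(k \<circ> (\<lambda>z. 1 / z)) z = h z" if "norm z > 1 / r" for z
      using hk[of "1/z"] z[OF that] by (simp add: less_imp_le)
    ultimately have "h holomorphic_on {z. norm z > 1 / r}"
      by (auto intro: holomorphic_transform)
    moreover have "open {z::complex. norm z > 1 / r}"
      by (intro open_Collect_less continuous_intros)
    ultimately show ?thesis using that analytic_at by blast
  qed
  have "\<forall>\<^sub>F z in at_infinity. h analytic_on {z}"
    unfolding eventually_at_infinity by (rule exI[of _ "1 / r + 1"]) (use ana in auto)
  from differential_constant_off_finite[OF local k0nz lim this]
  have "finite {z. h z \<noteq> k 0}" .
  moreover have "{z. \<omega> z \<noteq> k 0 * dp q z} \<subseteq> {z. h z \<noteq> k 0} \<union> (case q of Fin a \<Rightarrow> {a} | Inf \<Rightarrow> {})"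
    by (cases q) (auto simp: h_def e_def field_simps)
  ultimately have "finite {z. \<omega> z \<noteq> k 0 * dp q z}"
    by (cases q) (auto elim: finite_subset)
  with k0nz that show thesis by blast
qed

text \<open>Away from the pole the primitive is a coordinate of the line. At a finite pole it takes,
  by division by zero, the value \<open>0\<close> that belongs to infinity, hence the two
  inequations.\<close>

lemma prim_inj:
  assumes "p \<noteq> q" "p' \<noteq> q" "prim q p = prim q p'"
  shows "p = p'"
  using assms by (cases q; cases p; cases p') (auto simp: field_simps)

section \<open>Mobius transformations acting on the standard differential\<close>

lemma pullback_mobius:
  assumes "c * z + d \<noteq> 0"
  shows "pullback (mobius_map a b c d) \<omega> z =
      \<omega> ((a * z + b) / (c * z + d)) * ((a * d - b * c) / (c * z + d)\<^sup>2)"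
proof -
  have "((\<lambda>u. aff_coord (mobius_map a b c d (Fin u))) has_field_derivative (a * d - b * c) / (c * z + d)\<^sup>2) (at z)"
  proof (rule has_field_derivative_transform_within_open)
    show "((\<lambda>u. (a * u + b) / (c * u + d)) has_field_derivative (a * d - b * c) / (c * z + d)\<^sup>2) (at z)"
      using assms by (auto intro!: derivative_eq_intros simp: power2_eq_square algebra_simps)
    show "open {u. c * u + d \<noteq> 0}"
      by (intro open_Collect_neq continuous_intros)
  qed (use assms in auto)
  then show ?thesis using assms
    by (simp add: pullback_def DERIV_imp_deriv)
qed

lemma finite_mobius_pole:
  assumes "a * d - b * c \<noteq> (0::complex)"
  shows "finite {z. c * z + d = 0}"
proof (rule finite_subset)
  have "z = - d / c" if "c * z + d = 0" for z
  proof -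
    have "c \<noteq> 0" using assms that by auto
    moreover have "c * z = - d" using that by (simp add: eq_neg_iff_add_eq_0)
    ultimately show ?thesis by (metis nonzero_mult_div_cancel_left)
  qed
  then show "{z. c * z + d = 0} \<subseteq> {- d / c}" by blast
qed simp

text \<open>A Mobius map is injective off its pole, so a finite exceptional set has a finite
  preimage; only the pole itself has to be added.\<close>

lemma finite_pullback:
  assumes "is_mobius \<phi>" and fin: "finite {z. \<omega> z \<noteq> \<omega>' z}"
  shows "finite {z. pullback \<phi> \<omega> z \<noteq> pullback \<phi> \<omega>' z}"
proof -
  obtain a b c d where det: "a * d - b * c \<noteq> 0" and \<phi>: "\<phi> = mobius_map a b c d"
    using assms(1) by (auto simp: is_mobius_def)
  let ?g = "\<lambda>z. (a * z + b) / (c * z + d)"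
  have inj: "inj_on ?g {z. c * z + d \<noteq> 0}"
  proof (rule inj_onI)
    fix x y assume *: "x \<in> {z. c * z + d \<noteq> 0}" "y \<in> {z. c * z + d \<noteq> 0}" "?g x = ?g y"
    then have "(a * x + b) * (c * y + d) = (a * y + b) * (c * x + d)" by (simp add: field_simps)
    then have "(a * d - b * c) * (x - y) = 0" by (simp add: algebra_simps)
    with det show "x = y" by simp
  qed
  have "finite (?g -` {z. \<omega> z \<noteq> \<omega>' z} \<inter> {z. c * z + d \<noteq> 0})"
    by (rule finite_vimage_IntI[OF fin inj])
  moreover have "{z. pullback \<phi> \<omega> z \<noteq> pullback \<phi> \<omega>' z} \<subseteq>
    (?g -` {z. \<omega> z \<noteq> \<omega>' z} \<inter> {z. c * z + d \<noteq> 0}) \<union> {z. c * z + d = 0}"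
    by (auto simp: \<phi> pullback_mobius)
  ultimately show ?thesis
    using finite_mobius_pole[OF det] by (meson finite_UnI finite_subset)
qed

lemma dp_rescale_zero: "W \<noteq> 0 \<Longrightarrow> D \<noteq> 0 \<Longrightarrow> 1 / (- D / W)\<^sup>2 * (D * c / W\<^sup>2) = c / (D :: complex)"
  by (simp add: power_divide power2_eq_square)

lemma dp_rescale_both: "W \<noteq> 0 \<Longrightarrow> k \<noteq> 0 \<Longrightarrow> 1 / (k * t / W)\<^sup>2 * (k * D / W\<^sup>2) =
    D / k * (1 / (t :: complex)\<^sup>2)"
  by (simp add: power_divide power2_eq_square)

lemma prim_rescale: "t \<noteq> 0 \<Longrightarrow> k \<noteq> 0 \<Longrightarrow> - (c * t + D) / (k * t) = D / k * (- 1 / t) + - c / (k :: complex)"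
  by (simp add: field_simps)

text \<open>The pullback of \<open>dp q'\<close> has a double pole at \<open>q\<close> and no other
  zeros or poles, hence is a multiple \<open>e * dp q\<close>; integrating, the primitive changes by
  the same factor and a constant. The four cases compute \<open>e\<close> and \<open>k\<close>
  explicitly.\<close>

lemma prim_mobius_aux:
  assumes det: "a * d - b * c \<noteq> 0" and \<phi>q: "mobius_map a b c d q = q'"
  shows "\<exists>e k. e \<noteq> 0 \<and> (\<forall>p. p \<noteq> q \<longrightarrow> prim q' (mobius_map a b c d p) = e * prim q p + k) \<and>
     (\<forall>z. c * z + d \<noteq> 0 \<longrightarrow> Fin z \<noteq> q \<longrightarrow> pullback (mobius_map a b c d) (dp q') z = e * dp q z)"
proof (cases q; cases q')
  assume q: "q = Inf" "q' = Inf"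
  then have c: "c = 0" using \<phi>q by (auto split: if_splits)
  then have nz: "a \<noteq> 0" "d \<noteq> 0" using det by auto
  have "prim q' (mobius_map a b c d p) = a / d * prim q p + b / d" if "p \<noteq> q" for p
    using that nz by (cases p) (auto simp: q c field_simps)
  moreover have "pullback (mobius_map a b c d) (dp q') z = a / d * dp q z" for z
    using nz by (subst pullback_mobius) (auto simp: q c field_simps power2_eq_square)
  ultimately show ?thesis using nz by (intro exI[of _ "a / d"] exI[of _ "b / d"]) auto
next
  fix r assume q: "q = Inf" "q' = Fin r"
  then have c: "c \<noteq> 0" and a: "a = r * c" using \<phi>q by (auto split: if_splits)
  define D where "D = r * d - b"
  have b: "b = r * d - D" by (simp add: D_def)
  have D: "D \<noteq> 0" using det by (simp add: a b algebra_simps)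
  have "prim q' (mobius_map a b c d p) = c / D * prim q p + d / D" if p: "p \<noteq> q" for p
  proof (cases p)
    case (Fin z)
    show ?thesis
    proof (cases "c * z + d = 0")
      case True
      then show ?thesis using D by (simp add: Fin q) (simp add: field_simps)
    next
      case False
      have "(a * z + b) / (c * z + d) - r = - D / (c * z + d)"
        using False by (simp add: a b field_simps)
      then show ?thesis using D False by (simp add: Fin q) (simp add: field_simps)
    qed
  qed (use p q in simp)
  moreover have "pullback (mobius_map a b c d) (dp q') z = c / D * dp q z" if z: "c * z + d \<noteq> 0" for z
  proof -
    have e: "(a * z + b) / (c * z + d) - r = - D / (c * z + d)"
      using z by (simp add: a b field_simps)
    have "a * d - b * c = D * c" by (simp add: a b algebra_simps)
    then have "pullback (mobius_map a b c d) (dp q') z =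
        1 / (- D / (c * z + d))\<^sup>2 * (D * c / (c * z + d)\<^sup>2)"
      by (simp only: pullback_mobius[OF z] q dp.simps e \<open>a * d - b * c = D * c\<close>)
    also have "\<dots> = c / D" using z D by (rule dp_rescale_zero)
    finally show ?thesis by (simp add: q)
  qed
  ultimately show ?thesis using c D by (intro exI[of _ "c / D"] exI[of _ "d / D"]) auto
next
  fix r assume q: "q = Fin r" "q' = Inf"
  then have d: "d = - c * r" using \<phi>q by (auto split: if_splits simp: eq_neg_iff_add_eq_0 add.commute)
  then have c: "c \<noteq> 0" using det by auto
  define D where "D = a * r + b"
  have b: "b = D - a * r" by (simp add: D_def)
  have D: "D \<noteq> 0" using det by (auto simp: d b algebra_simps)
  have "prim q' (mobius_map a b c d p) = - D / c * prim q p + a / c" if p: "p \<noteq> q" for p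
  proof (cases p)
    case (Fin z)
    have "c * z + d = c * (z - r)" by (simp add: d algebra_simps)
    moreover have "z - r \<noteq> 0" using p Fin q by auto
    ultimately show ?thesis using c by (simp add: Fin q b) (simp add: field_simps)
  qed (use c q in simp)
  moreover have "pullback (mobius_map a b c d) (dp q') z = - D / c * dp q z" if z: "c * z + d \<noteq> 0" for z
  proof -
    have "c * z + d = c * (z - r)" by (simp add: d algebra_simps)
    moreover have "a * d - b * c = - D * c" by (simp add: d b algebra_simps)
    ultimately have "pullback (mobius_map a b c d) (dp q') z = - D * c / (c * (z - r))\<^sup>2"
      by (simp only: pullback_mobius[OF z] q dp.simps mult_1)
    also have "\<dots> = - D / c * (1 / (z - r)\<^sup>2)" using c by (simp add: power_mult_distrib power2_eq_square)
    finally show ?thesis by (simp add: q)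
  qed
  ultimately show ?thesis using c D by (intro exI[of _ "- D / c"] exI[of _ "a / c"]) auto
next
  fix r r' assume q: "q = Fin r" "q' = Fin r'"
  \<comment> \<open>Solving the condition on the image of \<open>q\<close> for \<open>b\<close> and
    writing \<open>a = k + r' * c\<close>, \<open>d = D - c * r\<close> turns the determinant into
    \<open>k * D\<close>.\<close>
  define D where "D = c * r + d"
  have D: "D \<noteq> 0" and "(a * r + b) / D = r'" using \<phi>q by (auto simp: q D_def split: if_splits)
  then have b: "b = r' * D - a * r" by (auto simp: field_simps)
  have d: "d = D - c * r" by (simp add: D_def)
  define k where "k = a - r' * c"
  have a: "a = k + r' * c" by (simp add: k_def)
  have det': "a * d - b * c = k * D" by (simp add: a b d algebra_simps)
  then have k: "k \<noteq> 0" using det by auto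
  have e: "(a * z + b) / (c * z + d) - r' = k * (z - r) / (c * z + d)" if z: "c * z + d \<noteq> 0" for z
  proof -
    have "(a * z + b) - r' * (c * z + d) = k * (z - r)" by (simp add: a b d algebra_simps)
    then show ?thesis using z by (simp add: field_simps)
  qed
  have "prim q' (mobius_map a b c d p) = D / k * prim q p + - c / k" if p: "p \<noteq> q" for p
  proof (cases p)
    case (Fin z)
    have zr: "z - r \<noteq> 0" using p Fin q by auto
    have cz: "c * z + d = c * (z - r) + D" by (simp add: d algebra_simps)
    have "- (c * z + d) / (k * (z - r)) = D / k * (- 1 / (z - r)) + - c / k"
      unfolding cz using zr k by (rule prim_rescale)
    then have *: "D / k * (- 1 / (z - r)) + - c / k = - (c * z + d) / (k * (z - r))" by (rule sym)
    show ?thesis unfolding Fin q prim.simps *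
      by (cases "c * z + d = 0") (simp_all add: e del: minus_add_distrib)
  next
    case Inf
    show ?thesis
    proof (cases "c = 0")
      case False
      have "a / c - r' = k / c" using False by (simp add: a field_simps)
      then show ?thesis using False by (simp add: Inf q)
    qed (simp add: Inf q)
  qed
  moreover have "pullback (mobius_map a b c d) (dp q') z = D / k * dp q z" if z: "c * z + d \<noteq> 0"
      "Fin z \<noteq> q" for z
  proof -
    have "pullback (mobius_map a b c d) (dp q') z =
        1 / (k * (z - r) / (c * z + d))\<^sup>2 * (k * D / (c * z + d)\<^sup>2)"
      by (simp only: pullback_mobius[OF z(1)] q dp.simps e[OF z(1)] det')
    also have "\<dots> = D / k * (1 / (z - r)\<^sup>2)" using z(1) k by (rule dp_rescale_both)
    finally show ?thesis by (simp add: q)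
  qed
  ultimately show ?thesis using k D by (intro exI[of _ "D / k"] exI[of _ "- c / k"]) auto
qed

lemma prim_mobius:
  assumes "is_mobius \<phi>" "\<phi> q = q'"
  obtains e k where "e \<noteq> 0" "\<And>p. p \<noteq> q \<Longrightarrow> prim q' (\<phi> p) = e * prim q p + k"
    "finite {z. pullback \<phi> (dp q') z \<noteq> e * dp q z}"
proof -
  obtain a b c d where det: "a * d - b * c \<noteq> 0" and \<phi>: "\<phi> = mobius_map a b c d"
    using assms(1) by (auto simp: is_mobius_def)
  from prim_mobius_aux[OF det assms(2)[unfolded \<phi>]] obtain e k where ek: "e \<noteq> 0"
    "\<And>p. p \<noteq> q \<Longrightarrow> prim q' (\<phi> p) = e * prim q p + k"
    "\<And>z. c * z + d \<noteq> 0 \<Longrightarrow> Fin z \<noteq> q \<Longrightarrow> pullback \<phi> (dp q') z = e * dp q z"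
    unfolding \<phi> by blast
  have "{z. pullback \<phi> (dp q') z \<noteq> e * dp q z} \<subseteq> {z. c * z + d = 0} \<union> {aff_coord q}"
    using ek(3) by (cases q) auto
  then have "finite {z. pullback \<phi> (dp q') z \<noteq> e * dp q z}"
    using finite_mobius_pole[OF det] finite_subset by blast
  with ek that show thesis by blast
qed

section \<open>Integrals as differences of the primitive\<close>

lemma remove_sings_constant:
  assumes "finite {z. f z \<noteq> c}"
  shows "remove_sings f = (\<lambda>_. c)"
proof
  fix z
  have "\<forall>\<^sub>F w in at z. w \<notin> {z. f z \<noteq> c}"
    using islimpt_finite[OF assms, of z] by (simp add: islimpt_conv_frequently_at not_frequently)
  then have "\<forall>\<^sub>F w in at z. c = f w" by eventually_elim auto
  then have "f \<midarrow>z\<rightarrow> c" by (rule Lim_transform_eventually[OF tendsto_const])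
  then show "remove_sings f z = c" by (rule remove_sings_eqI)
qed

lemma has_contour_integral_constant:
  assumes "valid_path \<gamma>"
  shows "((\<lambda>_. c) has_contour_integral c * (pathfinish \<gamma> - pathstart \<gamma>)) \<gamma>"
  using contour_integral_primitive[of UNIV "\<lambda>z. c * z" "\<lambda>_. c" \<gamma>] assms
  by (auto simp: right_diff_distrib intro!: derivative_eq_intros)

text \<open>In a coordinate with the pole at infinity the coefficient is the constant
  \<open>K * e\<close> off a finite set, so the integral is \<open>K * e\<close> times the
  difference of the endpoints. The factor \<open>e\<close> is also the one by which the primitives
  differ, so path and coordinate drop out.\<close>

lemma diff_integral_aux:
  assumes fin: "finite {z. \<omega> z \<noteq> K * dp q z}" and \<phi>: "is_mobius \<phi>" "\<phi> Inf = q" and \<gamma>: "valid_path \<gamma>"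
    "\<phi> (Fin (pathstart \<gamma>)) = p" "\<phi> (Fin (pathfinish \<gamma>)) = p'"
  shows "(remove_sings (pullback \<phi> \<omega>) has_contour_integral (K * (prim q p' - prim q p))) \<gamma>"
proof -
  obtain e k where ek: "e \<noteq> 0" "\<And>p. p \<noteq> Inf \<Longrightarrow> prim q (\<phi> p) = e * prim Inf p + k"
    "finite {z. pullback \<phi> (dp q) z \<noteq> e * dp Inf z}"
    using prim_mobius[OF \<phi>] by blast
  have "pullback \<phi> (\<lambda>z. K * dp q z) = (\<lambda>z. K * pullback \<phi> (dp q) z)"
    by (simp add: pullback_def mult.assoc)
  then have "finite {z. pullback \<phi> \<omega> z \<noteq> K * pullback \<phi> (dp q) z}"
    using finite_pullback[OF \<phi>(1) fin] by simp
  then have "finite ({z. pullback \<phi> \<omega> z \<noteq> K * pullback \<phi> (dp q) z} \<union> {z. pullback \<phi> (dp q) z \<noteq> e * dp Inf z})"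
    using ek(3) by simp
  then have "finite {z. pullback \<phi> \<omega> z \<noteq> K * e}"
    by (rule rev_finite_subset) auto
  then have "remove_sings (pullback \<phi> \<omega>) = (\<lambda>_. K * e)" by (rule remove_sings_constant)
  moreover have "prim q p' - prim q p = e * (pathfinish \<gamma> - pathstart \<gamma>)"
    using ek(2)[of "Fin (pathstart \<gamma>)"] ek(2)[of "Fin (pathfinish \<gamma>)"] \<gamma>(2,3)
    by (simp add: algebra_simps)
  ultimately show ?thesis
    using has_contour_integral_constant[OF \<gamma>(1), of "K * e"] by (simp add: mult.assoc)
qed

lemma ex_mobius_at_infinity:
  obtains \<phi> where "is_mobius \<phi>" "\<phi> Inf = q" "\<And>p. p \<noteq> q \<Longrightarrow> \<exists>z. \<phi> (Fin z) = p"
proof (cases q)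
  case Inf
  show thesis
  proof (rule that[of "mobius_map 1 0 0 1"])
    show "is_mobius (mobius_map 1 0 0 1)" unfolding is_mobius_def
      by (intro exI[of _ "1::complex"] exI[of _ "0::complex"]) simp
    show "\<exists>z. mobius_map 1 0 0 1 (Fin z) = p" if "p \<noteq> q" for p
      using that Inf by (cases p) auto
  qed (simp add: Inf)
next
  case (Fin a)
  show thesis
  proof (rule that[of "mobius_map a 1 1 0"])
    show "is_mobius (mobius_map a 1 1 0)" unfolding is_mobius_def
      by (rule exI[of _ a], rule exI[of _ 1], rule exI[of _ 1], rule exI[of _ 0]) simp
    show "\<exists>z. mobius_map a 1 1 0 (Fin z) = p" if p: "p \<noteq> q" for p
    proof (cases p)
      case (Fin w)
      then have "w - a \<noteq> 0" using p \<open>q = Fin a\<close> by auto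
      then have "mobius_map a 1 1 0 (Fin (1 / (w - a))) = p" by (simp add: Fin field_simps)
      then show ?thesis by blast
    qed (auto intro: exI[of _ 0])
  qed (simp add: Fin)
qed

text \<open>The description in \<open>diff_integral\<close> is satisfied by the value along a
  straight segment, and every other admissible path and coordinate gives the same value by
  \<open>diff_integral_aux\<close>.\<close>

lemma diff_integral_eq:
  assumes fin: "finite {z. \<omega> z \<noteq> K * dp q z}" and p: "p \<noteq> q" "p' \<noteq> q"
  shows "diff_integral \<omega> q p p' = K * (prim q p' - prim q p)"
  unfolding diff_integral_def
proof (rule the_equality)
  obtain \<phi> where \<phi>: "is_mobius \<phi>" "\<phi> Inf = q" "\<And>p. p \<noteq> q \<Longrightarrow> \<exists>z. \<phi> (Fin z) = p"
    using ex_mobius_at_infinity by blast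
  obtain z z' where z: "\<phi> (Fin z) = p" "\<phi> (Fin z') = p'" using \<phi>(3) p by metis
  show "\<exists>\<phi> \<gamma>. is_mobius \<phi> \<and> \<phi> Inf = q \<and> valid_path \<gamma> \<and>
      \<phi> (Fin (pathstart \<gamma>)) = p \<and> \<phi> (Fin (pathfinish \<gamma>)) = p' \<and>
      (remove_sings (pullback \<phi> \<omega>) has_contour_integral K * (prim q p' - prim q p)) \<gamma>"
    using diff_integral_aux[OF fin \<phi>(1,2), of "linepath z z'"] \<phi>(1,2) z
    by (intro exI[of _ \<phi>] exI[of _ "linepath z z'"]) simp
next
  fix I
  assume "\<exists>\<phi> \<gamma>. is_mobius \<phi> \<and> \<phi> Inf = q \<and> valid_path \<gamma> \<and>
      \<phi> (Fin (pathstart \<gamma>)) = p \<and> \<phi> (Fin (pathfinish \<gamma>)) = p' \<and>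
      (remove_sings (pullback \<phi> \<omega>) has_contour_integral I) \<gamma>"
  then show "I = K * (prim q p' - prim q p)"
    using diff_integral_aux[OF fin] has_contour_integral_unique by blast
qed

text \<open>Change of variables for the integral when \<open>\<phi>\<close> multiplies the
  differential by \<open>c\<close>. Comparing coefficients at a single generic point suffices,
  because both sides are multiples of \<open>dp q\<close>.\<close>

lemma prim_transport:
  assumes fin: "finite {z. \<omega> z \<noteq> K * dp q z}" and fin': "finite {z. \<omega>' z \<noteq> K' * dp q' z}"
    and \<phi>: "is_mobius \<phi>" "\<phi> q = q'" and eq: "diff_eq (pullback \<phi> \<omega>') (\<lambda>z. c * \<omega> z)"
    and p: "p \<noteq> q" "p' \<noteq> q"
  shows "K' * (prim q' (\<phi> p') - prim q' (\<phi> p)) = c * (K * (prim q p' - prim q p))"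
proof -
  obtain e k where ek: "e \<noteq> 0" "\<And>p. p \<noteq> q \<Longrightarrow> prim q' (\<phi> p) = e * prim q p + k"
    "finite {z. pullback \<phi> (dp q') z \<noteq> e * dp q z}"
    using prim_mobius[OF \<phi>] by blast
  have "pullback \<phi> (\<lambda>z. K' * dp q' z) = (\<lambda>z. K' * pullback \<phi> (dp q') z)"
    by (simp add: pullback_def mult.assoc)
  then have f: "finite {z. pullback \<phi> \<omega>' z \<noteq> K' * pullback \<phi> (dp q') z}"
    using finite_pullback[OF \<phi>(1) fin'] by simp
  have cos: "\<forall>\<^sub>\<approx>z\<in>UNIV. P z" if "finite {z. \<not> P z}" for P :: "complex \<Rightarrow> bool"
    using that by (simp add: eventually_cosparse finite_imp_sparse)
  have "\<forall>\<^sub>\<approx>z\<in>UNIV. pullback \<phi> \<omega>' z = c * \<omega> z" using eq by (simp add: diff_eq_def)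
  moreover have "\<forall>\<^sub>\<approx>z\<in>UNIV. pullback \<phi> \<omega>' z = K' * pullback \<phi> (dp q') z" by (rule cos[OF f])
  moreover have "\<forall>\<^sub>\<approx>z\<in>UNIV. pullback \<phi> (dp q') z = e * dp q z" by (rule cos[OF ek(3)])
  moreover have "\<forall>\<^sub>\<approx>z\<in>UNIV. \<omega> z = K * dp q z" by (rule cos[OF fin])
  \<comment> \<open>Away from a finite pole \<open>dp q z\<close> is nonzero and can be
    cancelled.\<close>
  moreover have "\<forall>\<^sub>\<approx>z\<in>UNIV. z \<noteq> aff_coord q" by (rule cos) simp
  ultimately have "\<forall>\<^sub>\<approx>z\<in>(UNIV::complex set). K' * e = c * K"
    by eventually_elim (cases q, auto)
  then have "K' * e = c * K" by (simp add: eventually_const)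
  moreover have "prim q' (\<phi> p') - prim q' (\<phi> p) = e * (prim q p' - prim q p)"
    by (simp add: ek(2) p algebra_simps)
  ultimately show ?thesis by (metis mult.assoc)
qed

text \<open>The local model \<open>dz\<close>: in the coordinate \<open>w = 1/z\<close> it is
  \<open>- dw / w^2\<close>. All components built in \<open>deform\<close> carry this
  differential.\<close>

lemma double_pole_only_one: "double_pole_only (\<lambda>_. 1) Inf"
proof -
  have inf: "\<forall>\<^sub>F z in at 0. pullback (centred_chart Inf) (\<lambda>_. 1) z = - 1 * (z - 0) powi - 2"
    unfolding eventually_at by (rule exI[of _ 1]) (auto simp: pullback_chart_Inf power_int_minus field_simps simp del: centred_chart.simps)
  have "pullback (centred_chart p) (\<lambda>_. 1) meromorphic_on {0}" for p
  proof (cases p)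
    case (Fin a)
    then show ?thesis by (simp only: pullback_chart_Fin meromorphic_on_const)
  next
    case Inf
    have "(\<lambda>z. - 1 * (z - 0) powi - 2 :: complex) meromorphic_on {0}" by (intro meromorphic_intros)
    moreover have "pullback (centred_chart Inf) (\<lambda>_. 1) meromorphic_on {0} \<longleftrightarrow>
        (\<lambda>z. - 1 * (z - 0) powi - 2 :: complex) meromorphic_on {0}"
      by (rule meromorphic_on_cong) (use inf in auto)
    ultimately show ?thesis by (simp only: Inf)
  qed
  moreover have "zorder (pullback (centred_chart Inf) (\<lambda>_. 1)) 0 = -2"
  proof -
    have "zorder (pullback (centred_chart Inf) (\<lambda>_. 1)) 0 =
        zorder (\<lambda>z::complex. - 1 * (z - 0) powi - 2) 0"
      by (rule zorder_cong[OF inf refl])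
    also have "\<dots> = -2" by (rule zorder_eqI[of UNIV _ "\<lambda>_. -1"]) auto
    finally show ?thesis .
  qed
  moreover have "zorder (pullback (centred_chart p) (\<lambda>_. 1)) 0 = 0" if "p \<noteq> Inf" for p
  proof (cases p)
    case (Fin a)
    have "zorder (\<lambda>_::complex. 1::complex) 0 = 0" by (rule zorder_eq_0I) auto
    then show ?thesis by (simp only: Fin pullback_chart_Fin)
  qed (use that in simp)
  moreover have "\<not> diff_eq (\<lambda>_. 1) (\<lambda>_. 0)" by (simp add: diff_eq_def eventually_False)
  ultimately show ?thesis
    by (simp add: double_pole_only_def meromorphic_differential_def diff_order_def del: centred_chart.simps)
qed

section \<open>Level trees given by a parent function\<close>

text \<open>A walk becomes simple by cutting it back to the earlier visit whenever a vertex recurs.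
  The set \<open>A\<close> confines the path, as needed for the connected fibers of
  contractions.\<close>

lemma reachable_simple_path:
  assumes "(a, b) \<in> {(x, y). (x, y) \<in> tadj \<Gamma> \<and> x \<in> A \<and> y \<in> A}\<^sup>*" "a \<in> A" "A \<subseteq> tverts \<Gamma>"
  shows "\<exists>xs. simple_path \<Gamma> xs a b \<and> set xs \<subseteq> A"
  using assms(1)
proof (induction rule: rtrancl_induct)
  case base
  show ?case using assms(2,3) by (intro exI[of _ "[a]"]) (auto simp: simple_path_def)
next
  case (step y z)
  then obtain xs where xs: "simple_path \<Gamma> xs a y" "set xs \<subseteq> A" by blast
  show ?case
  proof (cases "z \<in> set xs")
    case True
    then obtain ys zs where split: "xs = ys @ z # zs" by (meson split_list)
    have "simple_path \<Gamma> (ys @ [z]) a z"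
      using xs(1) unfolding split simple_path_def by (auto simp: successively_append_iff hd_append)
    then show ?thesis using xs(2) split by (intro exI[of _ "ys @ [z]"]) auto
  next
    case False
    then have "simple_path \<Gamma> (xs @ [z]) a z"
      using xs step.hyps(2) assms(3) unfolding simple_path_def
      by (auto simp: successively_append_iff)
    then show ?thesis using xs(2) step.hyps(2) by (intro exI[of _ "xs @ [z]"]) auto
  qed
qed

text \<open>The adjacency of a rooted tree is known from the parents of its vertices, and condition
  (a) on the preorder makes a parent strictly smaller. The parent function turns statements about
  simple paths into inductions on levels.\<close>

locale level_tree =
  fixes \<Gamma> :: ltree and par :: "nat \<Rightarrow> nat"
  assumes finite_verts: "finite (tverts \<Gamma>)"
    and root_in: "troot \<Gamma> \<in> tverts \<Gamma>"
    and par_in: "v \<in> tverts \<Gamma> \<Longrightarrow> v \<noteq> troot \<Gamma> \<Longrightarrow> par v \<in> tverts \<Gamma>"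
    and par_less: "v \<in> tverts \<Gamma> \<Longrightarrow> v \<noteq> troot \<Gamma> \<Longrightarrow> tless \<Gamma> (par v) v"
    and pre: "preorder_on (tverts \<Gamma>) (tle \<Gamma>)" and tot: "total_on (tverts \<Gamma>) (tle \<Gamma>)"
    and adj: "tadj \<Gamma> = {(v, w). v \<in> tverts \<Gamma> \<and> w \<in> tverts \<Gamma> \<and>
      ((v \<noteq> troot \<Gamma> \<and> w = par v) \<or> (w \<noteq> troot \<Gamma> \<and> v = par w))}"
begin

abbreviation "V \<equiv> tverts \<Gamma>"
abbreviation "r \<equiv> troot \<Gamma>"
abbreviation "lv \<equiv> tlevel \<Gamma>"

definition pstep :: "nat rel" where
  "pstep = {(v, par v) | v. v \<in> V \<and> v \<noteq> r}"

text \<open>The order written \<open>v \<subseteq> u\<close> on trees, generated by parents instead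
  of simple paths; \<open>below_iff\<close> shows that the two descriptions agree.\<close>

definition anc :: "nat \<Rightarrow> nat \<Rightarrow> bool" where
  "anc v u \<longleftrightarrow> u \<in> V \<and> (u, v) \<in> pstep\<^sup>*"

lemma le_cases: "v \<in> V \<Longrightarrow> w \<in> V \<Longrightarrow> tless \<Gamma> v w \<or> tequiv \<Gamma> v w \<or> tless \<Gamma> w v"
  using tot pre unfolding total_on_def preorder_on_def refl_on_def tless_def tequiv_def by (cases
      "v = w") auto

lemma le_trans: "(u, v) \<in> tle \<Gamma> \<Longrightarrow> (v, w) \<in> tle \<Gamma> \<Longrightarrow> (u, w) \<in> tle \<Gamma>"
  using pre unfolding preorder_on_def trans_def by blast

lemma le_refl: "v \<in> V \<Longrightarrow> (v, v) \<in> tle \<Gamma>"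
  using pre unfolding preorder_on_def refl_on_def by blast

lemma tclass_eq: "tequiv \<Gamma> v w \<Longrightarrow> tclass \<Gamma> v = tclass \<Gamma> w"
  unfolding tclass_def tequiv_def using le_trans by blast

lemma tclass_eq_iff: "v \<in> V \<Longrightarrow> w \<in> V \<Longrightarrow> tclass \<Gamma> v = tclass \<Gamma> w \<longleftrightarrow> tequiv \<Gamma> v w"
  using tclass_eq le_refl unfolding tclass_def tequiv_def by blast

lemma lv_mono: assumes "(v, w) \<in> tle \<Gamma>" shows "lv v \<le> lv w"
  unfolding tlevel_def
proof (rule card_mono)
  show "tclass \<Gamma> ` {u \<in> V. tless \<Gamma> u v} \<subseteq> tclass \<Gamma> ` {u \<in> V. tless \<Gamma> u w}"
    using assms le_trans unfolding tless_def by blast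
qed (use finite_verts in auto)

lemma lv_strict: assumes "v \<in> V" "w \<in> V" "tless \<Gamma> v w" shows "lv v < lv w"
  unfolding tlevel_def
proof (rule psubset_card_mono)
  have "tclass \<Gamma> ` {u \<in> V. tless \<Gamma> u v} \<subseteq> tclass \<Gamma> ` {u \<in> V. tless \<Gamma> u w}"
    using assms le_trans unfolding tless_def by blast
  moreover have "tclass \<Gamma> v \<in> tclass \<Gamma> ` {u \<in> V. tless \<Gamma> u w}" using assms by blast
  moreover have "tclass \<Gamma> v \<notin> tclass \<Gamma> ` {u \<in> V. tless \<Gamma> u v}"
  proof
    assume "tclass \<Gamma> v \<in> tclass \<Gamma> ` {u \<in> V. tless \<Gamma> u v}"
    then obtain u where "u \<in> V" "tless \<Gamma> u v" "tclass \<Gamma> v = tclass \<Gamma> u" by blast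
    then show False using tclass_eq_iff assms(1) unfolding tless_def tequiv_def by blast
  qed
  ultimately show "tclass \<Gamma> ` {u \<in> V. tless \<Gamma> u v} \<subset> tclass \<Gamma> ` {u \<in> V. tless \<Gamma> u w}" by blast
qed (use finite_verts in auto)

lemma lv_less_iff: "v \<in> V \<Longrightarrow> w \<in> V \<Longrightarrow> lv v < lv w \<longleftrightarrow> tless \<Gamma> v w"
  using lv_strict lv_mono le_cases unfolding tless_def tequiv_def by (metis leD)

lemma lv_le_iff: "v \<in> V \<Longrightarrow> w \<in> V \<Longrightarrow> lv v \<le> lv w \<longleftrightarrow> (v, w) \<in> tle \<Gamma>"
  using lv_less_iff[of w v] le_cases[of v w] unfolding tless_def tequiv_def
      by (auto simp: not_less[symmetric])

lemma lv_eq_iff: "v \<in> V \<Longrightarrow> w \<in> V \<Longrightarrow> lv v = lv w \<longleftrightarrow> tequiv \<Gamma> v w"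
  unfolding tequiv_def using lv_le_iff by (metis order_antisym_conv order_refl)

lemma lv_le_length: assumes "v \<in> V" shows "lv v \<le> tlength \<Gamma>"
proof -
  have "tclass \<Gamma> v \<notin> tclass \<Gamma> ` {u \<in> V. tless \<Gamma> u v}"
  proof
    assume "tclass \<Gamma> v \<in> tclass \<Gamma> ` {u \<in> V. tless \<Gamma> u v}"
    then obtain u where "u \<in> V" "tless \<Gamma> u v" "tclass \<Gamma> v = tclass \<Gamma> u" by blast
    then show False using tclass_eq_iff assms unfolding tless_def tequiv_def by blast
  qed
  then have "tclass \<Gamma> ` {u \<in> V. tless \<Gamma> u v} \<subset> tclass \<Gamma> ` V" using assms by blast
  then have "lv v < card (tclass \<Gamma> ` V)"
    unfolding tlevel_def by (rule psubset_card_mono[rotated]) (use finite_verts in auto)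
  then show ?thesis unfolding tlength_def by simp
qed

lemma lv_image: "lv ` V = {..tlength \<Gamma>}"
proof (rule card_subset_eq)
  show "lv ` V \<subseteq> {..tlength \<Gamma>}" using lv_le_length by auto
  have "card (lv ` V) = card (tclass \<Gamma> ` V)"
  proof (rule bij_betw_same_card)
    show "bij_betw (\<lambda>m. tclass \<Gamma> (SOME v. v \<in> V \<and> lv v = m)) (lv ` V) (tclass \<Gamma> ` V)"
    proof (rule bij_betw_imageI)
      have s: "(SOME v. v \<in> V \<and> lv v = lv u) \<in> V \<and> lv (SOME v. v \<in> V \<and> lv v = lv u) = lv u" if "u \<in> V"
          for u
        by (rule someI[of "\<lambda>v. v \<in> V \<and> lv v = lv u" u]) (use that in simp)
      then have t: "tclass \<Gamma> (SOME v. v \<in> V \<and> lv v = lv u) = tclass \<Gamma> u" if "u \<in> V" for u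
        using that tclass_eq_iff lv_eq_iff by blast
      show "inj_on (\<lambda>m. tclass \<Gamma> (SOME v. v \<in> V \<and> lv v = m)) (lv ` V)"
        by (rule inj_onI) (auto simp: t tclass_eq_iff lv_eq_iff)
      show "(\<lambda>m. tclass \<Gamma> (SOME v. v \<in> V \<and> lv v = m)) ` lv ` V = tclass \<Gamma> ` V"
        by (auto simp: t image_image)
    qed
  qed
  moreover have "card (tclass \<Gamma> ` V) > 0" using finite_verts root_in by (auto simp: card_gt_0_iff)
  ultimately show "card (lv ` V) = card {..tlength \<Gamma>}" by (simp add: tlength_def)
qed simp

lemma anc_refl [simp]: "v \<in> V \<Longrightarrow> anc v v" by (simp add: anc_def)

lemma anc_in: "anc v u \<Longrightarrow> u \<in> V \<and> v \<in> V"
proof -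
  assume "anc v u"
  then have "(u, v) \<in> pstep\<^sup>*" "u \<in> V" by (auto simp: anc_def)
  then show ?thesis by (induction rule: rtrancl_induct) (auto simp: pstep_def par_in)
qed

lemma anc_trans: "anc x v \<Longrightarrow> anc v u \<Longrightarrow> anc x u"
  unfolding anc_def by (meson rtrancl_trans)

lemma anc_par: "v \<in> V \<Longrightarrow> v \<noteq> r \<Longrightarrow> anc (par v) v"
  unfolding anc_def pstep_def by blast

lemma anc_step: "anc v u \<Longrightarrow> v = u \<or> (u \<noteq> r \<and> anc v (par u))"
proof -
  assume "anc v u"
  then have "(u, v) \<in> pstep\<^sup>*" "u \<in> V" by (auto simp: anc_def)
  then show ?thesis
    by (cases rule: converse_rtranclE) (auto simp: anc_def pstep_def par_in)
qed

lemma anc_top: "anc v u \<Longrightarrow> v = u \<or> (\<exists>w. w \<noteq> r \<and> w \<in> V \<and> par w = v \<and> anc w u)"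
proof -
  assume a: "anc v u"
  then have "(u, v) \<in> pstep\<^sup>*" "u \<in> V" by (auto simp: anc_def)
  then show ?thesis
    by (cases rule: rtranclE) (auto simp: anc_def pstep_def)
qed

lemma anc_lv: "anc v u \<Longrightarrow> v = u \<or> lv v < lv u"
proof -
  assume "anc v u"
  then have "(u, v) \<in> pstep\<^sup>*" "u \<in> V" by (auto simp: anc_def)
  then show ?thesis
  proof (induction rule: rtrancl_induct)
    case (step y z)
    then have z: "z = par y" "y \<noteq> r" "y \<in> V" by (auto simp: pstep_def)
    have "lv z < lv y" using lv_strict[of z y] par_less[OF z(3,2)] par_in[OF z(3,2)] z by simp
    then show ?case using step by auto
  qed simp
qed

lemma anc_antisym: "anc v u \<Longrightarrow> anc u v \<Longrightarrow> u = v"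
  by (auto dest!: anc_lv)

lemma anc_chain: "anc v u \<Longrightarrow> anc w u \<Longrightarrow> anc v w \<or> anc w v"
proof -
  assume a: "anc v u" "anc w u"
  have "single_valued pstep" by (auto simp: single_valued_def pstep_def)
  moreover have "(u, v) \<in> pstep\<^sup>*" "(u, w) \<in> pstep\<^sup>*" using a by (auto simp: anc_def)
  ultimately have "(v, w) \<in> pstep\<^sup>* \<or> (w, v) \<in> pstep\<^sup>*" by (rule single_valued_confluent)
  moreover have "v \<in> V" "w \<in> V" using a by (blast dest: anc_in)+
  ultimately show ?thesis by (auto simp: anc_def)
qed

text \<open>Along the chain of ancestors of \<open>u\<close> levels strictly increase, so at most
  one component of a given level lies below \<open>u\<close>. Components can therefore be addressed
  by a level and a marked point.\<close>

lemma anc_lv_eq: "anc v u \<Longrightarrow> anc w u \<Longrightarrow> lv v = lv w \<Longrightarrow> v = w"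
  using anc_chain anc_lv by (metis less_irrefl)

lemma anc_lv_le: "anc v u \<Longrightarrow> anc w u \<Longrightarrow> lv v \<le> lv w \<Longrightarrow> anc v w"
  using anc_chain anc_lv by (metis anc_in anc_refl leD)

lemma anc_root: "v \<in> V \<Longrightarrow> anc r v"
proof (induction "lv v" arbitrary: v rule: less_induct)
  case less
  show ?case
  proof (cases "v = r")
    case False
    then have "lv (par v) < lv v" using less(2) par_less par_in lv_less_iff by blast
    then have "anc r (par v)" using less par_in False by blast
    then show ?thesis using anc_par[OF less(2) False] anc_trans by blast
  qed (use root_in in simp)
qed

lemma anc_of_root: "anc v r \<Longrightarrow> v = r"
  using anc_step by blast

lemma par_neq: "v \<in> V \<Longrightarrow> v \<noteq> r \<Longrightarrow> \<not> anc v (par v)"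
  using anc_lv[of v "par v"] lv_strict[of "par v" v] par_in[of v] par_less[of v] by auto

text \<open>A path can leave the part above \<open>c\<close> only through the edge joining \<open>c\<close> to its parent.\<close>

lemma path_stays_above:
  assumes "successively (\<lambda>x y. (x, y) \<in> tadj \<Gamma>) xs" "xs \<noteq> []" "anc c (hd xs)" "c \<noteq> r" "par c \<notin> set xs"
  shows "\<forall>x\<in>set xs. anc c x"
  using assms
proof (induction xs rule: induct_list012)
  case (3 x y zs)
  have cy: "anc c y"
  proof -
    have xy: "(x, y) \<in> tadj \<Gamma>" using 3(3) by simp
    have cx: "anc c x" using 3(5) by simp
    from xy consider "x \<noteq> r" "y = par x" | "y \<noteq> r" "y \<in> V" "x = par y" unfolding adj by auto
    then show ?thesis
    proof cases
      case 1
      then show ?thesis using anc_step[OF cx] 3(7) by auto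
    next
      case 2
      then show ?thesis using anc_par[of y] cx anc_trans by blast
    qed
  qed
  have "\<forall>z\<in>set (y # zs). anc c z" by (rule 3(2)) (use 3(3,6,7) cy in simp_all)
  then show ?case using 3(5) by simp
qed auto

text \<open>The part above \<open>c\<close> can be entered only by the edge from
  \<open>par c\<close> to \<open>c\<close>, so a path avoiding \<open>c\<close> stays
  outside.\<close>

lemma path_stays_below:
  assumes "successively (\<lambda>x y. (x, y) \<in> tadj \<Gamma>) xs" "xs \<noteq> []" "\<not> anc c (hd xs)" "c \<notin> set xs"
  shows "\<forall>x\<in>set xs. \<not> anc c x"
  using assms
proof (induction xs rule: induct_list012)
  case (3 x y zs)
  have cy: "\<not> anc c y"
  proof
    assume cy: "anc c y"
    have xy: "(x, y) \<in> tadj \<Gamma>" using 3(3) by simp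
    have cx: "\<not> anc c x" using 3(5) by simp
    from xy consider "x \<noteq> r" "x \<in> V" "y = par x" | "y \<noteq> r" "y \<in> V" "x = par y" unfolding adj by auto
    then show False
    proof cases
      case 1
      then show ?thesis using anc_par[of x] cy cx anc_trans by blast
    next
      case 2
      then show ?thesis using anc_step[OF cy] 3(6) cx by auto
    qed
  qed
  have "\<forall>z\<in>set (y # zs). \<not> anc c z" by (rule 3(2)) (use 3(3,6) cy in simp_all)
  then show ?case using 3(5) by simp
qed auto

section \<open>Simple paths, the tree order and meets\<close>

text \<open>Every step of the path goes to the parent: a step to a child would confine the rest to
  the part above that child, since \<open>u\<close> is not visited again, and the root is not
  there.\<close>

lemma simple_path_root:
  assumes "simple_path \<Gamma> xs u r"
  shows "set xs = {v. anc v u}"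
  using assms
proof (induction "lv u" arbitrary: u xs rule: less_induct)
  case less
  have u: "u \<in> V" using less(2) by (auto simp: simple_path_def)
  obtain ys where xs: "xs = u # ys" using less(2) by (cases xs) (auto simp: simple_path_def)
  show ?case
  proof (cases "u = r")
    case True
    have "ys = []"
      using less(2) True unfolding xs simple_path_def by (cases ys rule: rev_cases) auto
    then show ?thesis using True xs u anc_of_root by auto
  next
    case False
    have ne: "ys \<noteq> []" using less(2) False unfolding xs simple_path_def by auto
    have suc: "successively (\<lambda>x y. (x, y) \<in> tadj \<Gamma>) ys" and h: "(u, hd ys) \<in> tadj \<Gamma>"
      using less(2) ne unfolding xs simple_path_def by (cases ys; auto)+
    have "\<not> (hd ys \<noteq> r \<and> u = par (hd ys))"
    proof
      assume *: "hd ys \<noteq> r \<and> u = par (hd ys)"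
      have "hd ys \<in> V" using less(2) ne unfolding xs simple_path_def by auto
      then have "\<forall>x\<in>set ys. anc (hd ys) x"
        using path_stays_above[OF suc ne, of "hd ys"] * less(2) unfolding xs simple_path_def by auto
      moreover have "r \<in> set ys" using less(2) ne unfolding xs simple_path_def
          by (metis last_ConsR last_in_set)
      ultimately show False using anc_of_root * by blast
    qed
    then have hp: "hd ys = par u" using h unfolding adj by auto
    have "simple_path \<Gamma> ys (par u) r"
      using less(2) ne suc hp unfolding xs simple_path_def by auto
    moreover have "lv (par u) < lv u" using u False par_less par_in lv_less_iff by blast
    ultimately have "set ys = {v. anc v (par u)}" using less(1) by blast
    then show ?thesis using xs anc_step[of _ u] anc_par[OF u False] anc_trans u by auto
  qed
qed

lemma path_up:
  assumes "anc v u" "\<And>x. anc v x \<Longrightarrow> anc x u \<Longrightarrow> x \<in> A"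
  shows "(u, v) \<in> {(x, y). (x, y) \<in> tadj \<Gamma> \<and> x \<in> A \<and> y \<in> A}\<^sup>*"
  using assms
proof (induction "lv u" arbitrary: u rule: less_induct)
  case less
  show ?case
  proof (cases "u = v")
    case False
    have u: "u \<in> V" using anc_in less(2) by blast
    have ur: "u \<noteq> r" and va: "anc v (par u)" using anc_step[OF less(2)] False by auto
    have "lv (par u) < lv u" using u ur par_less par_in lv_less_iff by blast
    moreover have "x \<in> A" if "anc v x" "anc x (par u)" for x
      using that less(3) anc_par[OF u ur] anc_trans by blast
    ultimately have "(par u, v) \<in> {(x, y). (x, y) \<in> tadj \<Gamma> \<and> x \<in> A \<and> y \<in> A}\<^sup>*"
      using less(1) va by blast
    moreover have "(u, par u) \<in> {(x, y). (x, y) \<in> tadj \<Gamma> \<and> x \<in> A \<and> y \<in> A}"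
      using less(2,3) va anc_par[OF u ur] u ur par_in by (auto simp: adj)
    ultimately show ?thesis by (rule converse_rtrancl_into_rtrancl[rotated])
  qed simp
qed

lemma adj_sym: "(x, y) \<in> tadj \<Gamma> \<Longrightarrow> (y, x) \<in> tadj \<Gamma>"
  unfolding adj by auto

lemma path_sym:
  assumes "(u, v) \<in> {(x, y). (x, y) \<in> tadj \<Gamma> \<and> x \<in> A \<and> y \<in> A}\<^sup>*"
  shows "(v, u) \<in> {(x, y). (x, y) \<in> tadj \<Gamma> \<and> x \<in> A \<and> y \<in> A}\<^sup>*"
  using assms
proof (rule symD[OF sym_rtrancl, rotated])
  show "sym {(x, y). (x, y) \<in> tadj \<Gamma> \<and> x \<in> A \<and> y \<in> A}" using adj_sym by (auto simp: sym_def)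
qed

lemma below_iff: "below \<Gamma> v u \<longleftrightarrow> anc v u"
proof
  assume "below \<Gamma> v u"
  then show "anc v u" unfolding below_def using simple_path_root by blast
next
  assume a: "anc v u"
  then have u: "u \<in> V" using anc_in by blast
  have "(u, r) \<in> {(x, y). (x, y) \<in> tadj \<Gamma> \<and> x \<in> V \<and> y \<in> V}\<^sup>*"
    by (rule path_up) (use anc_root[OF u] anc_in in auto)
  then obtain xs where "simple_path \<Gamma> xs u r"
    using reachable_simple_path u by blast
  then show "below \<Gamma> v u" unfolding below_def using simple_path_root a by blast
qed

text \<open>A greatest common ancestor, whereas \<open>tmeet\<close> asks only for a maximal one.
  Ancestors of a vertex form a chain, so the two notions agree.\<close>

definition meet_of :: "nat \<Rightarrow> nat \<Rightarrow> nat \<Rightarrow> bool" where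
  "meet_of w u v \<longleftrightarrow> anc w u \<and> anc w v \<and> (\<forall>x. anc x u \<and> anc x v \<longrightarrow> anc x w)"

lemma ex_meet:
  assumes "u \<in> V" "v \<in> V"
  obtains w where "meet_of w u v"
proof -
  let ?A = "{x. anc x u \<and> anc x v}"
  have "finite ?A" using finite_verts by (rule rev_finite_subset) (use anc_in in auto)
  moreover have "r \<in> ?A" using assms anc_root by auto
  ultimately have "Max (lv ` ?A) \<in> lv ` ?A" by (intro Max_in) blast+
  then obtain w where w: "w \<in> ?A" "lv w = Max (lv ` ?A)" by auto
  then have "\<forall>x\<in>?A. lv x \<le> lv w" using \<open>finite ?A\<close> by simp
  then have "meet_of w u v" unfolding meet_of_def using w anc_lv_le by blast
  then show thesis using that by blast
qed

lemma tmeet_eq: assumes "meet_of w u v" shows "tmeet \<Gamma> u v = w"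
  unfolding tmeet_def below_iff
proof (rule the_equality)
  show "anc w u \<and> anc w v \<and> (\<forall>x. anc x u \<and> anc x v \<and> anc w x \<longrightarrow> x = w)"
    using assms anc_antisym unfolding meet_of_def by blast
  fix w' assume w': "anc w' u \<and> anc w' v \<and> (\<forall>x. anc x u \<and> anc x v \<and> anc w' x \<longrightarrow> x = w')"
  then have "anc w' w" using assms unfolding meet_of_def by blast
  with w' assms show "w' = w" unfolding meet_of_def by blast
qed

lemma tmeet_meet: "u \<in> V \<Longrightarrow> v \<in> V \<Longrightarrow> meet_of (tmeet \<Gamma> u v) u v"
  using ex_meet tmeet_eq by metis

lemma tmeet_self: "u \<in> V \<Longrightarrow> tmeet \<Gamma> u u = u"
  by (rule tmeet_eq) (simp add: meet_of_def)

lemma tmeet_sym: "u \<in> V \<Longrightarrow> v \<in> V \<Longrightarrow> tmeet \<Gamma> u v = tmeet \<Gamma> v u"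
  using tmeet_meet[of v u] by (intro tmeet_eq) (auto simp: meet_of_def)

lemma terminal_iff: "terminal \<Gamma> v \<longleftrightarrow> v \<in> V \<and> (\<forall>w\<in>V. w \<noteq> r \<longrightarrow> par w \<noteq> v)"
proof
  assume "terminal \<Gamma> v"
  then show "v \<in> V \<and> (\<forall>w\<in>V. w \<noteq> r \<longrightarrow> par w \<noteq> v)"
    unfolding terminal_def below_iff using anc_par par_neq by (metis anc_refl)
next
  assume "v \<in> V \<and> (\<forall>w\<in>V. w \<noteq> r \<longrightarrow> par w \<noteq> v)"
  then show "terminal \<Gamma> v" unfolding terminal_def below_iff using anc_top by metis
qed

lemma ex_terminal_above:
  assumes "v \<in> V"
  obtains u where "terminal \<Gamma> u" "anc v u"
proof -
  let ?A = "{x. anc v x}"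
  have "finite ?A" using finite_verts by (rule rev_finite_subset) (use anc_in in auto)
  moreover have "v \<in> ?A" using assms by auto
  ultimately have "Max (lv ` ?A) \<in> lv ` ?A" by (intro Max_in) blast+
  then obtain w where w: "w \<in> ?A" "lv w = Max (lv ` ?A)" by auto
  then have mx: "\<forall>x\<in>?A. lv x \<le> lv w" using \<open>finite ?A\<close> by simp
  have "terminal \<Gamma> w" unfolding terminal_def below_iff
    using w(1) mx anc_in anc_trans anc_lv by (metis leD mem_Collect_eq)
  with w(1) that show thesis by blast
qed

lemma child_towards:
  assumes "anc v u" "v \<noteq> u"
  shows "\<exists>!c. c \<in> V \<and> c \<noteq> r \<and> par c = v \<and> anc c u"
proof -
  obtain c where c: "c \<in> V" "c \<noteq> r" "par c = v" "anc c u" using anc_top[OF assms(1)] assms(2) by auto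
  have "c' = c" if "c' \<in> V" "c' \<noteq> r" "par c' = v" "anc c' u" for c'
    using anc_chain[OF that(4) c(4)] anc_step[of c' c] anc_step[of c c'] c that par_neq by metis
  with c show ?thesis by blast
qed

text \<open>If the path went down to the parent of \<open>v\<close>, it could not come back above
  \<open>v\<close> without visiting \<open>v\<close> again; and from a child it can only reach what
  lies above that child.\<close>

lemma first_step_towards:
  assumes sp: "simple_path \<Gamma> (v # w # xs) v u" and a: "anc v u" "v \<noteq> u"
  shows "w \<in> V \<and> w \<noteq> r \<and> par w = v \<and> anc w u"
proof -
  have s: "successively (\<lambda>x y. (x, y) \<in> tadj \<Gamma>) (w # xs)" "v \<notin> set (w # xs)" "u \<in> set (w # xs)" "w \<in> V"
    using sp a(2) unfolding simple_path_def by (auto simp: successively_Cons)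
  have "(v, w) \<in> tadj \<Gamma>" using sp by (simp add: simple_path_def)
  then consider "v \<noteq> r" "v \<in> V" "w = par v" | "w \<noteq> r" "v = par w" unfolding adj by auto
  then show ?thesis
  proof cases
    case 1
    then have "\<not> anc v w" using par_neq by blast
    then show ?thesis using path_stays_below[OF s(1) _ _ s(2)] s(3) a(1) by auto
  next
    case 2
    then show ?thesis using path_stays_above[OF s(1), of w] s by auto
  qed
qed

lemma ex_path_towards:
  assumes "c \<in> V" "c \<noteq> r" "anc c u"
  shows "\<exists>xs. simple_path \<Gamma> (par c # c # xs) (par c) u"
proof -
  have "(u, c) \<in> {(x, y). (x, y) \<in> tadj \<Gamma> \<and> x \<in> {x. anc c x} \<and> y \<in> {x. anc c x}}\<^sup>*"
    by (rule path_up) (use assms in auto)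
  then obtain xs where xs: "simple_path \<Gamma> xs c u" "set xs \<subseteq> {x. anc c x}"
    using reachable_simple_path[OF path_sym, of u c "{x. anc c x}"] assms anc_in by auto
  obtain ys where ys: "xs = c # ys" using xs(1) by (cases xs) (auto simp: simple_path_def)
  have "par c \<notin> set xs" using xs(2) par_neq assms by blast
  then have "simple_path \<Gamma> (par c # c # ys) (par c) u"
    using xs(1) par_in assms unfolding ys simple_path_def by (auto simp: adj)
  then show ?thesis by blast
qed

end

section \<open>Marked trees, chains of partitions and contractions\<close>

text \<open>The ultrametric inequality \<open>ultra\<close> makes \<open>M i j \<ge> k\<close> an
  equivalence relation for every \<open>k \<le> len\<close>, and \<open>attained\<close> makes these
  relations strictly finer as \<open>k\<close> grows. This is the information in a chain of
  partitions.\<close>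

locale level_function =
  fixes n len :: nat and M :: "nat \<Rightarrow> nat \<Rightarrow> nat"
  assumes sym: "i \<in> {1..n} \<Longrightarrow> j \<in> {1..n} \<Longrightarrow> M i j = M j i"
    and self: "i \<in> {1..n} \<Longrightarrow> M i i = len"
    and le: "i \<in> {1..n} \<Longrightarrow> j \<in> {1..n} \<Longrightarrow> M i j \<le> len"
    and ultra: "i \<in> {1..n} \<Longrightarrow> j \<in> {1..n} \<Longrightarrow> k \<in> {1..n} \<Longrightarrow> m \<le> M i j \<Longrightarrow> m \<le> M j k \<Longrightarrow> m \<le> M i k"
    and attained: "m \<le> len \<Longrightarrow> \<exists>i\<in>{1..n}. \<exists>j\<in>{1..n}. M i j = m"
begin

definition rel :: "nat \<Rightarrow> nat rel" where
  "rel k = {(i, j). i \<in> {1..n} \<and> j \<in> {1..n} \<and> M i j \<ge> k}"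

definition part :: "nat \<Rightarrow> nat set set" where
  "part k = {1..n} // rel k"

lemma equiv_rel: assumes "k \<le> len" shows "equiv {1..n} (rel k)"
proof (rule equivI)
  show "rel k \<subseteq> {1..n} \<times> {1..n}" by (auto simp: rel_def)
  show "refl_on {1..n} (rel k)" using self assms by (auto simp: refl_on_def rel_def)
  show "Relation.sym (rel k)" using sym by (auto simp: sym_def rel_def)
  show "trans (rel k)"
  proof (rule transI)
    fix i j l assume "(i, j) \<in> rel k" "(j, l) \<in> rel k"
    then show "(i, l) \<in> rel k" using ultra[of i j l k] by (simp add: rel_def)
  qed
qed

lemma part_iff:
  assumes "k \<le> len" "i \<in> {1..n}" "j \<in> {1..n}"
  shows "(\<exists>B\<in>part k. i \<in> B \<and> j \<in> B) \<longleftrightarrow> k \<le> M i j"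
proof
  assume "\<exists>B\<in>part k. i \<in> B \<and> j \<in> B"
  then have "(i, j) \<in> rel k" unfolding part_def using quotient_eq_iff[OF equiv_rel[OF assms(1)]]
      by blast
  then show "k \<le> M i j" by (simp add: rel_def)
next
  assume "k \<le> M i j"
  then have "j \<in> rel k `` {i}" using assms by (simp add: rel_def)
  moreover have "i \<in> rel k `` {i}" using assms self by (simp add: rel_def)
  moreover have "rel k `` {i} \<in> part k" unfolding part_def using assms(2) by (rule quotientI)
  ultimately show "\<exists>B\<in>part k. i \<in> B \<and> j \<in> B" by blast
qed

lemma inj_part: "inj_on part {..len}"
proof -
  have "part k \<noteq> part k'" if "k < k'" "k' \<le> len" for k k'
  proof
    assume eq: "part k = part k'"
    obtain i j where "i \<in> {1..n}" "j \<in> {1..n}" "M i j = k"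
      using attained[of k] \<open>k < k'\<close> \<open>k' \<le> len\<close> by auto
    then show False using part_iff[of k i j] part_iff[of k' i j] eq that by auto
  qed
  then show ?thesis by (intro inj_onI) (metis atMost_iff linorder_neqE_nat)
qed

text \<open>A chain is a set without numbering, but its members are distinct and nested, so the
  number of those that keep \<open>i\<close> and \<open>j\<close> together recovers the
  level.\<close>

lemma level_card:
  assumes "i \<in> {1..n}" "j \<in> {1..n}"
  shows "M i j = card {P \<in> part ` {1..len}. \<exists>B\<in>P. i \<in> B \<and> j \<in> B}"
proof -
  have "{P \<in> part ` {1..len}. \<exists>B\<in>P. i \<in> B \<and> j \<in> B} = part ` {k \<in> {1..len}. \<exists>B\<in>part k. i \<in> B \<and> j \<in> B}"
    by blast
  also have "{k \<in> {1..len}. \<exists>B\<in>part k. i \<in> B \<and> j \<in> B} = {k \<in> {1..len}. k \<le> M i j}"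
    by (rule Collect_cong) (use part_iff[OF _ assms] in auto)
  also have "\<dots> = {1..M i j}" using le[OF assms] by auto
  finally have "{P \<in> part ` {1..len}. \<exists>B\<in>P. i \<in> B \<and> j \<in> B} = part ` {1..M i j}" .
  moreover have "inj_on part {1..M i j}"
    by (rule inj_on_subset[OF inj_part]) (use le[OF assms] in auto)
  ultimately show ?thesis by (simp add: card_image)
qed

lemma length_card: "len = card (part ` {1..len})"
proof -
  have "inj_on part {1..len}" by (rule inj_on_subset[OF inj_part]) auto
  then show ?thesis by (simp add: card_image)
qed

lemma partition_on_part: "k \<le> len \<Longrightarrow> partition_on {1..n} (part k)"
  unfolding part_def using equiv_rel partition_on_quotient by blast

text \<open>A pair of level \<open>0\<close> is separated by every member, so the one-block
  partition does not occur; refinement is monotonicity in \<open>k\<close>.\<close>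

lemma part_chain:
  assumes "len \<ge> 1"
  shows "part ` {1..len} \<in> partition_chains n"
proof -
  have "part k \<noteq> {{1..n}}" if "k \<in> {1..len}" for k
  proof
    assume eq: "part k = {{1..n}}"
    obtain i j where "i \<in> {1..n}" "j \<in> {1..n}" "M i j = 0" using attained[of 0] by auto
    then show False using part_iff[of k i j] eq that by auto
  qed
  then have "part ` {1..len} \<subseteq> partitions_minus n"
    using partition_on_part by (auto simp: partitions_minus_def)
  moreover have "refines {1..n} (part k') (part k)" if "k \<le> k'" "k' \<le> len" for k k'
  proof -
    have "\<exists>Y\<in>part k. X \<subseteq> Y" if "X \<in> part k'" for X
    proof -
      obtain i where i: "i \<in> {1..n}" "X = rel k' `` {i}" using \<open>X \<in> part k'\<close> unfolding part_def
          by (rule quotientE)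
      have "X \<subseteq> rel k `` {i}" using \<open>k \<le> k'\<close> i by (auto simp: rel_def)
      moreover have "rel k `` {i} \<in> part k" unfolding part_def using i(1) by (rule quotientI)
      ultimately show ?thesis by blast
    qed
    then show ?thesis using partition_on_part that unfolding refines_def by simp
  qed
  then have "\<forall>\<eta>\<in>part ` {1..len}. \<forall>\<pi>\<in>part ` {1..len}. refines {1..n} \<pi> \<eta> \<or> refines {1..n} \<eta> \<pi>"
    by (auto) (meson nat_le_linear)
  ultimately show ?thesis using assms by (auto simp: partition_chains_def)
qed

end

lemma level_function_determined:
  assumes "level_function n len M" "level_function n len' M'"
    and "level_function.part n M ` {1..len} = level_function.part n M' ` {1..len'}"
  shows "len = len'" "\<And>i j. i \<in> {1..n} \<Longrightarrow> j \<in> {1..n} \<Longrightarrow> M i j = M' i j"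
proof -
  show "len = len'" using level_function.length_card[OF assms(1)] level_function.length_card[OF assms(2)] assms(3) by simp
  show "M i j = M' i j" if "i \<in> {1..n}" "j \<in> {1..n}" for i j
    using level_function.level_card[OF assms(1) that] level_function.level_card[OF assms(2) that] assms(3) by simp
qed

section \<open>Marked trees and their level functions\<close>

definition mlev :: "ltree \<Rightarrow> nat \<Rightarrow> nat \<Rightarrow> nat" where
  "mlev \<Gamma> i j = tlevel \<Gamma> (tmeet \<Gamma> (tmark \<Gamma> i) (tmark \<Gamma> j))"

text \<open>The combinatorial content of a stable marked line. \<open>branching\<close> is stability
  of a nonterminal component: besides its descending node, or the point at infinity, it has at least
  two nodes.\<close>

locale marked_tree = level_tree +
  fixes n :: nat
  assumes terminal_equiv: "terminal \<Gamma> v \<Longrightarrow> terminal \<Gamma> w \<Longrightarrow> tequiv \<Gamma> v w"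
    and terminal_mark: "i \<in> {1..n} \<Longrightarrow> terminal \<Gamma> (tmark \<Gamma> i)"
    and marked_terminal: "terminal \<Gamma> v \<Longrightarrow> \<exists>i\<in>{1..n}. tmark \<Gamma> i = v"
    and branching: "v \<in> tverts \<Gamma> \<Longrightarrow> \<not> terminal \<Gamma> v \<Longrightarrow>
      \<exists>c c'. c \<in> tverts \<Gamma> \<and> c' \<in> tverts \<Gamma> \<and> c \<noteq> c' \<and> c \<noteq> troot \<Gamma> \<and> c' \<noteq> troot \<Gamma> \<and> par c = v \<and> par c' = v"
begin

abbreviation "h \<equiv> tmark \<Gamma>"
abbreviation "len \<equiv> tlength \<Gamma>"

lemma terminal_in: "terminal \<Gamma> v \<Longrightarrow> v \<in> V" by (simp add: terminal_def)

lemma terminal_anc: "terminal \<Gamma> v \<Longrightarrow> anc v u \<Longrightarrow> u = v"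
  unfolding terminal_def below_iff using anc_in by blast

text \<open>A vertex of the top level has nothing above it, and some terminal vertex lies above it;
  as terminal vertices are equivalent, all of them are on this level.\<close>

lemma terminal_level: "terminal \<Gamma> v \<longleftrightarrow> v \<in> V \<and> lv v = len"
proof -
  obtain w where w: "w \<in> V" "lv w = len" using lv_image by (metis atMost_iff imageE order_refl)
  obtain u where u: "terminal \<Gamma> u" "anc w u" using ex_terminal_above[OF w(1)] .
  have lu: "lv u = len" using anc_lv[OF u(2)] w lv_le_length[OF terminal_in[OF u(1)]] by auto
  show ?thesis
  proof
    assume t: "terminal \<Gamma> v"
    then have "lv v = lv u" using terminal_equiv[OF t u(1)] lv_eq_iff terminal_in u(1) by blast
    with t lu show "v \<in> V \<and> lv v = len" using terminal_in by simp
  next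
    assume v: "v \<in> V \<and> lv v = len"
    then obtain u' where u': "terminal \<Gamma> u'" "anc v u'" using ex_terminal_above by blast
    then have "v = u'" using anc_lv[OF u'(2)] v lv_le_length[OF terminal_in[OF u'(1)]] by auto
    with u' show "terminal \<Gamma> v" by simp
  qed
qed

lemma h_in: "i \<in> {1..n} \<Longrightarrow> h i \<in> V" using terminal_mark terminal_in by blast

lemma ex_mark_above: assumes "v \<in> V" shows "\<exists>i\<in>{1..n}. anc v (h i)"
  using ex_terminal_above[OF assms] marked_terminal by metis

text \<open>At a nonterminal \<open>v\<close>, branching provides a child not leading to
  \<open>h i\<close>; a mark above this child separates from \<open>i\<close> exactly at
  \<open>v\<close>. So every vertex is a meet of marks and the level function loses no
  vertex.\<close>

lemma ex_meet_at:
  assumes i: "i \<in> {1..n}" and v: "anc v (h i)"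
  shows "\<exists>j\<in>{1..n}. tmeet \<Gamma> (h i) (h j) = v"
proof (cases "terminal \<Gamma> v")
  case True
  then have "h i = v" using v terminal_anc by blast
  then show ?thesis using i tmeet_self[OF h_in[OF i]] by auto
next
  case False
  have vV: "v \<in> V" using anc_in v by blast
  have "v \<noteq> h i" using False terminal_mark[OF i] by auto
  then obtain c where c: "c \<in> V" "c \<noteq> r" "par c = v" "anc c (h i)"
    and uq: "\<And>c'. c' \<in> V \<Longrightarrow> c' \<noteq> r \<Longrightarrow> par c' = v \<Longrightarrow> anc c' (h i) \<Longrightarrow> c' = c"
    using child_towards[OF v] by metis
  obtain c' where c': "c' \<in> V" "c' \<noteq> r" "par c' = v" "c' \<noteq> c"
    using branching[OF vV False] by metis
  obtain j where j: "j \<in> {1..n}" "anc c' (h j)" using ex_mark_above[OF c'(1)] by blast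
  have vj: "anc v (h j)" using anc_par[OF c'(1,2)] c'(3) anc_trans j(2) by blast
  have "meet_of v (h i) (h j)" unfolding meet_of_def
  proof (intro conjI allI impI v vj)
    fix x assume x: "anc x (h i) \<and> anc x (h j)"
    show "anc x v"
    proof (rule ccontr)
      assume n: "\<not> anc x v"
      then have "anc v x" using x v anc_chain by blast
      moreover have "v \<noteq> x" using n vV by auto
      ultimately obtain d where d: "d \<in> V" "d \<noteq> r" "par d = v" "anc d x" using child_towards by blast
      then have "d = c" using uq x anc_trans by blast
      moreover have "anc d (h j)" using d(4) x anc_trans by blast
      moreover have "v \<noteq> h j" using c'(1-3) j(2) par_neq by metis
      ultimately have "c = c'" using child_towards[OF vj] d c' j(2) by metis
      then show False using c'(4) by simp
    qed
  qed
  then show ?thesis using tmeet_eq j(1) by blast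
qed

lemma meet_ij: "i \<in> {1..n} \<Longrightarrow> j \<in> {1..n} \<Longrightarrow> meet_of (tmeet \<Gamma> (h i) (h j)) (h i) (h j)"
  using tmeet_meet h_in by blast

text \<open>The meet of \<open>h i\<close> and \<open>h j\<close> is the last common component, and
  below \<open>h i\<close> the order is that of levels. Which marks lie above a component is thus
  read off from the level function.\<close>

lemma anc_meet_iff:
  assumes "i \<in> {1..n}" "j \<in> {1..n}" "anc v (h i)"
  shows "anc v (h j) \<longleftrightarrow> lv v \<le> mlev \<Gamma> i j"
proof
  note m = meet_ij[OF assms(1,2)]
  assume "anc v (h j)"
  then have "anc v (tmeet \<Gamma> (h i) (h j))" using m assms(3) unfolding meet_of_def by blast
  then show "lv v \<le> mlev \<Gamma> i j" unfolding mlev_def using anc_lv by fastforce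
next
  note m = meet_ij[OF assms(1,2)]
  assume "lv v \<le> mlev \<Gamma> i j"
  then have "anc v (tmeet \<Gamma> (h i) (h j))"
    using m assms(3) anc_lv_le unfolding meet_of_def mlev_def by blast
  then show "anc v (h j)" using m anc_trans unfolding meet_of_def by blast
qed

lemma mlev_sym: "i \<in> {1..n} \<Longrightarrow> j \<in> {1..n} \<Longrightarrow> mlev \<Gamma> i j = mlev \<Gamma> j i"
  unfolding mlev_def using tmeet_sym h_in by metis

lemma mlev_self: "i \<in> {1..n} \<Longrightarrow> mlev \<Gamma> i i = len"
  unfolding mlev_def using tmeet_self h_in terminal_mark terminal_level by metis

lemma meet_in: "i \<in> {1..n} \<Longrightarrow> j \<in> {1..n} \<Longrightarrow> tmeet \<Gamma> (h i) (h j) \<in> V"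
  using meet_ij anc_in unfolding meet_of_def by blast

lemma mlev_le: "i \<in> {1..n} \<Longrightarrow> j \<in> {1..n} \<Longrightarrow> mlev \<Gamma> i j \<le> len"
  unfolding mlev_def using lv_le_length meet_in by blast

text \<open>The meets of \<open>i\<close>, \<open>j\<close> and of \<open>j\<close>,
  \<open>k\<close> both lie below \<open>h j\<close>, so one of them is below the other and hence
  below \<open>h i\<close> and \<open>h k\<close>.\<close>

lemma mlev_ultra:
  assumes ijk: "i \<in> {1..n}" "j \<in> {1..n}" "k \<in> {1..n}" and "m \<le> mlev \<Gamma> i j" "m \<le> mlev \<Gamma> j k"
  shows "m \<le> mlev \<Gamma> i k"
proof -
  let ?a = "tmeet \<Gamma> (h i) (h j)" and ?b = "tmeet \<Gamma> (h j) (h k)"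
  note a = meet_ij[OF ijk(1,2)] and b = meet_ij[OF ijk(2,3)]
  have "anc ?a ?b \<or> anc ?b ?a" using a b anc_chain unfolding meet_of_def by blast
  then obtain x where x: "x \<in> {?a, ?b}" "anc x (h i)" "anc x (h k)"
    using a b anc_trans unfolding meet_of_def by blast
  then have "lv x \<le> mlev \<Gamma> i k" using anc_meet_iff[OF ijk(1,3)] by blast
  then show ?thesis using x(1) assms(4,5) by (auto simp: mlev_def)
qed

lemma mlev_attained: assumes "m \<le> len" shows "\<exists>i\<in>{1..n}. \<exists>j\<in>{1..n}. mlev \<Gamma> i j = m"
proof -
  obtain v where v: "v \<in> V" "lv v = m" using assms lv_image by (metis atMost_iff imageE)
  obtain i where "i \<in> {1..n}" "anc v (h i)" using ex_mark_above[OF v(1)] by blast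
  with ex_meet_at show ?thesis unfolding mlev_def using v(2) by metis
qed

lemma mlev_top: assumes "i \<in> {1..n}" "j \<in> {1..n}" shows "mlev \<Gamma> i j = len \<longleftrightarrow> h i = h j"
proof
  assume "mlev \<Gamma> i j = len"
  then have "lv (h i) \<le> mlev \<Gamma> i j" using terminal_level terminal_mark assms by simp
  then have "anc (h i) (h j)" using anc_meet_iff[OF assms, of "h i"] h_in[OF assms(1)] by simp
  then show "h i = h j" using terminal_anc terminal_mark assms by metis
next
  assume "h i = h j"
  then show "mlev \<Gamma> i j = len" using mlev_self[OF assms(1)] unfolding mlev_def by simp
qed

lemma level_function: "level_function n len (mlev \<Gamma>)"
  by unfold_locales (use mlev_sym mlev_self mlev_le mlev_ultra mlev_attained in blast)+

end

section \<open>Contractions as mergings of levels\<close>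

locale two_trees = A: marked_tree \<Gamma> par n + B: marked_tree \<Gamma>' par' n for \<Gamma> par n \<Gamma>' par'
begin

text \<open>Compatibility with the preorder yields \<open>g\<close>. The point is that meets are
  preserved: connectedness of the fibers prevents vertices on two branches leaving a vertex from
  being identified unless that vertex is identified with them.\<close>

lemma contraction_levels:
  assumes f: "contraction n \<Gamma> \<Gamma>' f"
  shows "\<exists>g. (\<forall>v\<in>tverts \<Gamma>. tlevel \<Gamma>' (f v) = g (tlevel \<Gamma> v)) \<and>
    (\<forall>i\<in>{1..n}. \<forall>j\<in>{1..n}. mlev \<Gamma>' i j = g (mlev \<Gamma> i j)) \<and>
    mono_on {..tlength \<Gamma>} g \<and> g ` {..tlength \<Gamma>} = {..tlength \<Gamma>'}"
proof -
  have im: "f ` tverts \<Gamma> = tverts \<Gamma>'" and mk: "\<And>i. i \<in> {1..n} \<Longrightarrow> f (tmark \<Gamma> i) = tmark \<Gamma>' i"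
    and ord: "\<And>v w. v \<in> tverts \<Gamma> \<Longrightarrow> w \<in> tverts \<Gamma> \<Longrightarrow> (v, w) \<in> tle \<Gamma> \<Longrightarrow> (f v, f w) \<in> tle \<Gamma>'"
    and ad: "\<And>v w. v \<in> tverts \<Gamma> \<Longrightarrow> w \<in> tverts \<Gamma> \<Longrightarrow> (v, w) \<in> tadj \<Gamma> \<Longrightarrow> f v = f w \<or> (f v, f w) \<in> tadj \<Gamma>'"
    and fib: "\<And>v w. v \<in> tverts \<Gamma> \<Longrightarrow> w \<in> tverts \<Gamma> \<Longrightarrow> f v = f w \<Longrightarrow>
        \<exists>xs. Defs.simple_path \<Gamma> xs v w \<and> (\<forall>x\<in>set xs. f x = f v)"
    using f unfolding contraction_def by blast+
  have fV: "f v \<in> B.V" if "v \<in> A.V" for v using im that by blast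
  define g where "g = (\<lambda>m. tlevel \<Gamma>' (f (SOME v. v \<in> A.V \<and> A.lv v = m)))"
  have g: "B.lv (f v) = g (A.lv v)" if v: "v \<in> A.V" for v
  proof -
    let ?s = "SOME u. u \<in> A.V \<and> A.lv u = A.lv v"
    have s: "?s \<in> A.V \<and> A.lv ?s = A.lv v"
      by (rule someI[of "\<lambda>u. u \<in> A.V \<and> A.lv u = A.lv v" v]) (use v in simp)
    then have "tequiv \<Gamma> ?s v" using A.lv_eq_iff v by blast
    then have "tequiv \<Gamma>' (f ?s) (f v)" using ord s v unfolding tequiv_def by blast
    then show ?thesis unfolding g_def using B.lv_eq_iff fV s v by metis
  qed
  have mono: "mono_on {..tlength \<Gamma>} g"
  proof (rule mono_onI)
    fix a b assume ab: "a \<in> {..tlength \<Gamma>}" "b \<in> {..tlength \<Gamma>}" "a \<le> b"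
    then obtain v w where vw: "v \<in> A.V" "A.lv v = a" "w \<in> A.V" "A.lv w = b" using A.lv_image
        by (metis imageE)
    then have "(f v, f w) \<in> tle \<Gamma>'" using ord A.lv_le_iff ab(3) by blast
    then have "B.lv (f v) \<le> B.lv (f w)" using B.lv_mono by blast
    then show "g a \<le> g b" using g vw by metis
  qed
  have onto: "g ` {..tlength \<Gamma>} = {..tlength \<Gamma>'}"
  proof -
    have "g ` A.lv ` A.V = B.lv ` f ` A.V" using g by (force simp: image_image)
    then show ?thesis using A.lv_image B.lv_image im by simp
  qed
  have root: "f A.r = B.r"
  proof -
    obtain v where v: "v \<in> A.V" "f v = B.r" using im B.root_in by (metis imageE)
    have "A.lv A.r \<le> A.lv v" using A.anc_lv[OF A.anc_root[OF v(1)]] by auto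
    then have "(f A.r, B.r) \<in> tle \<Gamma>'" using ord A.lv_le_iff A.root_in v by metis
    then have "B.lv (f A.r) \<le> B.lv B.r" using B.lv_mono by blast
    then show ?thesis using B.anc_lv[OF B.anc_root[OF fV[OF A.root_in]]] by auto
  qed
  \<comment> \<open>An edge that is not contracted keeps its direction, since otherwise the image of
    \<open>v\<close> would be strictly smaller than that of its parent.\<close>
  have fpar: "f (par v) = f v \<or> (f v \<noteq> B.r \<and> f (par v) = par' (f v))" if v: "v \<in> A.V" "v \<noteq> A.r" for v
  proof -
    have "(par v, v) \<in> tadj \<Gamma>" using v A.par_in by (simp add: A.adj)
    then consider "f (par v) = f v" | "(f (par v), f v) \<in> tadj \<Gamma>'" using ad v A.par_in by blast
    then show ?thesis
    proof cases
      case 2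
      have "\<not> (f (par v) \<noteq> B.r \<and> f v = par' (f (par v)))"
      proof
        assume *: "f (par v) \<noteq> B.r \<and> f v = par' (f (par v))"
        then have "tless \<Gamma>' (f v) (f (par v))" using B.par_less[of "f (par v)"] fV A.par_in v by metis
        moreover have "(f (par v), f v) \<in> tle \<Gamma>'" using ord A.par_in A.par_less v unfolding tless_def
            by blast
        ultimately show False unfolding tless_def by blast
      qed
      with 2 show ?thesis unfolding B.adj by auto
    qed simp
  qed
  have fanc: "B.anc (f x) (f u)" if "A.anc x u" for x u
    using that
  proof (induction "A.lv u" arbitrary: u rule: less_induct)
    case less
    have uV: "u \<in> A.V" using A.anc_in less(2) by blast
    show ?case
    proof (cases "x = u")
      case False
      then have u: "u \<noteq> A.r" "A.anc x (par u)" using A.anc_step[OF less(2)] by auto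
      have "A.lv (par u) < A.lv u" using A.lv_strict A.par_in A.par_less uV u(1) by blast
      then have IH: "B.anc (f x) (f (par u))" using less(1) u(2) by blast
      show ?thesis using fpar[OF uV u(1)]
      proof
        assume *: "f u \<noteq> B.r \<and> f (par u) = par' (f u)"
        then have "B.anc (par' (f u)) (f u)" using B.anc_par fV[OF uV] by blast
        then show ?thesis using IH * B.anc_trans by metis
      qed (use IH in simp)
    qed (use fV[OF uV] in simp)
  qed
  \<comment> \<open>Walking from \<open>x\<close> up to \<open>u\<close>, the image moves by at most
    one edge at a time and so meets every vertex between \<open>f x\<close> and
    \<open>f u\<close>.\<close>
  have lift: "\<exists>y. A.anc x y \<and> A.anc y u \<and> f y = y'" if "A.anc x u" "B.anc (f x) y'" "B.anc y' (f u)"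
      for x u y'
    using that
  proof (induction "A.lv u" arbitrary: u rule: less_induct)
    case less
    have uV: "u \<in> A.V" using A.anc_in less(2) by blast
    show ?case
    proof (cases "y' = f u")
      case True
      then show ?thesis using less(2) uV by (intro exI[of _ u]) simp
    next
      case False
      have "x \<noteq> u" using False less(3,4) B.anc_antisym by blast
      then have u: "u \<noteq> A.r" "A.anc x (par u)" using A.anc_step[OF less(2)] by auto
      have "A.lv (par u) < A.lv u" using A.lv_strict A.par_in A.par_less uV u(1) by blast
      moreover have "B.anc y' (f (par u))"
        using fpar[OF uV u(1)] B.anc_step[OF less(4)] False less(4) by auto
      ultimately obtain y where "A.anc x y" "A.anc y (par u)" "f y = y'"
          using less(1)[OF _ u(2) less(3)] by blast
      then show ?thesis using A.anc_par[OF uV u(1)] A.anc_trans by blast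
    qed
  qed
  have meet: "f (tmeet \<Gamma> (A.h i) (A.h j)) = tmeet \<Gamma>' (B.h i) (B.h j)" if ij: "i \<in> {1..n}" "j \<in> {1..n}"
      for i j
  proof (rule ccontr)
    let ?v = "tmeet \<Gamma> (A.h i) (A.h j)" and ?w = "tmeet \<Gamma>' (B.h i) (B.h j)"
    assume ne: "f ?v \<noteq> ?w"
    note mA = A.meet_ij[OF ij] and mB = B.meet_ij[OF ij]
    have vi: "A.anc ?v (A.h i)" "A.anc ?v (A.h j)" using mA unfolding A.meet_of_def by auto
    have wi: "B.anc ?w (f (A.h i))" "B.anc ?w (f (A.h j))" using mB mk ij unfolding B.meet_of_def
        by auto
    have "B.anc (f ?v) ?w" using fanc[OF vi(1)] fanc[OF vi(2)] mB mk ij unfolding B.meet_of_def by auto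
    with lift[OF vi(1)] lift[OF vi(2)] wi obtain y z where
      y: "A.anc ?v y" "A.anc y (A.h i)" "f y = ?w" and z: "A.anc ?v z" "A.anc z (A.h j)" "f z = ?w"
          by meson
    \<comment> \<open>The fiber over \<open>?w\<close> contains a vertex on each of the two branches
      leaving \<open>?v\<close> but not \<open>?v\<close> itself, although a path joining these
      vertices has to pass through \<open>?v\<close>.\<close>
    obtain xs where xs: "Defs.simple_path \<Gamma> xs y z" "\<forall>x\<in>set xs. f x = ?w"
      using fib[of y z] A.anc_in y z by metis
    have "?v \<noteq> y" using ne y by auto
    then obtain c where c: "c \<in> A.V" "c \<noteq> A.r" "par c = ?v" "A.anc c y" using A.child_towards[OF y(1)]
        by blast
    have "par c \<notin> set xs" using xs(2) c(3) ne by auto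
    then have "\<forall>x\<in>set xs. A.anc c x"
      using A.path_stays_above[of xs c] xs(1) c unfolding Defs.simple_path_def by auto
    then have "A.anc c z" using xs(1) unfolding Defs.simple_path_def by auto
    then have "A.anc c (A.h i)" "A.anc c (A.h j)" using A.anc_trans c(4) y z by blast+
    then have "A.anc c ?v" using mA unfolding A.meet_of_def by blast
    then show False using A.par_neq c by metis
  qed
  have "mlev \<Gamma>' i j = g (mlev \<Gamma> i j)" if ij: "i \<in> {1..n}" "j \<in> {1..n}" for i j
    using g[OF A.meet_in[OF ij]] meet[OF ij] unfolding mlev_def by simp
  with g mono onto show ?thesis by blast
qed

text \<open>The image of \<open>v\<close> has to be the component of level \<open>g (lv v)\<close>
  below any mark above \<open>v\<close>. It exists because \<open>v\<close> is the meet of two marks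
  and the level of their meet in \<open>\<Gamma>'\<close> is prescribed; all marks above
  \<open>v\<close> give the same component because \<open>g\<close> is monotone.\<close>

lemma ex_contraction:
  assumes mono: "mono_on {..tlength \<Gamma>} g" 
    and glev: "\<And>i j. i \<in> {1..n} \<Longrightarrow> j \<in> {1..n} \<Longrightarrow> mlev \<Gamma>' i j = g (mlev \<Gamma> i j)"
  shows "\<exists>f. contraction n \<Gamma> \<Gamma>' f"
proof -
  have gle: "g a \<le> g b" if "a \<le> b" "b \<le> tlength \<Gamma>" for a b using mono_onD[OF mono, of a b] that by auto
  define P where "P = (\<lambda>v (i, j). i \<in> {1..n} \<and> j \<in> {1..n} \<and> tmeet \<Gamma> (A.h i) (A.h j) = v)"
  define f where "f = (\<lambda>v. let (i, j) = (SOME p. P v p) in tmeet \<Gamma>' (B.h i) (B.h j))"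
  have fchar: "B.anc (f v) (B.h i) \<and> B.lv (f v) = g (A.lv v)" if i: "i \<in> {1..n}" and v:
      "A.anc v (A.h i)" for v i
  proof -
    have "\<exists>p. P v p" using A.ex_meet_at[OF i v] i unfolding P_def by blast
    then have "P v (SOME p. P v p)" by (rule someI_ex)
    then obtain k j where kj: "k \<in> {1..n}" "j \<in> {1..n}" "tmeet \<Gamma> (A.h k) (A.h j) = v"
        "f v = tmeet \<Gamma>' (B.h k) (B.h j)"
      unfolding P_def f_def by (auto split: prod.splits)
    have lv: "B.lv (f v) = g (A.lv v)" using glev[OF kj(1,2)] kj(3,4) unfolding mlev_def by simp
    have "A.anc v (A.h k)" using A.meet_ij[OF kj(1,2)] kj(3) unfolding A.meet_of_def by simp
    then have "A.lv v \<le> mlev \<Gamma> k i" using A.anc_meet_iff[OF kj(1) i] v by blast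
    then have "B.lv (f v) \<le> mlev \<Gamma>' k i" using gle A.mlev_le[OF kj(1) i] glev[OF kj(1) i] lv by simp
    moreover have "B.anc (f v) (B.h k)" using B.meet_ij[OF kj(1,2)] kj(4) unfolding B.meet_of_def
        by simp
    ultimately have "B.anc (f v) (B.h i)" using B.anc_meet_iff[OF kj(1) i] by blast
    with lv show ?thesis by simp
  qed
  have funiq: "f v = w" if "i \<in> {1..n}" "A.anc v (A.h i)" "B.anc w (B.h i)" "B.lv w = g (A.lv v)"
      for v w i
    using fchar[OF that(1,2)] that(3,4) B.anc_lv_eq by metis
  have lvf: "f v \<in> B.V \<and> B.lv (f v) = g (A.lv v)" if "v \<in> A.V" for v
    using A.ex_mark_above[OF that] fchar B.anc_in by blast
  have marks: "f (A.h i) = B.h i" if i: "i \<in> {1..n}" for i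
  proof (rule funiq[OF i])
    show "A.anc (A.h i) (A.h i)" "B.anc (B.h i) (B.h i)" using A.h_in B.h_in i by auto
    show "B.lv (B.h i) = g (A.lv (A.h i))"
      using glev[OF i i] A.mlev_self[OF i] B.mlev_self[OF i] A.terminal_level A.terminal_mark[OF i]
        B.terminal_level B.terminal_mark[OF i] by simp
  qed
  have onto: "f ` A.V = B.V"
  proof
    show "f ` A.V \<subseteq> B.V" using lvf by blast
    show "B.V \<subseteq> f ` A.V"
    proof
      fix w assume "w \<in> B.V"
      then obtain i where i: "i \<in> {1..n}" "B.anc w (B.h i)" using B.ex_mark_above by blast
      then obtain j where j: "j \<in> {1..n}" "tmeet \<Gamma>' (B.h i) (B.h j) = w" using B.ex_meet_at by blast
      have "f (tmeet \<Gamma> (A.h i) (A.h j)) = w"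
      proof (rule funiq[OF i(1) _ i(2)])
        show "A.anc (tmeet \<Gamma> (A.h i) (A.h j)) (A.h i)" using A.meet_ij[OF i(1) j(1)]
            unfolding A.meet_of_def by blast
        show "B.lv w = g (A.lv (tmeet \<Gamma> (A.h i) (A.h j)))" using glev[OF i(1) j(1)] j(2)
            unfolding mlev_def by simp
      qed
      then show "w \<in> f ` A.V" using A.meet_in[OF i(1) j(1)] by blast
    qed
  qed
  have ord: "(f v, f w) \<in> tle \<Gamma>'" if "v \<in> A.V" "w \<in> A.V" "(v, w) \<in> tle \<Gamma>" for v w
  proof -
    have "g (A.lv v) \<le> g (A.lv w)" using that A.lv_mono A.lv_le_length by (intro gle) auto
    then show ?thesis using lvf that B.lv_le_iff by metis
  qed
  \<comment> \<open>A vertex \<open>c\<close> strictly between the two images is the meet of two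
    marks, \<open>i\<close> among them. The meet of these marks in \<open>\<Gamma>\<close> lies
    below \<open>h i\<close> at a level strictly between those of \<open>par v\<close> and
    \<open>v\<close>, where there is no vertex.\<close>
  have adjp: "f (par v) = f v \<or> (f v \<noteq> B.r \<and> f (par v) = par' (f v))" if v: "v \<in> A.V" "v \<noteq> A.r" for v
  proof (rule disj_imp[THEN iffD2], rule impI)
    assume ne: "f (par v) \<noteq> f v"
    obtain i where i: "i \<in> {1..n}" "A.anc v (A.h i)" using A.ex_mark_above[OF v(1)] by blast
    have pi: "A.anc (par v) (A.h i)" using A.anc_par[OF v] i(2) A.anc_trans by blast
    note fv = fchar[OF i] and fp = fchar[OF i(1) pi]
    have "A.lv (par v) < A.lv v" using A.lv_strict A.par_in A.par_less v by blast
    then have "g (A.lv (par v)) \<le> g (A.lv v)" using A.lv_le_length[OF v(1)] by (intro gle) auto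
    then have "B.anc (f (par v)) (f v)" using B.anc_lv_le fv fp by metis
    then obtain c where c: "c \<in> B.V" "c \<noteq> B.r" "par' c = f (par v)" "B.anc c (f v)"
      using B.child_towards[OF _ ne] by blast
    have "c = f v"
    proof (rule ccontr)
      assume cv: "c \<noteq> f v"
      have ch: "B.anc c (B.h i)" using c(4) fv B.anc_trans by blast
      obtain j where j: "j \<in> {1..n}" "tmeet \<Gamma>' (B.h i) (B.h j) = c" using B.ex_meet_at[OF i(1) ch]
          by blast
      let ?x = "tmeet \<Gamma> (A.h i) (A.h j)"
      have x: "A.anc ?x (A.h i)" using A.meet_ij[OF i(1) j(1)] unfolding A.meet_of_def by blast
      have gx: "g (A.lv ?x) = B.lv c" using glev[OF i(1) j(1)] j(2) unfolding mlev_def by simp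
      have lt: "g (A.lv ?x) < g (A.lv v)" using B.anc_lv[OF c(4)] cv gx fv by auto
      have gt: "g (A.lv (par v)) < g (A.lv ?x)"
        using B.lv_strict[of "par' c" c] B.par_in[OF c(1,2)] B.par_less[OF c(1,2)] c gx fp by metis
      have "A.lv ?x < A.lv v" using lt gle[of "A.lv v" "A.lv ?x"] A.lv_le_length A.anc_in[OF x]
          by (meson leD not_less)
      moreover have "A.lv (par v) < A.lv ?x" using gt gle[of "A.lv ?x"
          "A.lv (par v)"] A.lv_le_length[OF A.par_in[OF v]] by (meson leD not_less)
      ultimately have "A.anc ?x v" "?x \<noteq> v" using A.anc_lv_le[OF x i(2)] by auto
      then have "A.anc ?x (par v)" using A.anc_step by blast
      then show False using A.anc_lv \<open>A.lv (par v) < A.lv ?x\<close> by fastforce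
    qed
    with c show "f v \<noteq> B.r \<and> f (par v) = par' (f v)" by auto
  qed
  have ad: "f v = f w \<or> (f v, f w) \<in> tadj \<Gamma>'" if "v \<in> A.V" "w \<in> A.V" "(v, w) \<in> tadj \<Gamma>" for v w
  proof -
    from that(3) consider "v \<noteq> A.r" "w = par v" | "w \<noteq> A.r" "v = par w" unfolding A.adj by auto
    then show ?thesis
      using adjp[OF that(1)] adjp[OF that(2)] lvf[OF that(1)] lvf[OF that(2)]
          by cases (auto simp: B.adj)
  qed
  have up: "(v, u) \<in> {(x, y). (x, y) \<in> tadj \<Gamma> \<and> x \<in> {x \<in> A.V. f x = f v} \<and> y \<in> {x \<in> A.V. f x = f v}}\<^sup>*"
    if uv: "A.anc u v" and lu: "g (A.lv u) = g (A.lv v)" for u v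
  proof (rule A.path_up[OF uv])
    fix x assume x: "A.anc u x" "A.anc x v"
    have vV: "v \<in> A.V" using A.anc_in uv by blast
    obtain i where i: "i \<in> {1..n}" "A.anc v (A.h i)" using A.ex_mark_above[OF vV] by blast
    have xi: "A.anc x (A.h i)" using A.anc_trans x(2) i(2) by blast
    have "A.lv u \<le> A.lv x" "A.lv x \<le> A.lv v" using A.anc_lv x by fastforce+
    then have "g (A.lv x) = g (A.lv v)" using gle lu A.lv_le_length vV by (metis le_antisym le_trans)
    then have "f x = f v" using funiq[OF i(1) xi] fchar[OF i] by metis
    then show "x \<in> {x \<in> A.V. f x = f v}" using A.anc_in x by blast
  qed
  have fib: "\<exists>xs. Defs.simple_path \<Gamma> xs v w \<and> (\<forall>x\<in>set xs. f x = f v)"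
    if vw: "v \<in> A.V" "w \<in> A.V" and eq: "f v = f w" for v w
  proof -
    obtain u where u: "A.meet_of u v w" using A.ex_meet[OF vw] by blast
    have uv: "A.anc u v" "A.anc u w" using u unfolding A.meet_of_def by auto
    have gv: "g (A.lv v) = g (A.lv w)" using lvf vw eq by metis
    \<comment> \<open>Marks above \<open>v\<close> and \<open>w\<close> meet at \<open>u\<close>; in
      \<open>\<Gamma>'\<close> both lie above \<open>f v = f w\<close>, so their meet there has
      level at least that of \<open>f v\<close>. Hence the meet \<open>u\<close> of \<open>v\<close>
      and \<open>w\<close> is in the fiber as well.\<close>
    have "g (A.lv u) = g (A.lv v)"
    proof (cases "u = v \<or> u = w")
      case False
      obtain i where i: "i \<in> {1..n}" "A.anc v (A.h i)" using A.ex_mark_above[OF vw(1)] by blast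
      obtain j where j: "j \<in> {1..n}" "A.anc w (A.h j)" using A.ex_mark_above[OF vw(2)] by blast
      have "A.meet_of u (A.h i) (A.h j)" unfolding A.meet_of_def
      proof (intro conjI allI impI)
        show "A.anc u (A.h i)" "A.anc u (A.h j)" using uv i j A.anc_trans by blast+
        fix x assume x: "A.anc x (A.h i) \<and> A.anc x (A.h j)"
        have nvw: "\<not> A.anc v w" "\<not> A.anc w v"
          using False u vw A.anc_antisym uv unfolding A.meet_of_def by (metis A.anc_refl)+
        have "A.anc x v"
        proof (rule ccontr)
          assume "\<not> A.anc x v"
          then have "A.anc v x" using x i A.anc_chain by blast
          then have "A.anc v (A.h j)" using x A.anc_trans by blast
          then show False using j A.anc_chain nvw by blast
        qed
        moreover have "A.anc x w"
        proof (rule ccontr)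
          assume "\<not> A.anc x w"
          then have "A.anc w x" using x j A.anc_chain by blast
          then have "A.anc w (A.h i)" using x A.anc_trans by blast
          then show False using i A.anc_chain nvw by blast
        qed
        ultimately show "A.anc x u" using u unfolding A.meet_of_def by blast
      qed
      then have "mlev \<Gamma> i j = A.lv u" unfolding mlev_def using A.tmeet_eq by simp
      then have "g (A.lv u) = mlev \<Gamma>' i j" using glev i(1) j(1) by simp
      moreover have "B.lv (f v) \<le> mlev \<Gamma>' i j"
        using B.anc_meet_iff[OF i(1) j(1), of "f v"] fchar[OF i] fchar[OF j] eq by simp
      moreover have "A.lv u \<le> A.lv v" using A.anc_lv uv by fastforce
      then have "g (A.lv u) \<le> g (A.lv v)" using gle A.lv_le_length vw by blast
      ultimately show ?thesis using lvf vw by fastforce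
    qed (use gv in auto)
    then have gu: "g (A.lv u) = g (A.lv v)" "g (A.lv u) = g (A.lv w)" using gv by simp_all
    have "(w, u) \<in> {(x, y). (x, y) \<in> tadj \<Gamma> \<and> x \<in> {x \<in> A.V. f x = f v} \<and> y \<in> {x \<in> A.V. f x = f v}}\<^sup>*"
      using up[OF uv(2) gu(2)] by (simp only: eq)
    then have "(u, w) \<in> {(x, y). (x, y) \<in> tadj \<Gamma> \<and> x \<in> {x \<in> A.V. f x = f v} \<and> y \<in> {x \<in> A.V. f x =
        f v}}\<^sup>*" by (rule A.path_sym)
    with up[OF uv(1) gu(1)]
    have "(v, w) \<in> {(x, y). (x, y) \<in> tadj \<Gamma> \<and> x \<in> {x \<in> A.V. f x = f v} \<and> y \<in> {x \<in> A.V. f x = f v}}\<^sup>*"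
        by (rule rtrancl_trans)
    from reachable_simple_path[OF this] vw(1) show ?thesis by blast
  qed
  have "contraction n \<Gamma> \<Gamma>' f"
    unfolding contraction_def using onto marks ord ad fib by blast
  then show ?thesis by blast
qed

end

section \<open>Multiscaled lines\<close>

lemma dual_tree_sel [simp]:
  "tverts (dual_tree S) = comps S" "troot (dual_tree S) = fst (pinf S)" "tle (dual_tree S) = mle S"
  "tmark (dual_tree S) i = fst (marks S i)"
  "tadj (dual_tree S) = {(v, w). \<exists>a b. {(v, a), (w, b)} \<in> nodes S \<and> (v, a) \<noteq> (w, b)}"
  by (simp_all add: dual_tree_def)

text \<open>In genus 0 every node is the descending node of exactly one component: \<open>par v\<close> is the
  component below \<open>v\<close>, and \<open>dpt v\<close> and \<open>apt v\<close> are the two branches of the descending node of \<open>v\<close>.\<close>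

definition node_structure :: "mline \<Rightarrow> (nat \<Rightarrow> nat) \<Rightarrow> (nat \<Rightarrow> P1) \<Rightarrow> (nat \<Rightarrow> P1) \<Rightarrow> bool" where
  "node_structure S par apt dpt \<longleftrightarrow>
     nodes S = (\<lambda>v. {(v, dpt v), (par v, apt v)}) ` (comps S - {fst (pinf S)}) \<and>
     (\<forall>v\<in>comps S - {fst (pinf S)}. par v \<in> comps S \<and> tless (dual_tree S) (par v) v)"

text \<open>Genus 0 leaves one node fewer than there are components. Every component except the root
  has a descending node, and two components cannot share one, since each would be strictly smaller
  than the other; so by counting there are no other nodes.\<close>

lemma ex_node_structure:
  assumes "multiscaled_line S"
  shows "\<exists>par apt dpt. node_structure S par apt dpt"
proof -
  let ?W = "comps S - {fst (pinf S)}"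
  have gd: "finite (comps S)" "comps S \<noteq> {}" "finite (nodes S)" "\<forall>e\<in>nodes S. e \<subseteq> comps S \<times> UNIV"
    and root: "fst (pinf S) \<in> comps S"
    and gen: "arithmetic_genus S = 0"
    and ex1: "\<forall>v\<in>comps S. v \<noteq> troot (dual_tree S) \<longrightarrow> (\<exists>!w. (v, w) \<in> tadj (dual_tree S) \<and>
        tless (dual_tree S) w v)"
    using assms unfolding multiscaled_line_def glueing_data_def smooth_point_def
    by (simp_all add: ball_conj_distrib del: dual_tree_sel)
  have ex: "\<exists>w. (v, w) \<in> tadj (dual_tree S) \<and> tless (dual_tree S) w v" if "v \<in> ?W" for v
    using ex1_implies_ex[OF ex1[rule_format, of v]] that by auto
  have "\<forall>v\<in>?W. \<exists>t. {(v, fst t), (fst (snd t), snd (snd t))} \<in> nodes S \<and>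
      tless (dual_tree S) (fst (snd t)) v"
  proof
    fix v assume "v \<in> ?W"
    then obtain w a b where "{(v, a), (w, b)} \<in> nodes S" "tless (dual_tree S) w v"
      using ex[of v] by auto
    then show "\<exists>t. {(v, fst t), (fst (snd t), snd (snd t))} \<in> nodes S \<and>
        tless (dual_tree S) (fst (snd t)) v"
      by (intro exI[of _ "(a, w, b)"]) simp
  qed
  then obtain t where t: "\<And>v. v \<in> ?W \<Longrightarrow> {(v, fst (t v)), (fst (snd (t v)), snd (snd (t v)))} \<in> nodes S"
    "\<And>v. v \<in> ?W \<Longrightarrow> tless (dual_tree S) (fst (snd (t v))) v"
    by metis
  define N where "N = (\<lambda>v. {(v, fst (t v)), (fst (snd (t v)), snd (snd (t v)))})"
  have inj: "inj_on N ?W"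
  proof (rule inj_onI, rule ccontr)
    fix v v' assume *: "v \<in> ?W" "v' \<in> ?W" "N v = N v'" "v \<noteq> v'"
    then have "v' = fst (snd (t v))" "v = fst (snd (t v'))" unfolding N_def
        by (auto simp: doubleton_eq_iff prod_eq_iff)
    then show False using t(2)[OF *(1)] t(2)[OF *(2)] unfolding tless_def by metis
  qed
  have "card (nodes S) = card ?W"
    using gen root gd(1) card_Suc_Diff1[OF gd(1) root] by (simp add: arithmetic_genus_def)
  then have "N ` ?W = nodes S"
    using card_subset_eq[OF gd(3), of "N ` ?W"] t(1) card_image[OF inj] unfolding N_def by auto
  moreover have "fst (snd (t v)) \<in> comps S" if "v \<in> ?W" for v
    using bspec[OF gd(4) t(1)[OF that]] by (simp add: mem_Times_iff)
  ultimately have "node_structure S (\<lambda>v. fst (snd (t v))) (\<lambda>v. snd (snd (t v))) (\<lambda>v. fst (t v))"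
    unfolding node_structure_def N_def using t(2) by auto
  then show ?thesis by blast
qed

context
  fixes S par apt dpt
  assumes ns: "node_structure S par apt dpt"
begin

lemma ns_nodes: "nodes S = (\<lambda>v. {(v, dpt v), (par v, apt v)}) ` (comps S - {fst (pinf S)})"
  and ns_par: "v \<in> comps S \<Longrightarrow> v \<noteq> fst (pinf S) \<Longrightarrow> par v \<in> comps S"
  and ns_less: "v \<in> comps S \<Longrightarrow> v \<noteq> fst (pinf S) \<Longrightarrow> tless (dual_tree S) (par v) v"
  using ns unfolding node_structure_def by auto

lemma ns_neq: "v \<in> comps S \<Longrightarrow> v \<noteq> fst (pinf S) \<Longrightarrow> par v \<noteq> v"
  using ns_less unfolding tless_def by metis

lemma ns_node_iff:
  "{(v, a), (w, b)} \<in> nodes S \<longleftrightarrow>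
    (v \<in> comps S \<and> v \<noteq> fst (pinf S) \<and> w = par v \<and> a = dpt v \<and> b = apt v) \<or>
    (w \<in> comps S \<and> w \<noteq> fst (pinf S) \<and> v = par w \<and> b = dpt w \<and> a = apt w)"
  unfolding ns_nodes by (auto simp: doubleton_eq_iff)

lemma ns_inj: "inj_on (\<lambda>v. {(v, dpt v), (par v, apt v)}) (comps S - {fst (pinf S)})"
proof (rule inj_onI, rule ccontr)
  fix v v' assume *: "v \<in> comps S - {fst (pinf S)}" "v' \<in> comps S - {fst (pinf S)}"
    "{(v, dpt v), (par v, apt v)} = {(v', dpt v'), (par v', apt v')}" "v \<noteq> v'"
  then have "v' = par v" "v = par v'" by (auto simp: doubleton_eq_iff)
  then show False using ns_less[of v] ns_less[of v'] * unfolding tless_def by auto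
qed

lemma ns_adj: "tadj (dual_tree S) = {(v, w). v \<in> comps S \<and> w \<in> comps S \<and>
      ((v \<noteq> fst (pinf S) \<and> w = par v) \<or> (w \<noteq> fst (pinf S) \<and> v = par w))}"
proof (intro set_eqI iffI)
  fix e assume "e \<in> tadj (dual_tree S)"
  then show "e \<in> {(v, w). v \<in> comps S \<and> w \<in> comps S \<and>
      ((v \<noteq> fst (pinf S) \<and> w = par v) \<or> (w \<noteq> fst (pinf S) \<and> v = par w))}"
    using ns_par by (auto simp: ns_node_iff)
next
  fix e assume "e \<in> {(v, w). v \<in> comps S \<and> w \<in> comps S \<and>
      ((v \<noteq> fst (pinf S) \<and> w = par v) \<or> (w \<noteq> fst (pinf S) \<and> v = par w))}"
  then obtain v w where e: "e = (v, w)" "v \<in> comps S" "w \<in> comps S"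
    "(v \<noteq> fst (pinf S) \<and> w = par v) \<or> (w \<noteq> fst (pinf S) \<and> v = par w)" by blast
  from e(4) have "\<exists>a b. {(v, a), (w, b)} \<in> nodes S \<and> v \<noteq> w"
    using e(2,3) ns_neq[of v] ns_neq[of w] unfolding ns_node_iff by metis
  then show "e \<in> tadj (dual_tree S)" using e(1) by auto
qed

lemma ns_num_nodes: "num_nodes S v = card {w \<in> comps S - {fst (pinf S)}. w = v \<or> par w = v}"
proof -
  let ?N = "\<lambda>v. {(v, dpt v), (par v, apt v)}"
  have "{e \<in> nodes S. \<exists>a. (v, a) \<in> e} = ?N ` {w \<in> comps S - {fst (pinf S)}. w = v \<or> par w = v}"
    unfolding ns_nodes by auto
  moreover have "inj_on ?N {w \<in> comps S - {fst (pinf S)}. w = v \<or> par w = v}"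
    by (rule inj_on_subset[OF ns_inj]) auto
  ultimately show ?thesis unfolding num_nodes_def by (simp add: card_image)
qed

lemma ns_descending: "v \<in> comps S \<Longrightarrow> v \<noteq> fst (pinf S) \<Longrightarrow> descending_point S v = dpt v"
  unfolding descending_point_def
proof (rule the_equality)
  assume v: "v \<in> comps S" "v \<noteq> fst (pinf S)"
  show "\<exists>w b. {(v, dpt v), (w, b)} \<in> nodes S \<and> tless (dual_tree S) w v"
    using v ns_less by (intro exI[of _ "par v"] exI[of _ "apt v"]) (simp add: ns_node_iff)
  fix a assume "\<exists>w b. {(v, a), (w, b)} \<in> nodes S \<and> tless (dual_tree S) w v"
  then obtain w b where wb: "{(v, a), (w, b)} \<in> nodes S" "tless (dual_tree S) w v" by blast
  from wb(1) show "a = dpt v"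
    unfolding ns_node_iff using wb(2) ns_less[of w] unfolding tless_def by auto
qed

end

section \<open>The tree and the branch points of a stable line\<close>

locale line =
  fixes n S par apt dpt
  assumes stable: "stable_line n S" and ns: "node_structure S par apt dpt"
begin

lemma marked: "marked_line n S" and ms: "multiscaled_line S"
  using stable by (auto simp: stable_line_def marked_line_def)

sublocale marked_tree "dual_tree S" par n
proof
  show "finite (tverts (dual_tree S))" "troot (dual_tree S) \<in> tverts (dual_tree S)"
    "preorder_on (tverts (dual_tree S)) (tle (dual_tree S))"
        "total_on (tverts (dual_tree S)) (tle (dual_tree S))"
    using ms by (auto simp: multiscaled_line_def glueing_data_def smooth_point_def)
  show "par v \<in> tverts (dual_tree S)" "tless (dual_tree S) (par v) v"
    if "v \<in> tverts (dual_tree S)" "v \<noteq> troot (dual_tree S)" for v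
    using that ns_par[OF ns] ns_less[OF ns] by auto
  show "tadj (dual_tree S) = {(v, w). v \<in> tverts (dual_tree S) \<and> w \<in> tverts (dual_tree S) \<and>
      ((v \<noteq> troot (dual_tree S) \<and> w = par v) \<or> (w \<noteq> troot (dual_tree S) \<and> v = par w))}"
    unfolding ns_adj[OF ns] by simp
  show "tequiv (dual_tree S) v w" if "terminal (dual_tree S) v" "terminal (dual_tree S) w" for v w
    using ms that unfolding multiscaled_line_def by blast
  show "terminal (dual_tree S) (tmark (dual_tree S) i)" if "i \<in> {1..n}" for i
    using marked that by (simp add: marked_line_def)
  show "\<exists>i\<in>{1..n}. tmark (dual_tree S) i = v" if "terminal (dual_tree S) v" for v
  proof -
    have "v \<in> comps S" using that by (simp add: terminal_def)
    then show ?thesis using stable that unfolding stable_line_def by (auto split: if_splits)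
  qed
  show "\<exists>c c'. c \<in> tverts (dual_tree S) \<and> c' \<in> tverts (dual_tree S) \<and> c \<noteq> c' \<and> c \<noteq> troot (dual_tree S) \<and>
      c' \<noteq> troot (dual_tree S) \<and> par c = v \<and> par c' = v"
    if v: "v \<in> tverts (dual_tree S)" "\<not> terminal (dual_tree S) v" for v
  proof -
    \<comment> \<open>The nodes on \<open>v\<close> are the descending nodes of its children and,
      unless \<open>v\<close> is the root, its own. Without the latter, stability leaves two
      children in both cases.\<close>
    let ?C = "{w \<in> comps S - {fst (pinf S)}. par w = v}"
    let ?D = "{w \<in> comps S - {fst (pinf S)}. w = v \<or> par w = v}"
    have fin: "finite (comps S)" using ms by (auto simp: multiscaled_line_def glueing_data_def)
    have nn: "num_nodes S v \<ge> 3 \<or> (num_nodes S v \<ge> 2 \<and> fst (pinf S) = v)"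
      using stable v unfolding stable_line_def by (auto split: if_splits)
    have "card ?C \<ge> 2"
    proof (cases "fst (pinf S) = v")
      case True
      then have "?D = ?C" by auto
      then have "num_nodes S v = card ?C" by (simp only: ns_num_nodes[OF ns])
      then show ?thesis using nn by linarith
    next
      case False
      have "?D \<subseteq> insert v ?C" by auto
      then have "card ?D \<le> card (insert v ?C)" using fin by (intro card_mono) auto
      also have "\<dots> \<le> Suc (card ?C)" using fin by (simp add: card_insert_if)
      finally have "num_nodes S v \<le> Suc (card ?C)" by (simp only: ns_num_nodes[OF ns])
      then show ?thesis using nn False by linarith
    qed
    then have "\<not> card ?C \<le> Suc 0" by simp
    moreover have "finite ?C" using fin by simp
    ultimately have "\<not> (\<forall>x\<in>?C. \<forall>y\<in>?C. x = y)" using card_le_Suc0_iff_eq by blast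
    then obtain c c' where "c \<in> ?C" "c' \<in> ?C" "c \<noteq> c'" by blast
    then show ?thesis by auto
  qed
qed

lemma mem_nodes: "v \<in> comps S \<Longrightarrow> v \<noteq> fst (pinf S) \<Longrightarrow> {(v, dpt v), (par v, apt v)} \<in> nodes S"
  unfolding ns_nodes[OF ns] by auto

lemma pole_point_eq: "v \<in> comps S \<Longrightarrow> pole_point S v = (if v = fst (pinf S) then snd (pinf S) else dpt v)"
  by (simp add: pole_point_def ns_descending[OF ns])

lemma nodes_disjoint:
  assumes "v \<in> comps S" "v \<noteq> fst (pinf S)" "w \<in> comps S" "w \<noteq> fst (pinf S)" "v \<noteq> w"
  shows "{(v, dpt v), (par v, apt v)} \<inter> {(w, dpt w), (par w, apt w)} = {}"
proof -
  have "pairwise disjnt (nodes S)" using ms by (simp add: multiscaled_line_def glueing_data_def)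
  moreover have "{(v, dpt v), (par v, apt v)} \<noteq> {(w, dpt w), (par w, apt w)}"
    using inj_onD[OF ns_inj[OF ns], of v w] assms by auto
  ultimately show ?thesis
    using mem_nodes[OF assms(1,2)] mem_nodes[OF assms(3,4)] unfolding pairwise_def disjnt_def by metis
qed

lemma at_not_pole:
  assumes "c \<in> comps S" "c \<noteq> fst (pinf S)"
  shows "apt c \<noteq> pole_point S (par c)"
proof (cases "par c = fst (pinf S)")
  case True
  have "pinf S \<notin> \<Union>(nodes S)" using ms by (simp add: multiscaled_line_def smooth_point_def)
  then have "(par c, apt c) \<noteq> pinf S" using mem_nodes[OF assms] by auto
  then show ?thesis using True by (auto simp: pole_point_def prod_eq_iff)
next
  case False
  have pc: "par c \<in> comps S" using ns_par[OF ns assms] .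
  have "(par c, dpt (par c)) \<noteq> (par c, apt c)"
    using nodes_disjoint[OF pc False assms] ns_neq[OF ns assms] by auto
  then show ?thesis using pole_point_eq[OF pc] False by auto
qed

lemma mark_not_pole:
  assumes i: "i \<in> {1..n}"
  shows "snd (marks S i) \<noteq> pole_point S (fst (marks S i))"
proof -
  have m: "smooth_point S (marks S i)" "marks S i \<noteq> pinf S" using marked i
      by (auto simp: marked_line_def)
  have c: "fst (marks S i) \<in> comps S" using m by (simp add: smooth_point_def)
  show ?thesis
  proof (cases "fst (marks S i) = fst (pinf S)")
    case True
    then show ?thesis using m(2) by (simp add: pole_point_def prod_eq_iff)
  next
    case False
    then have "(fst (marks S i), dpt (fst (marks S i))) \<noteq> marks S i"
      using mem_nodes[OF c False] m(1) unfolding smooth_point_def by auto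
    then show ?thesis using pole_point_eq[OF c] False by (auto simp: prod_eq_iff)
  qed
qed

lemma node_towards_eq:
  assumes c: "c \<in> comps S" "c \<noteq> fst (pinf S)" "anc c u"
  shows "node_towards S (par c) u = apt c"
  unfolding node_towards_def
proof (rule the_equality)
  obtain xs where "Defs.simple_path (dual_tree S) (par c # c # xs) (par c) u"
    using ex_path_towards[of c u] c by auto
  then show "\<exists>w b xs. Defs.simple_path (dual_tree S) (par c # w # xs) (par c) u \<and>
      {(par c, apt c), (w, b)} \<in> nodes S"
    using mem_nodes[OF c(1,2)] by (intro exI[of _ c] exI[of _
        "dpt c"] exI[of _ xs]) (simp add: insert_commute)
  fix a assume "\<exists>w b xs. Defs.simple_path (dual_tree S) (par c # w # xs) (par c) u \<and>
      {(par c, a), (w, b)} \<in> nodes S"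
  then obtain w b xs where w: "Defs.simple_path (dual_tree S) (par c # w # xs) (par c) u"
    "{(par c, a), (w, b)} \<in> nodes S" by blast
  have pu: "anc (par c) u" "par c \<noteq> u"
    using anc_par[of c] anc_trans[OF _ c(3)] c par_neq[of c] by auto
  have wc: "w \<in> comps S \<and> w \<noteq> fst (pinf S) \<and> par w = par c \<and> anc w u"
    using first_step_towards[OF w(1) pu] by simp
  then have "w = c" using child_towards[OF pu] c by auto
  with w(2) show "a = apt c"
    unfolding ns_node_iff[OF ns] using par_neq[of "par c"] anc_par[of c] c(1,2) by auto
qed

text \<open>The points \<open>n_i\<close> in the definition of \<open>I_map\<close>, but for every
  component \<open>v\<close> below the mark \<open>i\<close> and not just a meet: the mark itself,
  or the node towards it. For other \<open>v\<close> the value is meaningless.\<close>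

definition dir_point :: "nat \<Rightarrow> nat \<Rightarrow> P1" where
  "dir_point v i = (if v = h i then snd (marks S i)
     else apt (THE c. c \<in> comps S \<and> c \<noteq> fst (pinf S) \<and> par c = v \<and> anc c (h i)))"

lemma dir_point_child:
  assumes "c \<in> comps S" "c \<noteq> fst (pinf S)" "anc c (h i)"
  shows "dir_point (par c) i = apt c"
proof -
  have pu: "anc (par c) (h i)" "par c \<noteq> h i"
    using anc_par[of c] anc_trans[OF _ assms(3)] assms par_neq[of c] by auto
  have "(THE c'. c' \<in> comps S \<and> c' \<noteq> fst (pinf S) \<and> par c' = par c \<and> anc c' (h i)) = c"
    using child_towards[OF pu] assms by (intro the1_equality) auto
  then show ?thesis unfolding dir_point_def using pu(2) by simp
qed

lemma dir_point_cases:
  assumes "anc v (h i)"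
  obtains "v = h i" "dir_point v i = snd (marks S i)"
  | c where "c \<in> comps S" "c \<noteq> fst (pinf S)" "par c = v" "anc c (h i)" "v \<noteq> h i" "dir_point v i = apt c"
proof (cases "v = h i")
  case True
  then show thesis using that(1) by (simp add: dir_point_def)
next
  case False
  then obtain c where "c \<in> comps S" "c \<noteq> fst (pinf S)" "par c = v" "anc c (h i)"
    using child_towards[OF assms False, THEN ex1_implies_ex] by auto
  then show thesis using that(2)[of c] dir_point_child[of c i] False by auto
qed

lemma dir_point_not_pole:
  assumes "i \<in> {1..n}" "anc v (h i)"
  shows "dir_point v i \<noteq> pole_point S v"
  using assms(2)
proof (cases rule: dir_point_cases)
  case 1
  then show ?thesis using mark_not_pole[OF assms(1)] by simp
next
  case (2 c)
  then show ?thesis using at_not_pole[of c] by simp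
qed

lemma child_same:
  assumes ij: "i \<in> {1..n}" "j \<in> {1..n}" and v: "anc v (h i)" "lv v < mlev (dual_tree S) i j"
  obtains c where "c \<in> comps S" "c \<noteq> fst (pinf S)" "par c = v" "anc c (h i)" "anc c (h j)"
proof -
  let ?m = "tmeet (dual_tree S) (h i) (h j)"
  note m = meet_ij[OF ij]
  have "anc v ?m" using anc_lv_le[OF v(1), of ?m] m v(2) unfolding meet_of_def mlev_def by auto
  moreover have "v \<noteq> ?m" using v(2) by (auto simp: mlev_def)
  ultimately obtain c where c: "c \<in> comps S" "c \<noteq> fst (pinf S)" "par c = v" "anc c ?m"
      using child_towards[THEN ex1_implies_ex, of v ?m] by auto
  have "anc c (h i)" "anc c (h j)" using c(4) m anc_trans unfolding meet_of_def by blast+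
  with c(1-3) show thesis by (rule that)
qed

lemma child_differ:
  assumes ij: "i \<in> {1..n}" "j \<in> {1..n}" and c: "c \<in> comps S" "c \<noteq> fst (pinf S)" "anc c (h i)"
      "anc c (h j)"
  shows "lv (par c) < mlev (dual_tree S) i j"
proof -
  have "lv c \<le> mlev (dual_tree S) i j" using anc_meet_iff[OF ij c(3)] c(4) by simp
  moreover have "lv (par c) < lv c" using lv_strict[of "par c" c] par_in[of c] par_less[of c] c by auto
  ultimately show ?thesis by simp
qed

lemma dir_point_same:
  assumes ij: "i \<in> {1..n}" "j \<in> {1..n}" and v: "anc v (h i)" "lv v < mlev (dual_tree S) i j"
  shows "dir_point v i = dir_point v j"
proof -
  from child_same[OF assms] obtain c where "c \<in> comps S" "c \<noteq> fst (pinf S)" "par c = v" "anc c (h i)"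
      "anc c (h j)" .
  then show ?thesis using dir_point_child[of c i] dir_point_child[of c j] by simp
qed

text \<open>Below the top level, separating branches pass through different nodes, which are
  disjoint. On a terminal component marked points may coincide, which is why
  \<open>lv v < len\<close> is assumed.\<close>

lemma dir_point_differ:
  assumes ij: "i \<in> {1..n}" "j \<in> {1..n}" and v: "anc v (h i)" "anc v (h j)"
      "lv v = mlev (dual_tree S) i j"
    and l: "lv v < len"
  shows "dir_point v i \<noteq> dir_point v j"
proof -
  have ne: "v \<noteq> h i" "v \<noteq> h j" using l terminal_mark ij terminal_level by auto
  obtain c where c: "c \<in> comps S" "c \<noteq> fst (pinf S)" "par c = v" "anc c (h i)" "dir_point v i = apt c"
    by (rule dir_point_cases[OF v(1)]) (use ne in auto)
  obtain d where d: "d \<in> comps S" "d \<noteq> fst (pinf S)" "par d = v" "anc d (h j)" "dir_point v j = apt d"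
    by (rule dir_point_cases[OF v(2)]) (use ne in auto)
  have "c \<noteq> d" using child_differ[OF ij c(1,2,4)] c(3) d(4) v(3) by auto
  then have "(par c, apt c) \<noteq> (par d, apt d)" using nodes_disjoint[OF c(1,2) d(1,2)] by auto
  then show ?thesis using c d by auto
qed

lemma I_map_eq:
  assumes K: "\<And>v. v \<in> comps S \<Longrightarrow> finite {z. mdiff S v z \<noteq> K v * dp (pole_point S v) z}"
    and ij: "i \<in> {1..n}" "j \<in> {1..n}" and v: "v = tmeet (dual_tree S) (h i) (h j)"
  shows "I_map S i j = K v * (prim (pole_point S v) (dir_point v j) - prim (pole_point S v) (dir_point v i))"
proof -
  have vi: "anc v (h i)" "anc v (h j)" using meet_ij[OF ij] v unfolding meet_of_def by auto
  have vS: "v \<in> comps S" using anc_in[OF vi(1)] by simp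
  have "I_map S i j = diff_integral (mdiff S v) (pole_point S v) (dir_point v i) (dir_point v j)"
  proof (cases "h i = h j")
    case True
    then have "v = h i" using v tmeet_self[OF h_in[OF ij(1)]] by simp
    then show ?thesis using True v unfolding I_map_def dir_point_def Let_def by simp
  next
    case False
    have ne: "v \<noteq> h i" "v \<noteq> h j" using False vi terminal_anc terminal_mark ij by metis+
    have "node_towards S v (h i) = dir_point v i" "node_towards S v (h j) = dir_point v j"
      by (rule dir_point_cases[OF vi(1)], use ne node_towards_eq in auto)
        (rule dir_point_cases[OF vi(2)], use ne node_towards_eq in auto)
    then show ?thesis using False v unfolding I_map_def Let_def by simp
  qed
  also have "\<dots> = K v * (prim (pole_point S v) (dir_point v j) - prim (pole_point S v) (dir_point v i))"
    by (rule diff_integral_eq[OF K[OF vS]]) (use dir_point_not_pole ij vi in auto)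
  finally show ?thesis .
qed

lemma ex_scales: "\<exists>K. \<forall>v\<in>comps S. K v \<noteq> 0 \<and> finite {z. mdiff S v z \<noteq> K v * dp (pole_point S v) z}"
proof -
  have "\<forall>v\<in>comps S. double_pole_only (mdiff S v) (pole_point S v)"
    using ms by (simp add: multiscaled_line_def)
  then have "\<forall>v\<in>comps S. \<exists>k. k \<noteq> 0 \<and> finite {z. mdiff S v z \<noteq> k * dp (pole_point S v) z}"
    using double_pole_only_form by metis
  then show ?thesis by metis
qed

lemma Pi_map_eq:
  assumes "i \<in> {1..n}" "j \<in> {1..n}"
  shows "Pi_map S i j = (if mlev (dual_tree S) i j = len then Fin (I_map S i j) else Inf)"
proof (cases "h i = h j")
  case True
  then have "tmeet (dual_tree S) (h i) (h j) = h i" using tmeet_self[OF h_in[OF assms(1)]] by simp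
  then show ?thesis using True mlev_top[OF assms] by (simp add: Pi_map_def I_map_def Let_def)
next
  case False
  then show ?thesis using mlev_top[OF assms] by (simp add: Pi_map_def)
qed

end

text \<open>\<open>x m i\<close> is the position, on the component of level \<open>m\<close> below the marked point \<open>i\<close>, of the branch
  leading to it; the value is irrelevant but consistent when there is no such component.\<close>

definition positions :: "nat \<Rightarrow> nat \<Rightarrow> (nat \<Rightarrow> nat \<Rightarrow> nat) \<Rightarrow> (nat \<Rightarrow> nat \<Rightarrow> complex) \<Rightarrow> bool" where
  "positions n l M x \<longleftrightarrow> (\<forall>i\<in>{1..n}. \<forall>j\<in>{1..n}.
     (M i j < l \<longrightarrow> x (M i j) i \<noteq> x (M i j) j) \<and> (\<forall>m<M i j. x m i = x m j))"

abbreviation slev :: "mline \<Rightarrow> nat \<Rightarrow> nat \<Rightarrow> nat" where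
  "slev S \<equiv> mlev (dual_tree S)"

abbreviation slen :: "mline \<Rightarrow> nat" where
  "slen S \<equiv> tlength (dual_tree S)"

lemma ex_line: "stable_line n S \<Longrightarrow> \<exists>par apt dpt. line n S par apt dpt"
  using ex_node_structure unfolding stable_line_def marked_line_def line_def by blast

section \<open>Positions of branches, and lines with prescribed positions\<close>

context line begin

text \<open>The position is the primitive of the differential, \<open>K v * prim\<close>, at the
  branch point. Distinct branches get distinct positions because \<open>prim\<close> is injective
  off the pole, and marks that separate only higher up use the same branch.\<close>

lemma ex_positions:
  "\<exists>x. positions n len (slev S) x \<and>
    (\<forall>i\<in>{1..n}. \<forall>j\<in>{1..n}. I_map S i j = x (slev S i j) j - x (slev S i j) i)"
proof -
  obtain K where K: "\<And>v. v \<in> comps S \<Longrightarrow> K v \<noteq> 0"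
      "\<And>v. v \<in> comps S \<Longrightarrow> finite {z. mdiff S v z \<noteq> K v * dp (pole_point S v) z}"
    using ex_scales by blast
  define vx where "vx = (\<lambda>m i. THE v. anc v (h i) \<and> lv v = m)"
  \<comment> \<open>Level \<open>m\<close> may be missing below \<open>i\<close>. The default
    \<open>0\<close> is consistent: for \<open>m < slev S i j\<close> it is missing below
    \<open>i\<close> and \<open>j\<close> alike or below neither.\<close>
  define x where "x = (\<lambda>m i. if \<exists>v. anc v (h i) \<and> lv v = m
      then K (vx m i) * prim (pole_point S (vx m i)) (dir_point (vx m i) i) else 0)"
  have vx: "vx (lv v) i = v" if "anc v (h i)" for v i
    unfolding vx_def by (rule the_equality) (use that anc_lv_eq in auto)
  have x: "x (lv v) i = K v * prim (pole_point S v) (dir_point v i)" if "anc v (h i)" for v i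
    unfolding x_def using vx[OF that] that by auto
  have I: "I_map S i j = x (slev S i j) j - x (slev S i j) i" if ij: "i \<in> {1..n}" "j \<in> {1..n}" for i j
  proof -
    have "anc (tmeet (dual_tree S) (h i) (h j)) (h i)" "anc (tmeet (dual_tree S) (h i) (h j)) (h j)"
      using meet_ij[OF ij] unfolding meet_of_def by auto
    then show ?thesis using I_map_eq[OF K(2) ij refl] x unfolding mlev_def
        by (simp add: right_diff_distrib)
  qed
  have ne: "x (slev S i j) i \<noteq> x (slev S i j) j" if ij: "i \<in> {1..n}" "j \<in> {1..n}" and l:
      "slev S i j < len" for i j
  proof -
    define v where "v = tmeet (dual_tree S) (h i) (h j)"
    have v: "anc v (h i)" "anc v (h j)" using meet_ij[OF ij] unfolding meet_of_def v_def by auto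
    have vS: "v \<in> comps S" using anc_in[OF v(1)] by simp
    have lv: "slev S i j = lv v" by (simp add: mlev_def v_def)
    have "dir_point v i \<noteq> dir_point v j" using dir_point_differ[OF ij v] l lv by simp
    then have "prim (pole_point S v) (dir_point v i) \<noteq> prim (pole_point S v) (dir_point v j)"
      using prim_inj dir_point_not_pole[OF ij(1) v(1)] dir_point_not_pole[OF ij(2) v(2)] by blast
    then show ?thesis using x[OF v(1)] x[OF v(2)] K(1)[OF vS] lv by simp
  qed
  have eq: "x m i = x m j" if ij: "i \<in> {1..n}" "j \<in> {1..n}" and m: "m < slev S i j" for i j m
  proof (cases "\<exists>v. anc v (h i) \<and> lv v = m")
    case True
    then obtain v where v: "anc v (h i)" "lv v = m" by blast
    have vj: "anc v (h j)" using anc_meet_iff[OF ij v(1)] v(2) m by simp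
    have "dir_point v i = dir_point v j" using dir_point_same[OF ij v(1)] v(2) m by simp
    then show ?thesis using x[OF v(1)] x[OF vj] v(2) by simp
  next
    case False
    moreover have "\<not> (\<exists>v. anc v (h j) \<and> lv v = m)"
    proof
      assume "\<exists>v. anc v (h j) \<and> lv v = m"
      then obtain v where v: "anc v (h j)" "lv v = m" by blast
      then have "anc v (h i)" using anc_meet_iff[OF ij(2,1) v(1)] mlev_sym[OF ij] m by simp
      then show False using False v by blast
    qed
    ultimately have "x m i = 0" "x m j = 0" unfolding x_def by - (rule if_not_P, assumption)+
    then show ?thesis by simp
  qed
  show ?thesis unfolding positions_def using I ne eq by blast
qed

text \<open>On each component the coordinate can be chosen with the pole at infinity and the
  differential \<open>dz\<close>; then the tree and the positions of nodes and marks describe a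
  line. Stability and the conditions on the preorder are inherited, as they depend on the tree
  alone.\<close>

lemma deform:
  assumes x: "positions n len (slev S) x"
  shows "\<exists>S'. stable_line n S' \<and> dual_tree S' = dual_tree S \<and>
    (\<forall>i\<in>{1..n}. \<forall>j\<in>{1..n}. I_map S' i j = x (slev S i j) j - x (slev S i j) i)"
proof -
  have xne: "x (slev S i j) i \<noteq> x (slev S i j) j" if "i \<in> {1..n}" "j \<in> {1..n}" "slev S i j < len"
      for i j
    using x that unfolding positions_def by blast
  have xeq: "x m i = x m j" if "i \<in> {1..n}" "j \<in> {1..n}" "m < slev S i j" for i j m
    using x that unfolding positions_def by blast
  \<comment> \<open>Any mark above \<open>v\<close> will do: all of them have the same position on
    \<open>par v\<close>.\<close>
  define k where "k = (\<lambda>v. SOME i. i \<in> {1..n} \<and> anc v (h i))"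
  have k: "k v \<in> {1..n}" "anc v (h (k v))" if "v \<in> comps S" for v
  proof -
    have "\<exists>i. i \<in> {1..n} \<and> anc v (h i)" using ex_mark_above[of v] that by auto
    then have "k v \<in> {1..n} \<and> anc v (h (k v))" unfolding k_def by (rule someI_ex)
    then show "k v \<in> {1..n}" "anc v (h (k v))" by auto
  qed
  define y where "y = (\<lambda>v. x (lv (par v)) (k v))"
  define S' where "S' = \<lparr> comps = comps S,
      nodes = (\<lambda>v. {(v, Inf), (par v, Fin (y v))}) ` (comps S - {fst (pinf S)}),
      pinf = (fst (pinf S), Inf), mle = mle S, mdiff = (\<lambda>_ _. 1),
      marks = (\<lambda>i. (fst (marks S i), Fin (x len i))) \<rparr>"
  have sel: "comps S' = comps S" "pinf S' = (fst (pinf S), Inf)" "mle S' = mle S" "mdiff S' v = (\<lambda>_. 1)"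
    "marks S' i = (fst (marks S i), Fin (x len i))" 
    "nodes S' = (\<lambda>v. {(v, Inf), (par v, Fin (y v))}) ` (comps S - {fst (pinf S)})" for v i
    by (simp_all add: S'_def)
  have tle: "tless (dual_tree S') = tless (dual_tree S)" by (intro ext) (simp add: tless_def sel)
  have ns': "node_structure S' par (\<lambda>v. Fin (y v)) (\<lambda>_. Inf)"
    unfolding node_structure_def using ns_par[OF ns] ns_less[OF ns] by (simp add: sel tle)
  have dt: "dual_tree S' = dual_tree S"
  proof (rule ltree.equality)
    show "tadj (dual_tree S') = tadj (dual_tree S)"
      unfolding ns_adj[OF ns'] ns_adj[OF ns] by (simp add: sel)
  qed (auto simp: dual_tree_def sel)
  \<comment> \<open>Children of one component at equal positions would make two nodes overlap. Their
    marks \<open>k v\<close> and \<open>k w\<close> separate exactly on the common parent, where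
    \<open>x\<close> distinguishes them.\<close>
  have yne: "y v \<noteq> y w" if v: "v \<in> comps S" "v \<noteq> fst (pinf S)" and w: "w \<in> comps S" "w \<noteq> fst (pinf S)"
    and vw: "v \<noteq> w" "par v = par w" for v w
  proof -
    have kk: "k v \<in> {1..n}" "k w \<in> {1..n}" "anc v (h (k v))" "anc w (h (k w))" using k v w by auto
    have p: "anc (par v) (h (k v))" "anc (par v) (h (k w))"
      using anc_trans[OF anc_par kk(3)] anc_trans[OF anc_par kk(4)] v w vw(2) by auto
    have "\<not> lv (par v) < slev S (k v) (k w)"
    proof
      assume "lv (par v) < slev S (k v) (k w)"
      then obtain c where c: "c \<in> comps S" "c \<noteq> fst (pinf S)" "par c = par v" "anc c (h (k v))"
          "anc c (h (k w))"
        using child_same[OF kk(1,2) p(1)] by blast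
      have ne: "par v \<noteq> h (k v)" "par v \<noteq> h (k w)"
        using terminal_mark[OF kk(1)] terminal_mark[OF kk(2)] v w vw(2) unfolding terminal_iff by auto
      have "c = v" using child_towards[OF p(1) ne(1)] c kk v by auto
      moreover have "c = w" using child_towards[OF p(2) ne(2)] c kk w vw(2) by auto
      ultimately show False using vw(1) by simp
    qed
    moreover have "lv (par v) \<le> slev S (k v) (k w)" using anc_meet_iff[OF kk(1,2) p(1)] p(2) by blast
    ultimately have e: "slev S (k v) (k w) = lv (par v)" by simp
    have "lv (par v) < lv v" using lv_strict[of "par v" v] par_in[of v] par_less[of v] v by simp
    then have "lv (par v) < len" using lv_le_length[of v] v by simp
    then show ?thesis using xne[OF kk(1,2)] e vw(2) unfolding y_def by simp
  qed
  have fin: "finite (comps S)" and rt: "fst (pinf S) \<in> comps S"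
    using ms by (auto simp: multiscaled_line_def glueing_data_def smooth_point_def)
  have gl: "glueing_data S'"
  proof -
    have "pairwise disjnt (nodes S')"
      unfolding sel pairwise_def
    proof (intro ballI impI)
      fix e e' assume e: "e \<in> (\<lambda>v. {(v, Inf), (par v, Fin (y v))}) ` (comps S - {fst (pinf S)})"
        "e' \<in> (\<lambda>v. {(v, Inf), (par v, Fin (y v))}) ` (comps S - {fst (pinf S)})" "e \<noteq> e'"
      obtain v where v: "v \<in> comps S - {fst (pinf S)}" "e = {(v, Inf), (par v, Fin (y v))}"
        using e(1) by (rule imageE)
      obtain w where w: "w \<in> comps S - {fst (pinf S)}" "e' = {(w, Inf), (par w, Fin (y w))}"
        using e(2) by (rule imageE)
      have vw: "v \<noteq> w" using e(3) v(2) w(2) by auto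
      have "\<not> (par v = par w \<and> y v = y w)" using yne[of v w] v(1) w(1) vw by auto
      with vw show "disjnt e e'" unfolding v(2) w(2) by (auto simp: disjnt_def)
    qed
    moreover have "\<forall>e\<in>nodes S'. e \<subseteq> comps S' \<times> UNIV \<and> card e = 2"
      using ns_par[OF ns] by (auto simp: sel)
    ultimately show ?thesis unfolding glueing_data_def using fin rt by (auto simp: sel)
  qed
  have ag: "arithmetic_genus S' = 0"
  proof -
    have "card (nodes S') = card (comps S - {fst (pinf S)})"
      using card_image[OF ns_inj[OF ns']] unfolding ns_nodes[OF ns'] by (simp add: sel)
    then show ?thesis using card_Suc_Diff1[OF fin rt] by (simp add: arithmetic_genus_def sel)
  qed
  have pp: "pole_point S' v = Inf" if "v \<in> comps S" for v
    using ns_descending[OF ns', of v] that by (auto simp: pole_point_def sel)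
  have ms': "multiscaled_line S'"
  proof -
    have "smooth_point S' (pinf S')"
      unfolding smooth_point_def using rt by (auto simp: sel)
    moreover have "connected_curve S'" using ms
        unfolding multiscaled_line_def connected_curve_def dt sel by blast
    moreover have "\<forall>v\<in>comps S'. double_pole_only (mdiff S' v) (pole_point S' v)"
      using pp double_pole_only_one by (simp add: sel)
    ultimately show ?thesis
      using ms gl ag unfolding multiscaled_line_def dt sel by blast
  qed
  have ml': "marked_line n S'"
    unfolding marked_line_def dt
  proof (intro conjI ballI ms')
    fix i assume i: "i \<in> {1..n}"
    show t: "terminal (dual_tree S) (fst (marks S' i))" using terminal_mark[OF i] by (simp add: sel)
    show "marks S' i \<noteq> pinf S'" by (simp add: sel)
    have pm: "par v \<noteq> fst (marks S i)" if "v \<in> comps S" "v \<noteq> fst (pinf S)" for v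
      using terminal_mark[OF i] that unfolding terminal_iff by auto
    have "marks S' i \<notin> {(v, Inf), (par v, Fin (y v))}" if "v \<in> comps S - {fst (pinf S)}" for v
      using pm[of v] that by (auto simp: sel)
    then have "marks S' i \<notin> \<Union>(nodes S')" unfolding sel(6) by blast
    moreover have "fst (marks S i) \<in> comps S" using h_in[OF i] by simp
    ultimately show "smooth_point S' (marks S' i)"
      unfolding smooth_point_def by (simp add: sel)
  qed
  have nn: "num_nodes S' v = num_nodes S v" for v
    unfolding ns_num_nodes[OF ns'] ns_num_nodes[OF ns] by (simp add: sel)
  have st': "stable_line n S'"
    using conjI[OF ml' stable[unfolded stable_line_def, THEN conjunct2]]
    unfolding stable_line_def[of n S'] dt sel fst_conv nn .
  interpret L: line n S' par "\<lambda>v. Fin (y v)" "\<lambda>_. Inf"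
    by unfold_locales (rule st', rule ns')
  have dp: "prim Inf (L.dir_point v i) = x (lv v) i" if i: "i \<in> {1..n}" and v: "anc v (h i)" for v i
  proof -
    have ancL: "L.anc = anc" by (simp add: dt)
    have v': "L.anc v (L.h i)" using v by (simp add: ancL dt)
    from v' show ?thesis
    proof (cases rule: L.dir_point_cases)
      case 1
      then have "lv v = len" using terminal_mark[OF i] terminal_level by (simp add: sel)
      then show ?thesis using 1 by (simp add: sel)
    next
      case (2 c)
      have c: "c \<in> comps S" "c \<noteq> fst (pinf S)" "anc c (h i)" using 2 by (auto simp: sel ancL)
      have "lv (par c) < slev S (k c) i"
          using child_differ[OF k(1)[OF c(1)] i c(1,2) k(2)[OF c(1)] c(3)] .
      then have "x (lv (par c)) (k c) = x (lv (par c)) i" using xeq[OF k(1)[OF c(1)] i] by blast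
      then show ?thesis using 2 by (simp add: y_def)
    qed
  qed
  have "I_map S' i j = x (slev S i j) j - x (slev S i j) i" if ij: "i \<in> {1..n}" "j \<in> {1..n}" for i j
  proof -
    define v where "v = tmeet (dual_tree S) (h i) (h j)"
    have v: "anc v (h i)" "anc v (h j)" using meet_ij[OF ij] unfolding meet_of_def v_def by auto
    have vS: "v \<in> comps S" using anc_in[OF v(1)] by simp
    have "I_map S' i j = 1 * (prim (pole_point S' v) (L.dir_point v j) - prim (pole_point S' v) (L.dir_point v i))"
    proof (rule L.I_map_eq[of "\<lambda>_. 1"])
      show "finite {z. mdiff S' w z \<noteq> 1 * dp (pole_point S' w) z}" if "w \<in> comps S'" for w
        using pp that by (simp add: sel)
      show "v = tmeet (dual_tree S') (L.h i) (L.h j)" by (simp add: v_def dt sel)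
    qed (use ij in auto)
    then show ?thesis using dp[OF ij(1) v(1)] dp[OF ij(2) v(2)] pp[OF vS] by (simp add: mlev_def v_def)
  qed
  with st' dt show ?thesis by blast
qed

lemma irreducible_iff: "irreducible_line S \<longleftrightarrow> len = 0"
proof
  assume "irreducible_line S"
  then obtain v where "comps S = {v}" unfolding irreducible_line_def by (meson card_1_singletonE)
  moreover have "r \<in> comps S" using root_in by simp
  ultimately have "comps S = {r}" by simp
  then have "lv ` {r} = {..len}" using lv_image by simp
  then have "card {..len} = card (lv ` {r})" by simp
  then show "len = 0" by simp
next
  assume l: "len = 0"
  have vr: "v = r" if "v \<in> comps S" for v
  proof (rule ccontr)
    assume "v \<noteq> r"
    then have "lv (par v) < lv v" using lv_strict[of "par v" v] par_in[of v] par_less[of v] that by simp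
    then show False using lv_le_length[of v] that l by simp
  qed
  have "r \<in> comps S" using root_in by simp
  then have "comps S = {r}" using vr by blast
  then show "irreducible_line S" by (simp add: irreducible_line_def)
qed

lemma chain_of_eq: "chain_of n S = level_function.part n (slev S) ` {1..len}"
  unfolding chain_of_def level_partition_def
proof (rule image_cong[OF refl])
  fix k
  show "{1..n} // {(i, j). i \<in> {1..n} \<and> j \<in> {1..n} \<and>
      k \<le> lv (tmeet (dual_tree S) (fst (marks S i)) (fst (marks S j)))} = level_function.part n (slev S) k"
    by (simp only: level_function.part_def[OF level_function] level_function.rel_def[OF level_function])
      (simp add: mlev_def)
qed

end

section \<open>Invariance under isomorphism\<close>

text \<open>An injective monotone surjection between initial segments maps the numbers below
  \<open>m\<close> onto the numbers below \<open>g m\<close>, so counting gives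
  \<open>g m = m\<close>.\<close>

lemma strict_mono_onto_id:
  fixes g :: "nat \<Rightarrow> nat"
  assumes mono: "mono_on {..l} g" and inj: "inj_on g {..l}" and im: "g ` {..l} = {..l'}"
  shows "l = l'" "m \<le> l \<Longrightarrow> g m = m"
proof -
  have "card {..l} = card {..l'}" using card_image[OF inj] im by simp
  then show "l = l'" by simp
  show "g m = m" if m: "m \<le> l"
  proof -
    have less: "g a < g b \<longleftrightarrow> a < b" if "a \<le> l" "b \<le> l" for a b
      using mono_onD[OF mono, of a b] mono_onD[OF mono, of b a] inj_onD[OF inj, of a b] that
      by (cases a b rule: linorder_cases) (auto simp: less_le)
    have "g ` {..<m} = {..<g m}"
    proof
      show "g ` {..<m} \<subseteq> {..<g m}" using less m by auto
      show "{..<g m} \<subseteq> g ` {..<m}"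
      proof
        fix k assume k: "k \<in> {..<g m}"
        have "g m \<in> {..l'}" using im m by blast
        then have "k \<in> g ` {..l}" using k im by simp
        then obtain a where "a \<le> l" "k = g a" by auto
        then show "k \<in> g ` {..<m}" using less[of a m] m k by auto
      qed
    qed
    moreover have "card (g ` {..<m}) = m"
      by (subst card_image) (use m in \<open>auto intro: inj_on_subset[OF inj]\<close>)
    ultimately show ?thesis by simp
  qed
qed

text \<open>An isomorphism is in particular a contraction, and since it also reflects the preorder,
  it preserves levels. The constants \<open>c\<close> agree on equivalent components, so they define
  one factor \<open>C\<close> per level, equal to \<open>1\<close> at the top where the terminal
  components lie.\<close>

lemma proj_isomorphism_invariants:
  assumes L: "line n S par apt dpt" and L': "line n S' par' apt' dpt'" and iso:
      "proj_isomorphism n S S' \<sigma> \<phi>"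
  shows "slen S' = slen S \<and> (\<forall>i\<in>{1..n}. \<forall>j\<in>{1..n}. slev S' i j = slev S i j) \<and>
    (\<exists>C. (\<forall>m\<le>slen S. C m \<noteq> 0) \<and> C (slen S) = 1 \<and>
      (\<forall>i\<in>{1..n}. \<forall>j\<in>{1..n}. I_map S' i j = C (slev S i j) * I_map S i j))"
proof -
  interpret A: line n S par apt dpt by fact
  interpret B: line n S' par' apt' dpt' by fact
  interpret two_trees "dual_tree S" par n "dual_tree S'" par' by unfold_locales
  define \<Phi> where "\<Phi> = (\<lambda>(v, p). (\<sigma> v, \<phi> v p))"
  have \<Phi>: "\<Phi> (v, p) = (\<sigma> v, \<phi> v p)" for v p by (simp add: \<Phi>_def)
  have iso': "bij_betw \<sigma> (comps S) (comps S')" "\<forall>v\<in>comps S. is_mobius (\<phi> v)"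
    "nodes S' = (\<lambda>e. \<Phi> ` e) ` nodes S" "pinf S' = \<Phi> (pinf S)" "\<forall>i\<in>{1..n}. marks S' i = \<Phi> (marks S i)"
    "\<forall>v\<in>comps S. \<forall>w\<in>comps S. (v, w) \<in> mle S \<longleftrightarrow> (\<sigma> v, \<sigma> w) \<in> mle S'"
    "\<exists>c. (\<forall>v\<in>comps S. c v \<noteq> 0 \<and> diff_eq (pullback (\<phi> v) (mdiff S' (\<sigma> v))) (\<lambda>z. c v * mdiff S v z)) \<and>
          (\<forall>v\<in>comps S. \<forall>w\<in>comps S. tequiv (dual_tree S) v w \<longrightarrow> c v = c w) \<and>
          (\<forall>v\<in>comps S. terminal (dual_tree S) v \<longrightarrow> c v = 1)"
    using iso unfolding proj_isomorphism_def Let_def \<Phi>_def[symmetric]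
    by - (elim conjE, assumption)+
  note inj = bij_betw_imp_inj_on[OF iso'(1)]
  have im: "\<sigma> ` comps S = comps S'" using iso'(1) by (rule bij_betw_imp_surj_on)
  have \<sigma>V: "\<sigma> v \<in> comps S'" if "v \<in> comps S" for v using im that by blast
  have \<sigma>eq: "\<sigma> v = \<sigma> w \<longleftrightarrow> v = w" if "v \<in> comps S" "w \<in> comps S" for v w
    using inj_on_eq_iff[OF inj] that by blast
  have root: "fst (pinf S') = \<sigma> (fst (pinf S))" "snd (pinf S') = \<phi> (fst (pinf S)) (snd (pinf S))"
    unfolding iso'(4) by (cases "pinf S"; simp add: \<Phi>)+
  have mk: "fst (marks S' i) = \<sigma> (fst (marks S i))"
      "snd (marks S' i) = \<phi> (fst (marks S i)) (snd (marks S i))"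
    if "i \<in> {1..n}" for i
    using iso'(5) that by (cases "marks S i"; simp add: \<Phi>)+
  have rV: "fst (pinf S) \<in> comps S" using A.root_in by simp
  have nroot: "\<sigma> v \<noteq> fst (pinf S')" if "v \<in> comps S" "v \<noteq> fst (pinf S)" for v
    using \<sigma>eq[OF that(1) rV] that(2) root by simp
  have tless: "tless (dual_tree S') (\<sigma> v) (\<sigma> w) \<longleftrightarrow> tless (dual_tree S) v w" if "v \<in> comps S"
      "w \<in> comps S" for v w
    using iso'(6) that unfolding tless_def by simp
  have par: "par' (\<sigma> v) = \<sigma> (par v) \<and> dpt' (\<sigma> v) = \<phi> v (dpt v) \<and> apt' (\<sigma> v) = \<phi> (par v) (apt v)"
    if v: "v \<in> comps S" "v \<noteq> fst (pinf S)" for v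
  proof -
    have pv: "par v \<in> comps S" "tless (dual_tree S) (par v) v" using A.par_in[of v] A.par_less[of v] v
        by auto
    have "\<Phi> ` {(v, dpt v), (par v, apt v)} \<in> nodes S'" unfolding iso'(3) using A.mem_nodes[OF v]
        by blast
    then have "{(\<sigma> v, \<phi> v (dpt v)), (\<sigma> (par v), \<phi> (par v) (apt v))} \<in> nodes S'" by (simp add: \<Phi>)
    then have "(\<sigma> (par v) = par' (\<sigma> v) \<and> \<phi> v (dpt v) = dpt' (\<sigma> v) \<and> \<phi> (par v) (apt v) = apt' (\<sigma> v)) \<or>
        (\<sigma> (par v) \<noteq> fst (pinf S') \<and> \<sigma> v = par' (\<sigma> (par v)))"
      unfolding ns_node_iff[OF B.ns] by blast
    moreover have "\<not> (\<sigma> (par v) \<noteq> fst (pinf S') \<and> \<sigma> v = par' (\<sigma> (par v)))"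
    proof
      assume *: "\<sigma> (par v) \<noteq> fst (pinf S') \<and> \<sigma> v = par' (\<sigma> (par v))"
      then have "tless (dual_tree S') (\<sigma> v) (\<sigma> (par v))"
        using B.par_less[of "\<sigma> (par v)"] \<sigma>V[OF pv(1)] by simp
      then have "tless (dual_tree S) v (par v)" using tless v(1) pv(1) by blast
      then show False using pv(2) unfolding tless_def by blast
    qed
    ultimately show ?thesis by auto
  qed
  have con: "contraction n (dual_tree S) (dual_tree S') \<sigma>"
    unfolding contraction_def
  proof (intro conjI ballI impI)
    show "\<sigma> ` tverts (dual_tree S) = tverts (dual_tree S')" using im by simp
    show "\<sigma> (tmark (dual_tree S) i) = tmark (dual_tree S') i" if "i \<in> {1..n}" for i using mk[OF that]
        by simp
    show "(\<sigma> v, \<sigma> w) \<in> tle (dual_tree S')"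
      if "v \<in> tverts (dual_tree S)" "w \<in> tverts (dual_tree S)" "(v, w) \<in> tle (dual_tree S)" for v w
      using iso'(6) that by simp
    show "\<sigma> v = \<sigma> w \<or> (\<sigma> v, \<sigma> w) \<in> tadj (dual_tree S')"
      if "v \<in> tverts (dual_tree S)" "w \<in> tverts (dual_tree S)" and a: "(v, w) \<in> tadj (dual_tree S)"
          for v w
      using a unfolding ns_adj[OF A.ns] ns_adj[OF B.ns]
      by (auto simp: \<sigma>V par nroot)
    show "\<exists>xs. Defs.simple_path (dual_tree S) xs v w \<and> (\<forall>x\<in>set xs. \<sigma> x = \<sigma> v)"
      if "v \<in> tverts (dual_tree S)" "w \<in> tverts (dual_tree S)" "\<sigma> v = \<sigma> w" for v w
      using that \<sigma>eq[of v w] by (intro exI[of _ "[v]"]) (simp add: Defs.simple_path_def)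
  qed
  obtain g where g: "\<And>v. v \<in> comps S \<Longrightarrow> B.lv (\<sigma> v) = g (A.lv v)"
    "\<And>i j. i \<in> {1..n} \<Longrightarrow> j \<in> {1..n} \<Longrightarrow> slev S' i j = g (slev S i j)"
    "mono_on {..slen S} g" "g ` {..slen S} = {..slen S'}"
    using contraction_levels[OF con] by auto
  have ginj: "inj_on g {..slen S}"
  proof (rule inj_onI)
    fix a b assume ab: "a \<in> {..slen S}" "b \<in> {..slen S}" "g a = g b"
    then obtain v w where vw: "v \<in> comps S" "A.lv v = a" "w \<in> comps S" "A.lv w = b"
      using A.lv_image by (metis dual_tree_sel(1) imageE)
    then have "B.lv (\<sigma> v) = B.lv (\<sigma> w)" using g(1) ab(3) by simp
    then have "tequiv (dual_tree S') (\<sigma> v) (\<sigma> w)" using B.lv_eq_iff \<sigma>V vw by simp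
    then have "tequiv (dual_tree S) v w" using iso'(6) vw unfolding tequiv_def by simp
    then show "a = b" using A.lv_eq_iff[of v w] vw by simp
  qed
  have gid: "g m = m" if "m \<le> slen S" for m
    using strict_mono_onto_id(2)[OF g(3) ginj g(4) that] .
  have len: "slen S' = slen S" using strict_mono_onto_id(1)[OF g(3) ginj g(4)] by simp
  have lev: "slev S' i j = slev S i j" if "i \<in> {1..n}" "j \<in> {1..n}" for i j
    using g(2)[OF that] gid[OF A.mlev_le[OF that]] by simp
  have lv: "B.lv (\<sigma> v) = A.lv v" if "v \<in> comps S" for v
    using g(1)[OF that] gid[of "A.lv v"] A.lv_le_length[of v] that by simp
  have anc: "B.anc (\<sigma> x) (\<sigma> u)" if "A.anc x u" for x u
    using that
  proof (induction "A.lv u" arbitrary: u rule: less_induct)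
    case less
    have uV: "u \<in> comps S" using A.anc_in less(2) by auto
    show ?case
    proof (cases "x = u")
      case False
      then have u: "u \<noteq> fst (pinf S)" "A.anc x (par u)" using A.anc_step[OF less(2)] by auto
      have "A.lv (par u) < A.lv u" using A.lv_strict[of
          "par u" u] A.par_in[of u] A.par_less[of u] uV u(1) by simp
      then have "B.anc (\<sigma> x) (\<sigma> (par u))" using less(1) u(2) by blast
      moreover have "B.anc (\<sigma> (par u)) (\<sigma> u)"
        using B.anc_par[of "\<sigma> u"] par[OF uV u(1)] \<sigma>V[OF uV] nroot[OF uV u(1)] by simp
      ultimately show ?thesis by (rule B.anc_trans)
    qed (use \<sigma>V[OF uV] in simp)
  qed
  obtain c where c: "\<And>v. v \<in> comps S \<Longrightarrow> c v \<noteq> 0"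
    "\<And>v. v \<in> comps S \<Longrightarrow> diff_eq (pullback (\<phi> v) (mdiff S' (\<sigma> v))) (\<lambda>z. c v * mdiff S v z)"
    "\<And>v w. v \<in> comps S \<Longrightarrow> w \<in> comps S \<Longrightarrow> tequiv (dual_tree S) v w \<Longrightarrow> c v = c w"
    "\<And>v. v \<in> comps S \<Longrightarrow> terminal (dual_tree S) v \<Longrightarrow> c v = 1"
    using iso'(7) by blast
  define C where "C = (\<lambda>m. c (SOME v. v \<in> comps S \<and> A.lv v = m))"
  have C: "C (A.lv v) = c v" if "v \<in> comps S" for v
  proof -
    have "(SOME u. u \<in> comps S \<and> A.lv u = A.lv v) \<in> comps S \<and> A.lv (SOME u. u \<in> comps S \<and> A.lv u =
        A.lv v) = A.lv v"
      by (rule someI[of "\<lambda>u. u \<in> comps S \<and> A.lv u = A.lv v" v]) (use that in simp)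
    then show ?thesis unfolding C_def using c(3) A.lv_eq_iff that by auto
  qed
  have Cv: "\<exists>v. v \<in> comps S \<and> A.lv v = m" if "m \<le> slen S" for m
    using A.lv_image that by (metis atMost_iff dual_tree_sel(1) imageE)
  have C0: "C m \<noteq> 0" if "m \<le> slen S" for m using Cv[OF that] C c(1) by metis
  have C1: "C (slen S) = 1"
  proof -
    obtain v where v: "v \<in> comps S" "A.lv v = slen S" using Cv[of "slen S"] by auto
    then have "terminal (dual_tree S) v" using A.terminal_level by simp
    then show ?thesis using C[OF v(1)] c(4)[OF v(1)] v(2) by simp
  qed
  obtain K where K: "\<And>v. v \<in> comps S \<Longrightarrow> finite {z. mdiff S v z \<noteq> K v * dp (pole_point S v) z}"
    using A.ex_scales by blast
  obtain K' where K': "\<And>v. v \<in> comps S' \<Longrightarrow> finite {z. mdiff S' v z \<noteq> K' v * dp (pole_point S' v) z}"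
    using B.ex_scales by blast
  have pole: "\<phi> v (pole_point S v) = pole_point S' (\<sigma> v)" if v: "v \<in> comps S" for v
  proof (cases "v = fst (pinf S)")
    case True
    then show ?thesis using root by (simp add: pole_point_def)
  next
    case False
    then show ?thesis
      using A.pole_point_eq[OF v] B.pole_point_eq[OF \<sigma>V[OF v]] par[OF v False] nroot[OF v False] by simp
  qed
  have dir: "B.dir_point (\<sigma> v) i = \<phi> v (A.dir_point v i)" if i: "i \<in> {1..n}" and v: "A.anc v (A.h i)"
      for v i
    using v
  proof (cases rule: A.dir_point_cases)
    case 1
    then show ?thesis using mk[OF i] by (simp add: B.dir_point_def)
  next
    case (2 d)
    have dV: "\<sigma> d \<in> comps S'" "\<sigma> d \<noteq> fst (pinf S')" using \<sigma>V nroot 2(1,2) by auto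
    have "B.anc (\<sigma> d) (B.h i)" using anc[OF 2(4)] mk[OF i] by simp
    from B.dir_point_child[OF dV this] show ?thesis using par[OF 2(1,2)] 2(3,6) by auto
  qed
  have I: "I_map S' i j = C (slev S i j) * I_map S i j" if ij: "i \<in> {1..n}" "j \<in> {1..n}" for i j
  proof -
    define v where "v = tmeet (dual_tree S) (A.h i) (A.h j)"
    have v: "A.anc v (A.h i)" "A.anc v (A.h j)" using A.meet_ij[OF ij] unfolding A.meet_of_def v_def
        by auto
    have vS: "v \<in> comps S" using A.anc_in[OF v(1)] by simp
    have lvv: "A.lv v = slev S i j" by (simp add: mlev_def v_def)
    have "\<sigma> v = tmeet (dual_tree S') (B.h i) (B.h j)"
    proof (rule B.anc_lv_eq)
      show "B.anc (\<sigma> v) (B.h i)" using anc[OF v(1)] mk[OF ij(1)] by simp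
      show "B.anc (tmeet (dual_tree S') (B.h i) (B.h j)) (B.h i)"
        using B.meet_ij[OF ij] unfolding B.meet_of_def by blast
      show "B.lv (\<sigma> v) = B.lv (tmeet (dual_tree S') (B.h i) (B.h j))"
        using lv[OF vS] lvv lev[OF ij] by (simp add: mlev_def)
    qed
    then have "I_map S' i j = K' (\<sigma> v) * (prim (pole_point S' (\<sigma> v)) (\<phi> v (A.dir_point v j))
        - prim (pole_point S' (\<sigma> v)) (\<phi> v (A.dir_point v i)))"
      using B.I_map_eq[of K' i j "\<sigma> v", OF K' ij] dir[OF ij(1) v(1)] dir[OF ij(2) v(2)] by simp
    also have "\<dots> = c v * (K v * (prim (pole_point S v) (A.dir_point v j) - prim (pole_point S v) (A.dir_point v i)))"
      by (rule prim_transport[OF K[OF vS] K'[OF \<sigma>V[OF vS]] _ pole[OF vS] c(2)[OF vS]])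
        (use iso'(2) vS A.dir_point_not_pole[OF ij(1) v(1)] A.dir_point_not_pole[OF ij(2) v(2)] in auto)
    also have "\<dots> = C (slev S i j) * I_map S i j"
      using A.I_map_eq[of K i j v, OF K ij v_def] C[OF vS] lvv by simp
    finally show ?thesis .
  qed
  show ?thesis using len lev C0 C1 I by blast
qed

lemma pullback_id: "pullback (mobius_map 1 0 0 1) \<omega> = \<omega>"
  using pullback_mobius[of 0 _ 1 1 0 \<omega>] by (intro ext) simp

lemma mobius_id: "mobius_map 1 0 0 1 = (\<lambda>p. p)"
proof
  show "mobius_map 1 0 0 1 p = p" for p by (cases p) auto
qed

lemma proj_iso_refl: "stable_line n S \<Longrightarrow> (S, S) \<in> proj_iso_rel n"
proof -
  assume s: "stable_line n S"
  have "proj_isomorphism n S S (\<lambda>v. v) (\<lambda>_. mobius_map 1 0 0 1)"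
    unfolding proj_isomorphism_def Let_def
  proof (intro conjI)
    have i: "(\<lambda>(v, p). (v, mobius_map 1 0 0 1 p)) = (\<lambda>x. x)" unfolding mobius_id
        by (rule ext) (simp add: split_beta)
    show "nodes S = (\<lambda>e. (\<lambda>(v, p). (v, mobius_map 1 0 0 1 p)) ` e) ` nodes S"
      "pinf S = (\<lambda>(v, p). (v, mobius_map 1 0 0 1 p)) (pinf S)"
      "\<forall>i\<in>{1..n}. marks S i = (\<lambda>(v, p). (v, mobius_map 1 0 0 1 p)) (marks S i)"
      unfolding i by simp_all
    show "\<forall>v\<in>comps S. is_mobius (mobius_map 1 0 0 1)"
      unfolding is_mobius_def by (intro ballI exI[of _ "1::complex"] exI[of _ "0::complex"]) simp
    show "\<exists>c. (\<forall>v\<in>comps S. c v \<noteq> 0 \<and>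
        diff_eq (pullback (mobius_map 1 0 0 1) (mdiff S v)) (\<lambda>z. c v * mdiff S v z)) \<and>
          (\<forall>v\<in>comps S. \<forall>w\<in>comps S. tequiv (dual_tree S) v w \<longrightarrow> c v = c w) \<and>
          (\<forall>v\<in>comps S. terminal (dual_tree S) v \<longrightarrow> c v = 1)"
      by (rule exI[of _ "\<lambda>_. 1"]) (simp add: pullback_id diff_eq_def)
  qed (auto simp: bij_betw_def)
  then show ?thesis using s unfolding proj_iso_rel_def by blast
qed

text \<open>The representative of a class is chosen arbitrarily, so of a given line it keeps the
  level function but the integrals only up to a factor per level.\<close>

lemma moduli_of_line:
  assumes "stable_line n S"
  obtains X where "X \<in> moduli n" "stable_line n (representative X)"
    "slen (representative X) = slen S"
        "\<And>i j. i \<in> {1..n} \<Longrightarrow> j \<in> {1..n} \<Longrightarrow> slev (representative X) i j = slev S i j"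
    "\<exists>C. (\<forall>m\<le>slen S. C m \<noteq> 0) \<and> C (slen S) = 1 \<and>
      (\<forall>i\<in>{1..n}. \<forall>j\<in>{1..n}. I_map (representative X) i j = C (slev S i j) * I_map S i j)"
proof -
  let ?X = "proj_iso_rel n `` {S}"
  have X: "?X \<in> moduli n" unfolding moduli_def using assms by (intro quotientI) simp
  have "S \<in> ?X" using proj_iso_refl[OF assms] by simp
  then have "representative ?X \<in> ?X" unfolding representative_def by (rule someI)
  then obtain \<sigma> \<phi> where iso: "stable_line n (representative ?X)"
      "proj_isomorphism n S (representative ?X) \<sigma> \<phi>"
    unfolding proj_iso_rel_def by auto
  obtain par apt dpt where l: "line n S par apt dpt" using ex_line[OF assms] by blast
  obtain par' apt' dpt' where l': "line n (representative ?X) par' apt' dpt'" using ex_line[OF iso(1)]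
      by blast
  show thesis
    using that[OF X iso(1)] proj_isomorphism_invariants[OF l l' iso(2)] by blast
qed

lemma stable_representative: "X \<in> moduli n \<Longrightarrow> stable_line n (representative X)"
proof -
  assume "X \<in> moduli n"
  then obtain S where S: "stable_line n S" "X = proj_iso_rel n `` {S}"
    unfolding moduli_def by (auto elim: quotientE)
  then have "S \<in> X" using proj_iso_refl by simp
  then have "representative X \<in> X" unfolding representative_def by (rule someI)
  then show ?thesis using S(2) unfolding proj_iso_rel_def by auto
qed

section \<open>Subspaces, reindexing and affine equations\<close>

text \<open>The sheaf property used when a subspace is formed twice. Stated alone, it can be checked
  directly for affine spaces and for subspaces.\<close>

definition restricting :: "'a fspace \<Rightarrow> bool" where
  "restricting V \<longleftrightarrow> (\<forall>U W f. openin (ftop V) U \<and> openin (ftop V) W \<and> W \<subseteq> U \<and> f \<in> freg V U \<longrightarrow>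
      f \<in> freg V W)"

lemma restricting_function_space: "function_space V \<Longrightarrow> restricting V"
  unfolding function_space_def restricting_def by blast

lemma freg_affine: "f \<in> freg (affine_space I) U \<longleftrightarrow> (\<forall>x\<in>U. \<exists>p\<in>poly_funs I. \<exists>q\<in>poly_funs I. \<exists>W.
    openin (zariski I) W \<and> x \<in> W \<and> W \<subseteq> U \<and> (\<forall>y\<in>W. q y \<noteq> 0 \<and> f y = p y / q y))"
  by (simp add: affine_space_def)

lemma restricting_affine: "restricting (affine_space I)"
  unfolding restricting_def
proof (intro allI impI, elim conjE)
  fix U W f
  assume UW: "openin (ftop (affine_space I)) W" "W \<subseteq> U" "f \<in> freg (affine_space I) U"
  show "f \<in> freg (affine_space I) W"
    unfolding freg_affine
  proof
    fix x assume x: "x \<in> W"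
    then have "x \<in> U" using UW(2) by blast
    from UW(3)[unfolded freg_affine, rule_format, OF this]
    obtain p q W' where *: "p \<in> poly_funs I" "q \<in> poly_funs I" "openin (zariski I) W'" "x \<in> W'"
      "\<forall>y\<in>W'. q y \<noteq> 0 \<and> f y = p y / q y" by blast
    have "openin (zariski I) (W' \<inter> W)" using *(3) UW(1) by (auto simp: affine_space_def)
    then show "\<exists>p\<in>poly_funs I. \<exists>q\<in>poly_funs I. \<exists>Wa. openin (zariski I) Wa \<and> x \<in> Wa \<and> Wa \<subseteq> W \<and>
      (\<forall>y\<in>Wa. q y \<noteq> 0 \<and> f y = p y / q y)"
      using * x by (intro bexI[of _ p] bexI[of _ q] exI[of _ "W' \<inter> W"]) auto
  qed
qed

lemma ftop_subspace [simp]: "ftop (subspace_of V S) = subtopology (ftop V) S"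
  by (simp add: subspace_of_def)

lemma freg_subspace: "f \<in> freg (subspace_of V S) U \<longleftrightarrow>
    (\<forall>x\<in>U. \<exists>W g. openin (ftop V) W \<and> x \<in> W \<and> g \<in> freg V W \<and> (\<forall>y\<in>W \<inter> U. f y = g y))"
  by (simp add: subspace_of_def)

lemma restricting_subspace: "restricting (subspace_of V S)"
  unfolding restricting_def freg_subspace
proof (intro allI impI ballI, elim conjE)
  fix U W f x
  assume x: "x \<in> W" and WU: "W \<subseteq> U"
    and f: "\<forall>x\<in>U. \<exists>W g. openin (ftop V) W \<and> x \<in> W \<and> g \<in> freg V W \<and> (\<forall>y\<in>W \<inter> U. f y = g y)"
  from f[rule_format, of x] x WU obtain Q g where
    "openin (ftop V) Q" "x \<in> Q" "g \<in> freg V Q" "\<forall>y\<in>Q \<inter> U. f y = g y" by blast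
  with WU show "\<exists>Q g. openin (ftop V) Q \<and> x \<in> Q \<and> g \<in> freg V Q \<and> (\<forall>y\<in>Q \<inter> W. f y = g y)"
    by (intro exI[of _ Q] exI[of _ g]) auto
qed

lemma morphism_comp:
  assumes f: "morphism V W f" and g: "morphism W X g"
  shows "morphism V X (g \<circ> f)"
  unfolding morphism_def
proof (intro conjI allI impI)
  have cf: "continuous_map (ftop V) (ftop W) f" and cg: "continuous_map (ftop W) (ftop X) g"
    using f g by (auto simp: morphism_def)
  then show "continuous_map (ftop V) (ftop X) (g \<circ> f)" by (rule continuous_map_compose)
  fix U k assume k: "openin (ftop X) U \<and> k \<in> freg X U"
  then have "k \<circ> g \<in> freg W {x \<in> topspace (ftop W). g x \<in> U}" using g by (auto simp: morphism_def)
  moreover have "openin (ftop W) {x \<in> topspace (ftop W). g x \<in> U}"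
    using cg k by (auto simp: continuous_map_def)
  ultimately have "(k \<circ> g) \<circ> f \<in> freg V {x \<in> topspace (ftop V). f x \<in> {x \<in> topspace (ftop W). g x \<in> U}}"
    using f unfolding morphism_def by blast
  moreover have "{x \<in> topspace (ftop V). f x \<in> {x \<in> topspace (ftop W). g x \<in> U}} =
      {x \<in> topspace (ftop V). (g \<circ> f) x \<in> U}"
    using cf by (auto simp: continuous_map_def)
  ultimately show "k \<circ> (g \<circ> f) \<in> freg V {x \<in> topspace (ftop V). (g \<circ> f) x \<in> U}"
    by (simp add: comp_assoc)
qed

lemma isomorphism_comp:
  assumes f: "isomorphism V W f" and g: "isomorphism W X g"
  shows "isomorphism V X (g \<circ> f)"
proof -
  obtain f' where f': "morphism W V f'" "\<forall>x\<in>topspace (ftop V). f' (f x) = x"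
      "\<forall>y\<in>topspace (ftop W). f (f' y) = y"
    using f by (auto simp: isomorphism_def)
  obtain g' where g': "morphism X W g'" "\<forall>x\<in>topspace (ftop W). g' (g x) = x"
      "\<forall>y\<in>topspace (ftop X). g (g' y) = y"
    using g by (auto simp: isomorphism_def)
  have fg: "morphism V W f" "morphism W X g" using f g by (auto simp: isomorphism_def)
  have "f x \<in> topspace (ftop W)" if "x \<in> topspace (ftop V)" for x
    using fg(1) that by (auto simp: morphism_def continuous_map_def)
  moreover have "g' x \<in> topspace (ftop W)" if "x \<in> topspace (ftop X)" for x
    using g'(1) that by (auto simp: morphism_def continuous_map_def)
  ultimately show ?thesis unfolding isomorphism_def
    using morphism_comp[OF fg] morphism_comp[OF g'(1) f'(1)] f' g'
    by (intro conjI exI[of _ "f' \<circ> g'"]) auto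
qed

lemma morphism_restrict:
  assumes f: "morphism V W f" and S: "f ` (topspace (ftop V) \<inter> S) \<subseteq> S'"
  shows "morphism (subspace_of V S) (subspace_of W S') f"
  unfolding morphism_def
proof (intro conjI allI impI)
  have cf: "continuous_map (ftop V) (ftop W) f"
    and rf: "\<And>U g. openin (ftop W) U \<Longrightarrow> g \<in> freg W U \<Longrightarrow> g \<circ> f \<in> freg V {x \<in> topspace (ftop V). f x \<in> U}"
    using f by (auto simp: morphism_def)
  show "continuous_map (ftop (subspace_of V S)) (ftop (subspace_of W S')) f"
    using cf S by (auto simp: continuous_map_in_subtopology continuous_map_from_subtopology)
  fix U g assume U: "openin (ftop (subspace_of W S')) U \<and> g \<in> freg (subspace_of W S') U"
  show "g \<circ> f \<in> freg (subspace_of V S) {x \<in> topspace (ftop (subspace_of V S)). f x \<in> U}"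
    unfolding freg_subspace
  proof
    fix x assume x: "x \<in> {x \<in> topspace (ftop (subspace_of V S)). f x \<in> U}"
    then obtain W1 h where h: "openin (ftop W) W1" "f x \<in> W1" "h \<in> freg W W1" "\<forall>y\<in>W1 \<inter> U. g y = h y"
      using U unfolding freg_subspace by blast
    have "openin (ftop V) {x \<in> topspace (ftop V). f x \<in> W1}" using cf h(1)
        by (auto simp: continuous_map_def)
    then show "\<exists>Wa ga. openin (ftop V) Wa \<and> x \<in> Wa \<and> ga \<in> freg V Wa \<and>
        (\<forall>y\<in>Wa \<inter> {x \<in> topspace (ftop (subspace_of V S)). f x \<in> U}. (g \<circ> f) y = ga y)"
      using rf[OF h(1,3)] h x by (intro exI[of _ "{x \<in> topspace (ftop V). f x \<in> W1}"] exI[of _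
          "h \<circ> f"]) auto
  qed
qed

lemma isomorphism_restrict:
  assumes f: "isomorphism V W f" and S: "S \<subseteq> topspace (ftop V)"
  shows "isomorphism (subspace_of V S) (subspace_of W (f ` S)) f"
proof -
  obtain f' where f': "morphism W V f'" "\<forall>x\<in>topspace (ftop V). f' (f x) = x"
      "\<forall>y\<in>topspace (ftop W). f (f' y) = y"
    and mf: "morphism V W f"
    using f by (auto simp: isomorphism_def)
  have "morphism (subspace_of V S) (subspace_of W (f ` S)) f" by (rule morphism_restrict[OF mf]) auto
  moreover have "morphism (subspace_of W (f ` S)) (subspace_of V S) f'"
    by (rule morphism_restrict[OF f'(1)]) (use f'(2) S in auto)
  ultimately show ?thesis unfolding isomorphism_def using f'(2,3) by auto
qed

text \<open>Local extensions can be composed after shrinking to a common open set. The identity is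
  shown to be an isomorphism, instead of the two structures being equal, because \<open>freg\<close>
  carries meaning only on open sets.\<close>

lemma nested_subspace:
  assumes V: "restricting V" and S: "S \<subseteq> U"
  shows "isomorphism (subspace_of (subspace_of V U) S) (subspace_of V S) (\<lambda>x. x)"
    "isomorphism (subspace_of V S) (subspace_of (subspace_of V U) S) (\<lambda>x. x)"
proof -
  have top: "subtopology (subtopology (ftop V) U) S = subtopology (ftop V) S"
    using S by (simp add: subtopology_subtopology inf.absorb2)
  have eq: "g \<in> freg (subspace_of (subspace_of V U) S) Q \<longleftrightarrow> g \<in> freg (subspace_of V S) Q"
    if Q: "Q \<subseteq> S" for g Q
  proof
    assume g: "g \<in> freg (subspace_of (subspace_of V U) S) Q"
    show "g \<in> freg (subspace_of V S) Q"
      unfolding freg_subspace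
    proof
      fix x assume x: "x \<in> Q"
      then obtain W1 h where h: "openin (subtopology (ftop V) U) W1" "x \<in> W1"
          "h \<in> freg (subspace_of V U) W1"
        "\<forall>y\<in>W1 \<inter> Q. g y = h y" using g unfolding freg_subspace[of g] ftop_subspace by blast
      obtain W0 where W0: "openin (ftop V) W0" "W1 = W0 \<inter> U" using h(1)
          by (auto simp: openin_subtopology)
      obtain W2 k where k: "openin (ftop V) W2" "x \<in> W2" "k \<in> freg V W2" "\<forall>y\<in>W2 \<inter> W1. h y = k y"
        using h(2,3) unfolding freg_subspace by blast
      have o: "openin (ftop V) (W0 \<inter> W2)" using W0 k by auto
      then have "k \<in> freg V (W0 \<inter> W2)" using V k unfolding restricting_def by blast
      then show "\<exists>W ga. openin (ftop V) W \<and> x \<in> W \<and> ga \<in> freg V W \<and> (\<forall>y\<in>W \<inter> Q. g y = ga y)"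
        using o W0 k h Q S by (intro exI[of _ "W0 \<inter> W2"] exI[of _ k]) auto
    qed
  next
    assume g: "g \<in> freg (subspace_of V S) Q"
    show "g \<in> freg (subspace_of (subspace_of V U) S) Q"
      unfolding freg_subspace[of g] ftop_subspace
    proof
      fix x assume x: "x \<in> Q"
      then obtain W h where h: "openin (ftop V) W" "x \<in> W" "h \<in> freg V W" "\<forall>y\<in>W \<inter> Q. g y = h y"
        using g unfolding freg_subspace by blast
      have "h \<in> freg (subspace_of V U) (W \<inter> U)" unfolding freg_subspace using h by auto
      moreover have "openin (subtopology (ftop V) U) (W \<inter> U)" using h(1)
          by (auto simp: openin_subtopology)
      ultimately show "\<exists>W ga. openin (subtopology (ftop V) U) W \<and> x \<in> W \<and>
          ga \<in> freg (subspace_of V U) W \<and>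
          (\<forall>y\<in>W \<inter> Q. g y = ga y)"
        using h Q S x by (intro exI[of _ "W \<inter> U"] exI[of _ h]) auto
    qed
  qed
  have pre: "{x \<in> topspace (subtopology (ftop V) S). x \<in> Q} = Q" "Q \<subseteq> S" if
      "openin (subtopology (ftop V) S) Q" for Q
    using openin_subset[OF that] by auto
  have "morphism (subspace_of (subspace_of V U) S) (subspace_of V S) (\<lambda>x. x)"
    "morphism (subspace_of V S) (subspace_of (subspace_of V U) S) (\<lambda>x. x)"
    unfolding morphism_def ftop_subspace top
    using pre eq by (auto simp: o_def)
  then show "isomorphism (subspace_of (subspace_of V U) S) (subspace_of V S) (\<lambda>x. x)"
    "isomorphism (subspace_of V S) (subspace_of (subspace_of V U) S) (\<lambda>x. x)"
    unfolding isomorphism_def by auto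
qed

text \<open>A closed immersion gives an isomorphism onto a subspace of a subspace of affine space;
  restricting to \<open>S\<close> and flattening the nested subspaces puts the image directly into
  \<open>W\<close>.\<close>

lemma isomorphism_chart_restrict:
  assumes V: "restricting V" and W: "restricting W" and U: "U \<subseteq> topspace (ftop V)" and S: "S \<subseteq> U"
    and f: "isomorphism (subspace_of V U) (subspace_of (subspace_of W R) (f ` U)) f" and R: "f ` U \<subseteq> R"
  shows "isomorphism (subspace_of V S) (subspace_of W (f ` S)) f"
proof -
  have "S \<subseteq> topspace (ftop (subspace_of V U))" using U S by auto
  note i2 = isomorphism_restrict[OF f this]
  have fS: "f ` S \<subseteq> f ` U" "f ` S \<subseteq> R" using S R by auto
  note i1 = nested_subspace(2)[OF V S]
  note i3 = nested_subspace(1)[OF restricting_subspace fS(1), of W R]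
  note i4 = nested_subspace(1)[OF W fS(2)]
  have "isomorphism (subspace_of V S) (subspace_of W (f ` S)) ((\<lambda>x. x) \<circ> ((\<lambda>x. x) \<circ> (f \<circ> (\<lambda>x. x))))"
    by (rule isomorphism_comp[OF isomorphism_comp[OF isomorphism_comp[OF i1 i2] i3] i4])
  then show ?thesis by (simp add: o_def)
qed

section \<open>Renaming coordinates\<close>

text \<open>Charts have coordinates indexed by \<open>coord\<close>, while smoothness and
  quasi-affineness are defined through numbered coordinates; this map translates. Points of affine
  space vanish off the index set, hence the default \<open>0\<close>.\<close>

definition reindex :: "'i set \<Rightarrow> ('i \<Rightarrow> 'j) \<Rightarrow> ('j \<Rightarrow> complex) \<Rightarrow> 'i \<Rightarrow> complex" where
  "reindex I \<tau> x = (\<lambda>i. if i \<in> I then x (\<tau> i) else 0)"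

lemma reindex_poly:
  assumes "p \<in> poly_funs I" "\<tau> ` I \<subseteq> J"
  shows "(\<lambda>x. p (reindex I \<tau> x)) \<in> poly_funs J"
  using assms(1)
proof induction
  case (poly_coord i)
  then show ?case using assms(2) by (auto simp: reindex_def intro: poly_funs.poly_coord)
qed (auto intro: poly_funs.intros)

lemma topspace_zariski [simp]: "topspace (zariski I) = affine_points I"
proof -
  have "openin (zariski I) (affine_points I)" unfolding openin_zariski zariski_open_def
    by (rule exI[of _ "{\<lambda>_. 1}"]) (auto intro: poly_funs.intros)
  moreover have "U \<subseteq> affine_points I" if "openin (zariski I) U" for U
    using that unfolding openin_zariski zariski_open_def by auto
  ultimately show ?thesis by (metis openin_subset openin_topspace subset_antisym)
qed

lemma ftop_affine [simp]: "ftop (affine_space I) = zariski I"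
  by (simp add: affine_space_def)

lemma reindex_open:
  assumes "openin (zariski I) W" "\<tau> ` I \<subseteq> J"
  shows "openin (zariski J) {x \<in> affine_points J. reindex I \<tau> x \<in> W}"
proof -
  obtain F where F: "F \<subseteq> poly_funs I" "W = {x \<in> affine_points I. \<exists>p\<in>F. p x \<noteq> 0}"
    using assms(1) unfolding openin_zariski zariski_open_def by blast
  let ?F = "(\<lambda>p x. p (reindex I \<tau> x)) ` F"
  have "?F \<subseteq> poly_funs J" using F(1) reindex_poly[OF _ assms(2)] by auto
  moreover have "{x \<in> affine_points J. reindex I \<tau> x \<in> W} = {x \<in> affine_points J. \<exists>p\<in>?F. p x \<noteq> 0}"
    unfolding F(2) by (auto simp: affine_points_def reindex_def)
  ultimately show ?thesis unfolding openin_zariski zariski_open_def by blast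
qed

lemma reindex_morphism:
  assumes \<tau>: "\<tau> ` I \<subseteq> J"
  shows "morphism (affine_space J) (affine_space I) (reindex I \<tau>)"
  unfolding morphism_def ftop_affine topspace_zariski
proof (intro conjI allI impI)
  show "continuous_map (zariski J) (zariski I) (reindex I \<tau>)"
    unfolding continuous_map_def using reindex_open[OF _ \<tau>]
    by (auto simp: affine_points_def reindex_def)
  fix U g assume U: "openin (zariski I) U \<and> g \<in> freg (affine_space I) U"
  show "g \<circ> reindex I \<tau> \<in> freg (affine_space J) {x \<in> affine_points J. reindex I \<tau> x \<in> U}"
    unfolding freg_affine
  proof
    fix x assume x: "x \<in> {x \<in> affine_points J. reindex I \<tau> x \<in> U}"
    then have "reindex I \<tau> x \<in> U" by blast
    from U[THEN conjunct2, unfolded freg_affine, rule_format, OF this]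
    obtain p q W where *: "p \<in> poly_funs I" "q \<in> poly_funs I" "openin (zariski I) W"
        "reindex I \<tau> x \<in> W" "W \<subseteq> U"
      "\<forall>y\<in>W. q y \<noteq> 0 \<and> g y = p y / q y" by blast
    show "\<exists>p\<in>poly_funs J. \<exists>q\<in>poly_funs J. \<exists>W. openin (zariski J) W \<and> x \<in> W \<and>
        W \<subseteq> {x \<in> affine_points J. reindex I \<tau> x \<in> U} \<and> (\<forall>y\<in>W. q y \<noteq> 0 \<and> (g \<circ> reindex I \<tau>) y = p y / q y)"
      using * x reindex_poly[OF *(1) \<tau>] reindex_poly[OF *(2) \<tau>] reindex_open[OF *(3) \<tau>]
      by (intro bexI[of _ "\<lambda>x. p (reindex I \<tau> x)"] bexI[of _ "\<lambda>x. q (reindex I \<tau> x)"]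
          exI[of _ "{x \<in> affine_points J. reindex I \<tau> x \<in> W}"]) auto
  qed
qed

lemma reindex_isomorphism:
  assumes e: "bij_betw e I J"
  shows "isomorphism (affine_space I) (affine_space J) (reindex J (inv_into I e))"
proof -
  have eI: "e ` I \<subseteq> J" "inv_into I e ` J \<subseteq> I"
    using e by (auto simp: bij_betw_def inv_into_into)
  have "reindex I e (reindex J (inv_into I e) x) = x" if "x \<in> affine_points I" for x
    using that e eI by (auto simp: reindex_def affine_points_def bij_betw_def fun_eq_iff)
  moreover have "reindex J (inv_into I e) (reindex I e y) = y" if "y \<in> affine_points J" for y
    using that e eI by (auto simp: reindex_def affine_points_def bij_betw_def fun_eq_iff f_inv_into_f inv_into_into)
  ultimately show ?thesis unfolding isomorphism_def
    using reindex_morphism[OF eI(1)] reindex_morphism[OF eI(2)] by auto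
qed

section \<open>Systems of affine-linear equations\<close>

definition affine_form :: "'i set \<Rightarrow> (('i \<Rightarrow> complex) \<Rightarrow> complex) \<Rightarrow> bool" where
  "affine_form I L \<longleftrightarrow> (\<exists>a b. \<forall>x. L x = b + (\<Sum>i\<in>I. a i * x i))"

lemma affine_form_const: "affine_form I (\<lambda>_. c)"
  unfolding affine_form_def by (rule exI[of _ "\<lambda>_. 0"]) auto

lemma affine_form_coord: "finite I \<Longrightarrow> i \<in> I \<Longrightarrow> affine_form I (\<lambda>x. x i)"
  unfolding affine_form_def
  by (rule exI[of _ "\<lambda>j. if j = i then 1 else 0"], rule exI[of _ 0]) (simp add: if_distrib[of
      "\<lambda>c. c * _"] cong: if_cong)

lemma affine_form_diff: "affine_form I L \<Longrightarrow> affine_form I L' \<Longrightarrow> affine_form I (\<lambda>x. L x - L' x)"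
  unfolding affine_form_def
proof (elim exE)
  fix a b a' b' assume "\<forall>x. L x = b + (\<Sum>i\<in>I. a i * x i)" "\<forall>x. L' x = b' + (\<Sum>i\<in>I. a' i * x i)"
  then show "\<exists>a b. \<forall>x. L x - L' x = b + (\<Sum>i\<in>I. a i * x i)"
    by (intro exI[of _ "\<lambda>i. a i - a' i"] exI[of _ "b - b'"]) (simp add: left_diff_distrib sum_subtractf)
qed

lemma affine_form_neg: "affine_form I L \<Longrightarrow> affine_form I (\<lambda>x. - L x)"
  using affine_form_diff[OF affine_form_const[of I 0]] by simp

lemma affine_form_reindex:
  assumes e: "bij_betw e I J" and L: "affine_form I L" and I: "finite I"
  shows "affine_form J (\<lambda>y. L (reindex I e y))"
proof -
  obtain a b where ab: "\<And>x. L x = b + (\<Sum>i\<in>I. a i * x i)" using L by (auto simp: affine_form_def)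
  have "L (reindex I e y) = b + (\<Sum>j\<in>J. a (inv_into I e j) * y j)" for y
  proof -
    have "(\<Sum>j\<in>J. a (inv_into I e j) * y j) = (\<Sum>i\<in>I. a (inv_into I e (e i)) * y (e i))"
      by (rule sum.reindex_bij_betw[OF e, symmetric])
    also have "\<dots> = (\<Sum>i\<in>I. a i * reindex I e y i)"
      using e by (intro sum.cong) (auto simp: reindex_def bij_betw_def)
    finally show ?thesis by (simp add: ab)
  qed
  then show ?thesis unfolding affine_form_def by (intro exI[of _
      "\<lambda>j. a (inv_into I e j)"] exI[of _ b]) blast
qed

lemma affine_form_poly:
  assumes "finite I" "affine_form I L"
  shows "L \<in> poly_funs I"
proof -
  obtain a b where L: "\<And>x. L x = b + (\<Sum>i\<in>I. a i * x i)" using assms(2) by (auto simp: affine_form_def)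
  have "(\<lambda>x. \<Sum>i\<in>K. a i * x i) \<in> poly_funs I" if "K \<subseteq> I" for K
    using finite_subset[OF that assms(1)] that
  proof (induction K)
    case (insert k K)
    then have "(\<lambda>x. \<Sum>i\<in>K. a i * x i) \<in> poly_funs I" "k \<in> I" by auto
    then have "(\<lambda>x. a k * x k + (\<Sum>i\<in>K. a i * x i)) \<in> poly_funs I"
      by (intro poly_add poly_mult poly_const poly_coord)
    then show ?case using insert.hyps by simp
  qed (simp add: poly_const)
  then have "(\<lambda>x. b + (\<Sum>i\<in>I. a i * x i)) \<in> poly_funs I" by (intro poly_add poly_const) simp
  moreover have "L = (\<lambda>x. b + (\<Sum>i\<in>I. a i * x i))" using L by (rule ext)
  ultimately show ?thesis by simp
qed

lemma pderivative_affine: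
  assumes "\<And>x. L x = b + (\<Sum>i\<in>I. a i * x i)" "finite I" "i \<in> I"
  shows "pderivative L i x = a i"
proof -
  have "L (x(i := t)) = (b + (\<Sum>j\<in>I - {i}. a j * x j)) + a i * t" for t
    unfolding assms(1) by (simp add: sum.remove[OF assms(2,3)] algebra_simps)
  then have "(\<lambda>t. L (x(i := t))) = (\<lambda>t. (b + (\<Sum>j\<in>I - {i}. a j * x j)) + a i * t)" by auto
  then show ?thesis unfolding pderivative_def
    by (simp only:) (intro DERIV_imp_deriv, auto intro!: derivative_eq_intros)
qed

text \<open>Equations are added one at a time. If the linear part of a new one is a combination of
  the earlier linear parts, the common zero \<open>x0\<close> forces the constant terms to match, so
  the equation is redundant; otherwise the extended family stays independent.\<close>

lemma independent_subsystem:
  assumes "finite E" "\<And>L. L \<in> E \<Longrightarrow> affine_form {..<N} L" "\<And>L. L \<in> E \<Longrightarrow> L x0 = 0"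
  shows "\<exists>(c::nat) a b. (\<forall>x. (\<forall>L\<in>E. L x = 0) \<longleftrightarrow> (\<forall>k<c. b k + (\<Sum>i<N. a k i * x i) = 0)) \<and>
    (\<forall>\<mu>. (\<forall>i<N. (\<Sum>k<c. \<mu> k * a k i) = 0) \<longrightarrow> (\<forall>k<c. \<mu> k = (0::complex)))"
  using assms
proof (induction E rule: finite_induct)
  case empty
  show ?case by (rule exI[of _ 0]) simp
next
  case (insert L E)
  have "\<exists>(c::nat) a b. (\<forall>x. (\<forall>L\<in>E. L x = 0) \<longleftrightarrow> (\<forall>k<c. b k + (\<Sum>i<N. a k i * x i) = 0)) \<and>
    (\<forall>\<mu>. (\<forall>i<N. (\<Sum>k<c. \<mu> k * a k i) = 0) \<longrightarrow> (\<forall>k<c. \<mu> k = (0::complex)))"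
    by (rule insert.IH) (use insert.prems in auto)
  then obtain c :: nat and a b where
    eq: "\<And>x. (\<forall>L\<in>E. L x = 0) \<longleftrightarrow> (\<forall>k<c. b k + (\<Sum>i<N. a k i * x i) = 0)" and
    ind: "\<And>\<mu>. (\<forall>i<N. (\<Sum>k<c. \<mu> k * a k i) = 0) \<Longrightarrow> (\<forall>k<c. \<mu> k = (0::complex))" by blast
  obtain al be where L: "\<And>x. L x = be + (\<Sum>i<N. al i * x i)"
    using insert.prems(1)[of L] by (auto simp: affine_form_def)
  show ?case
  proof (cases "\<exists>\<mu>. \<forall>i<N. al i = (\<Sum>k<c. \<mu> k * a k i)")
    case True
    then obtain \<mu> where \<mu>: "\<And>i. i < N \<Longrightarrow> al i = (\<Sum>k<c. \<mu> k * a k i)" by blast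
    have Lx: "L x = be - (\<Sum>k<c. \<mu> k * b k) + (\<Sum>k<c. \<mu> k * (b k + (\<Sum>i<N. a k i * x i)))" for x
    proof -
      have "(\<Sum>i<N. al i * x i) = (\<Sum>i<N. \<Sum>k<c. \<mu> k * a k i * x i)"
        by (intro sum.cong refl) (simp add: \<mu> sum_distrib_right)
      also have "\<dots> = (\<Sum>k<c. \<Sum>i<N. \<mu> k * a k i * x i)" by (rule sum.swap)
      also have "\<dots> = (\<Sum>k<c. \<mu> k * (\<Sum>i<N. a k i * x i))" by (simp add: sum_distrib_left mult.assoc)
      finally show ?thesis unfolding L by (simp add: distrib_left sum.distrib)
    qed
    have z0: "\<forall>k<c. b k + (\<Sum>i<N. a k i * x0 i) = 0" using eq[of x0] insert.prems(2) by auto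
    have "be - (\<Sum>k<c. \<mu> k * b k) = 0" using Lx[of x0] insert.prems(2)[of L] z0 by simp
    then have "(\<forall>L\<in>E. L x = 0) \<Longrightarrow> L x = 0" for x using Lx[of x] eq[of x] by simp
    then have "(\<forall>L'\<in>insert L E. L' x = 0) \<longleftrightarrow> (\<forall>k<c. b k + (\<Sum>i<N. a k i * x i) = 0)" for x
      using eq[of x] by auto
    then show ?thesis by (intro exI[of _ c] exI[of _ a] exI[of _ b]) (use ind in simp)
  next
    case False
    define a' where "a' = a(c := al)"
    define b' where "b' = b(c := be)"
    have "(\<forall>L'\<in>insert L E. L' x = 0) \<longleftrightarrow> (\<forall>k<Suc c. b' k + (\<Sum>i<N. a' k i * x i) = 0)" for x
      using eq[of x] L[of x] by (auto simp: a'_def b'_def less_Suc_eq)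
    moreover have "\<forall>k<Suc c. \<mu> k = 0" if z: "\<forall>i<N. (\<Sum>k<Suc c. \<mu> k * a' k i) = 0" for \<mu>
    proof -
      have s: "(\<Sum>k<c. \<mu> k * a k i) + \<mu> c * al i = 0" if "i < N" for i
        using z that by (auto simp: a'_def)
      have "\<mu> c = 0"
      proof (rule ccontr)
        assume nz: "\<mu> c \<noteq> 0"
        have "al i = (\<Sum>k<c. (- \<mu> k / \<mu> c) * a k i)" if "i < N" for i
        proof -
          have "(\<Sum>k<c. (- \<mu> k / \<mu> c) * a k i) = - (\<Sum>k<c. \<mu> k * a k i) / \<mu> c"
            by (simp add: sum_divide_distrib sum_negf)
          also have "(\<Sum>k<c. \<mu> k * a k i) = - (\<mu> c * al i)" using s[OF that]
              by (simp add: eq_neg_iff_add_eq_0)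
          also have "- (- (\<mu> c * al i)) / \<mu> c = al i" using nz by simp
          finally show ?thesis by simp
        qed
        then have "\<exists>\<mu>. \<forall>i<N. al i = (\<Sum>k<c. \<mu> k * a k i)"
          by (intro exI[of _ "\<lambda>k. - \<mu> k / \<mu> c"]) simp
        with False show False by (rule notE)
      qed
      with s have "\<forall>i<N. (\<Sum>k<c. \<mu> k * a k i) = 0" by simp
      with ind \<open>\<mu> c = 0\<close> show ?thesis by (auto simp: less_Suc_eq)
    qed
    ultimately show ?thesis by (intro exI[of _
        "Suc c"] exI[of _ a'] exI[of _ b'] conjI allI impI) blast+
  qed
qed

text \<open>The differentials of affine-linear equations are constant, so independence of their
  coefficients is independence at every point. Nonemptiness supplies the common zero for
  \<open>independent_subsystem\<close>.\<close>

lemma affine_forms_cut_smooth: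
  fixes V :: "'a fspace" and W :: "(nat \<Rightarrow> complex) set"
  assumes "finite E" and E: "\<And>L. L \<in> E \<Longrightarrow> affine_form {..<N} L" and W: "openin (zariski {..<N}) W"
    and iso: "isomorphic V (subspace_of (affine_space {..<N}) {y \<in> W. \<forall>L\<in>E. L y = 0})"
    and ne: "{y \<in> W. \<forall>L\<in>E. L y = 0} \<noteq> {}"
  shows "smooth_variety V" "quasi_affine_variety V"
proof -
  obtain x0 where x0: "\<And>L. L \<in> E \<Longrightarrow> L x0 = 0" using ne by blast
  have "\<exists>(c::nat) a b. (\<forall>x. (\<forall>L\<in>E. L x = 0) \<longleftrightarrow> (\<forall>k<c. b k + (\<Sum>i<N. a k i * x i) = 0)) \<and>
    (\<forall>\<mu>. (\<forall>i<N. (\<Sum>k<c. \<mu> k * a k i) = 0) \<longrightarrow> (\<forall>k<c. \<mu> k = (0::complex)))"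
    by (rule independent_subsystem[where ?x0.0 = x0]) (use assms(1) E x0 in auto)
  then obtain c :: nat and a b where
    eq: "\<And>x. (\<forall>L\<in>E. L x = 0) \<longleftrightarrow> (\<forall>k<c. b k + (\<Sum>i<N. a k i * x i) = 0)" and
    ind: "\<And>\<mu>. (\<forall>i<N. (\<Sum>k<c. \<mu> k * a k i) = 0) \<Longrightarrow> (\<forall>k<c. \<mu> k = (0::complex))" by blast
  define g where "g = (\<lambda>k x. b k + (\<Sum>i<N. a k i * x i))"
  have aff: "affine_form {..<N} (g k)" for k unfolding affine_form_def g_def by blast
  have gp: "g k \<in> poly_funs {..<N}" for k by (rule affine_form_poly[OF _ aff]) simp
  have pd: "pderivative (g k) i y = a k i" if "i < N" for k i y
    by (rule pderivative_affine[where I = "{..<N}" and b = "b k"]) (use that in \<open>auto simp: g_def\<close>)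
  have set: "{y \<in> W. \<forall>L\<in>E. L y = 0} = {y \<in> W. \<forall>k<c. g k y = 0}" using eq by (simp add: g_def)
  have isoU: "isomorphic (subspace_of V (topspace (ftop V))) (subspace_of (affine_space {..<N}) {y \<in> W. \<forall>k<c. g k y = 0})"
  proof -
    obtain f where f: "isomorphism V (subspace_of (affine_space {..<N}) {y \<in> W. \<forall>k<c. g k y = 0}) f"
      using iso unfolding set isomorphic_def by blast
    have WA: "W \<subseteq> affine_points {..<N}" using openin_subset[OF W] by simp
    obtain f' where f': "\<forall>y\<in>topspace (subtopology (zariski {..<N}) {y \<in> W. \<forall>k<c. g k y =
        0}). f (f' y) = y"
        "continuous_map (subtopology (zariski {..<N}) {y \<in> W. \<forall>k<c. g k y = 0}) (ftop V) f'"
        "continuous_map (ftop V) (subtopology (zariski {..<N}) {y \<in> W. \<forall>k<c. g k y = 0}) f"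
      using f unfolding isomorphism_def morphism_def by auto
    have im: "f ` topspace (ftop V) = {y \<in> W. \<forall>k<c. g k y = 0}"
    proof
      show "f ` topspace (ftop V) \<subseteq> {y \<in> W. \<forall>k<c. g k y = 0}"
        using f'(3) by (auto simp: continuous_map_def)
      show "{y \<in> W. \<forall>k<c. g k y = 0} \<subseteq> f ` topspace (ftop V)"
      proof
        fix y assume y: "y \<in> {y \<in> W. \<forall>k<c. g k y = 0}"
        then have t: "y \<in> topspace (subtopology (zariski {..<N}) {y \<in> W. \<forall>k<c. g k y = 0})" using WA
            by auto
        then have "f' y \<in> topspace (ftop V)" using f'(2) by (auto simp: continuous_map_def)
        then show "y \<in> f ` topspace (ftop V)" using f'(1) t by force
      qed
    qed
    note i1 = isomorphism_restrict[OF f order_refl, unfolded im]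
    note i2 = nested_subspace(1)[OF restricting_affine order_refl, of "{..<N}"
        "{y \<in> W. \<forall>k<c. g k y = 0}"]
    show ?thesis using isomorphism_comp[OF i1 i2] unfolding isomorphic_def by blast
  qed
  show "smooth_variety V"
    unfolding smooth_variety_def
  proof
    fix x assume "x \<in> topspace (ftop V)"
    then show "\<exists>U (N::nat) (c::nat) g W. openin (ftop V) U \<and> x \<in> U \<and>
        openin (zariski {..<N}) W \<and> (\<forall>k<c. g k \<in> poly_funs {..<N}) \<and>
        (\<forall>y\<in>W. (\<forall>k<c. g k y = 0) \<longrightarrow>
           (\<forall>a. (\<forall>i<N. (\<Sum>k<c. a k * pderivative (g k) i y) = 0) \<longrightarrow> (\<forall>k<c. a k = 0))) \<and>
        isomorphic (subspace_of V U)
          (subspace_of (affine_space {..<N}) {y \<in> W. \<forall>k<c. g k y = 0})"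
      using W gp isoU ind pd
      by (intro exI[of _ "topspace (ftop V)"] exI[of _ N] exI[of _ c] exI[of _ g] exI[of _ W]) simp
  qed
  have "closedin (zariski {..<N}) {x \<in> affine_points {..<N}. \<forall>L\<in>E. L x = 0}"
  proof -
    have "openin (zariski {..<N}) {x \<in> affine_points {..<N}. \<exists>p\<in>E. p x \<noteq> 0}"
      unfolding openin_zariski zariski_open_def using affine_form_poly[OF _ E] by blast
    moreover have "affine_points {..<N} - {x \<in> affine_points {..<N}. \<forall>L\<in>E. L x = 0} =
        {x \<in> affine_points {..<N}. \<exists>p\<in>E. p x \<noteq> 0}"
      by auto
    ultimately show ?thesis unfolding closedin_def by auto
  qed
  then have "locally_closed_in (zariski {..<N}) {y \<in> W. \<forall>L\<in>E. L y = 0}"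
    unfolding locally_closed_in_def using W openin_subset[OF W]
    by (intro exI[of _ W] exI[of _ "{x \<in> affine_points {..<N}. \<forall>L\<in>E. L x = 0}"]) auto
  then show "quasi_affine_variety V" unfolding quasi_affine_variety_def using iso by blast
qed

text \<open>Polynomials are continuous in the classical topology. This is the bridge from limits of
  complex numbers to Zariski neighbourhoods.\<close>

lemma poly_tendsto:
  assumes "p \<in> poly_funs I" "\<And>i. i \<in> I \<Longrightarrow> ((\<lambda>s. F s i) \<longlongrightarrow> x i) G"
  shows "((\<lambda>s. p (F s)) \<longlongrightarrow> p x) G"
  using assms(1) by induction (auto intro!: tendsto_intros assms(2))

section \<open>Charts\<close>

text \<open>The level tree of \<open>R\<close> arises from that of \<open>S\<close> by merging levels along \<open>g\<close>.\<close>

definition merges :: "nat \<Rightarrow> mline \<Rightarrow> mline \<Rightarrow> (nat \<Rightarrow> nat) \<Rightarrow> bool" where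
  "merges n S R g \<longleftrightarrow> mono_on {..slen S} g \<and> g ` {..slen S} = {..slen R} \<and>
     (\<forall>i\<in>{1..n}. \<forall>j\<in>{1..n}. slev R i j = g (slev S i j))"

definition scale_of :: "ltree \<Rightarrow> (nat \<Rightarrow> nat \<times> nat) \<Rightarrow> (nat \<Rightarrow> nat \<Rightarrow> complex) \<Rightarrow> nat \<Rightarrow> complex" where
  "scale_of \<Gamma> pr I m = (if m < tlength \<Gamma> then I (fst (pr m)) (snd (pr m)) else 1)"

text \<open>The chart map freed from its choices: the representative enters only through its
  integrals \<open>I\<close>, the contraction only through the level map \<open>g\<close>.\<close>

definition chart_formula ::
  "nat \<Rightarrow> ltree \<Rightarrow> (nat \<Rightarrow> nat \<times> nat) \<Rightarrow> (nat \<Rightarrow> nat) \<Rightarrow> (nat \<Rightarrow> nat \<Rightarrow> complex) \<Rightarrow> coord \<Rightarrow> complex" where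
  "chart_formula n \<Gamma> pr g I k = (if k \<notin> chart_coords n \<Gamma> then 0 else case k of
      Z i j \<Rightarrow> I i j / scale_of \<Gamma> pr I (mlev \<Gamma> i j)
    | T m \<Rightarrow> if g m = g (m - 1) then scale_of \<Gamma> pr I m / scale_of \<Gamma> pr I (m - 1) else 0)"

section \<open>Strata and level functions\<close>

definition key :: "nat \<Rightarrow> mline set \<Rightarrow> nat set set set option" where
  "key n X = (if irreducible_line (representative X) then None else Some (chain_of n (representative X)))"

lemma stratum_iff: "X \<in> stratum n i \<longleftrightarrow> X \<in> moduli n \<and> key n X = i"
  by (cases i) (auto simp: stratum_def key_def)

definition same_levels :: "nat \<Rightarrow> mline \<Rightarrow> mline \<Rightarrow> bool" where
  "same_levels n S R \<longleftrightarrow> slen R = slen S \<and> (\<forall>i\<in>{1..n}. \<forall>j\<in>{1..n}. slev R i j = slev S i j)"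

text \<open>A chain determines its level function and conversely. Length \<open>0\<close>
  corresponds both to irreducible curves and to the empty chain, so the index \<open>None\<close>
  fits in.\<close>

lemma key_eq_iff:
  assumes "X \<in> moduli n" "X' \<in> moduli n"
  shows "key n X = key n X' \<longleftrightarrow> same_levels n (representative X) (representative X')"
proof -
  obtain par apt dpt where l: "line n (representative X) par apt dpt"
    using ex_line[OF stable_representative[OF assms(1)]] by blast
  obtain par' apt' dpt' where l': "line n (representative X') par' apt' dpt'"
    using ex_line[OF stable_representative[OF assms(2)]] by blast
  interpret A: line n "representative X" par apt dpt by fact
  interpret B: line n "representative X'" par' apt' dpt' by fact
  let ?A = "level_function.part n (slev (representative X)) ` {1..slen (representative X)}"
  let ?B = "level_function.part n (slev (representative X')) ` {1..slen (representative X')}"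
  have k: "key n X = (if slen (representative X) = 0 then None else Some ?A)"
    "key n X' = (if slen (representative X') = 0 then None else Some ?B)"
    unfolding key_def A.irreducible_iff B.irreducible_iff A.chain_of_eq B.chain_of_eq by simp_all
  show ?thesis
  proof
    assume eq: "key n X = key n X'"
    have "?A = ?B" using eq unfolding k by (auto split: if_splits)
    from level_function_determined[OF A.level_function B.level_function this]
    show "same_levels n (representative X) (representative X')" unfolding same_levels_def by auto
  next
    assume s: "same_levels n (representative X) (representative X')"
    have "level_function.rel n (slev (representative X)) =
        level_function.rel n (slev (representative X'))"
      using s unfolding level_function.rel_def[OF A.level_function] level_function.rel_def[OF B.level_function]
        same_levels_def by (intro ext) auto
    then have "level_function.part n (slev (representative X)) =
        level_function.part n (slev (representative X'))"
      unfolding level_function.part_def[OF A.level_function] level_function.part_def[OF B.level_function] by (intro ext) simp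
    moreover have "slen (representative X) = slen (representative X')" using s
        by (simp add: same_levels_def)
    ultimately show "key n X = key n X'" unfolding k by simp
  qed
qed

lemma key_in_index: assumes "X \<in> moduli n" shows "key n X \<in> strata_index n"
proof -
  obtain par apt dpt where l: "line n (representative X) par apt dpt"
    using ex_line[OF stable_representative[OF assms]] by blast
  interpret A: line n "representative X" par apt dpt by fact
  show ?thesis
    unfolding key_def strata_index_def A.irreducible_iff A.chain_of_eq
    using level_function.part_chain[OF A.level_function] by (auto simp: Suc_le_eq)
qed

section \<open>Charts in terms of levels and integrals\<close>

locale chart = line n S par apt dpt for n S par apt dpt +
  fixes pr vl
  assumes choice: "chart_choice n (dual_tree S) pr vl"
begin

abbreviation "tree \<equiv> dual_tree S"
abbreviation "lev \<equiv> slev S"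
abbreviation "coords \<equiv> chart_coords n tree"
abbreviation "\<psi> \<equiv> chart_map n tree pr vl"
abbreviation "U \<equiv> chart_domain n tree"

lemma pr_in: "m < len \<Longrightarrow> fst (pr m) \<in> {1..n}" "m < len \<Longrightarrow> snd (pr m) \<in> {1..n}"
  and pr_level: "m < len \<Longrightarrow> lev (fst (pr m)) (snd (pr m)) = m"
  using choice by (auto simp: chart_choice_def chart_vertex_def mlev_def mem_Times_iff)

lemma ex_index: "\<exists>i. i \<in> {1..n}"
  using mlev_attained[of 0] by auto

lemma merges_top: assumes "merges n S R g" "stable_line n R" shows "g len = slen R"
proof -
  obtain i where i: "i \<in> {1..n}" using ex_index by blast
  obtain par' apt' dpt' where "line n R par' apt' dpt'" using ex_line[OF assms(2)] by blast
  then interpret B: line n R par' apt' dpt' .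
  show ?thesis using assms(1) i mlev_self[OF i] B.mlev_self[OF i] unfolding merges_def by metis
qed

lemma merges_id: "same_levels n S R \<Longrightarrow> merges n S R (\<lambda>m. m)"
  by (auto simp: merges_def same_levels_def mono_on_def)

lemma contraction_iff:
  assumes "stable_line n R"
  shows "(\<exists>f. contraction n tree (dual_tree R) f) \<longleftrightarrow> (\<exists>g. merges n S R g)"
proof -
  obtain par' apt' dpt' where "line n R par' apt' dpt'" using ex_line[OF assms] by blast
  then interpret B: line n R par' apt' dpt' .
  interpret two_trees "dual_tree S" par n "dual_tree R" par' by unfold_locales
  show ?thesis
  proof
    assume "\<exists>f. contraction n tree (dual_tree R) f"
    then obtain f where "contraction n tree (dual_tree R) f" by blast
    from contraction_levels[OF this] show "\<exists>g. merges n S R g" unfolding merges_def by blast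
  next
    assume "\<exists>g. merges n S R g"
    then obtain g where "merges n S R g" by blast
    then show "\<exists>f. contraction n tree (dual_tree R) f"
      by (intro ex_contraction[of g]) (simp_all add: merges_def)
  qed
qed

lemma domain_iff:
  "X \<in> U \<longleftrightarrow> X \<in> moduli n \<and> (\<exists>g. merges n S (representative X) g) \<and>
    (\<forall>i\<in>{1..n}. \<forall>j\<in>{1..n}. lev i j < len \<longrightarrow>
      slev (representative X) i j = slen (representative X) \<longrightarrow> I_map (representative X) i j \<noteq> 0)"
proof (cases "X \<in> moduli n")
  case True
  note st = stable_representative[OF True]
  obtain par' apt' dpt' where "line n (representative X) par' apt' dpt'" using ex_line[OF st] by blast
  then interpret B: line n "representative X" par' apt' dpt' .
  have "(tmark tree i \<noteq> tmark tree j \<longrightarrow> Pi_map (representative X) i j \<noteq> Fin 0) \<longleftrightarrow>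
      (lev i j < len \<longrightarrow> slev (representative X) i j = slen (representative X) \<longrightarrow> I_map (representative X) i j \<noteq> 0)"
    if ij: "i \<in> {1..n}" "j \<in> {1..n}" for i j
  proof -
    have "tmark tree i \<noteq> tmark tree j \<longleftrightarrow> lev i j < len"
      unfolding mlev_top[OF ij, symmetric] using mlev_le[OF ij] by linarith
    then show ?thesis unfolding B.Pi_map_eq[OF ij] by simp
  qed
  then have "(\<forall>i\<in>{1..n}. \<forall>j\<in>{1..n}. tmark tree i \<noteq> tmark tree j \<longrightarrow>
      Pi_map (representative X) i j \<noteq> Fin 0) \<longleftrightarrow>
      (\<forall>i\<in>{1..n}. \<forall>j\<in>{1..n}. lev i j < len \<longrightarrow>
        slev (representative X) i j = slen (representative X) \<longrightarrow> I_map (representative X) i j \<noteq> 0)"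
    by (intro ball_cong refl)
  then show ?thesis using True
      unfolding chart_domain_def contraction_iff[OF st, symmetric] mem_Collect_eq by simp
qed (simp add: chart_domain_def)

text \<open>Of the contraction chosen by \<open>SOME\<close> only the equivalence of the images of
  two consecutive chart vertices matters. The map that it induces on levels is forced by the two
  level functions, since every level is attained, so any merging \<open>g\<close> gives the same
  coordinates.\<close>

lemma chart_map_eq:
  assumes X: "X \<in> moduli n" and g: "merges n S (representative X) g"
  shows "\<psi> X = chart_formula n tree pr g (I_map (representative X))"
proof -
  note st = stable_representative[OF X]
  obtain par' apt' dpt' where "line n (representative X) par' apt' dpt'" using ex_line[OF st] by blast
  then interpret B: line n "representative X" par' apt' dpt' .
  interpret two_trees "dual_tree S" par n "dual_tree (representative X)" par' by unfold_locales
  define f where "f = (SOME f. contraction n tree (dual_tree (representative X)) f)"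
  have "\<exists>f. contraction n tree (dual_tree (representative X)) f"
    unfolding contraction_iff[OF st] using g by blast
  then have con: "contraction n tree (dual_tree (representative X)) f"
    unfolding f_def by (rule someI_ex)
  from contraction_levels[OF con] obtain g' where
    g': "\<And>v. v \<in> comps S \<Longrightarrow> B.lv (f v) = g' (lv v)"
      "\<And>i j. i \<in> {1..n} \<Longrightarrow> j \<in> {1..n} \<Longrightarrow> slev (representative X) i j = g' (lev i j)" by auto
  have fV: "f v \<in> comps (representative X)" if "v \<in> comps S" for v
    using con that unfolding contraction_def by auto
  have gg: "g' m = g m" if m: "m \<le> len" for m
  proof -
    obtain i j where "i \<in> {1..n}" "j \<in> {1..n}" "lev i j = m" using mlev_attained[OF m] by blast
    then show ?thesis using g'(2) g unfolding merges_def by metis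
  qed
  let ?v = "chart_vertex tree pr vl"
  have v: "?v m \<in> comps S \<and> lv (?v m) = m" if "m \<le> len" for m
  proof (cases "m < len")
    case True
    then show ?thesis using pr_level[OF True] meet_in[OF pr_in(1)[OF True] pr_in(2)[OF True]]
      by (simp add: chart_vertex_def mlev_def)
  next
    case False
    have "terminal tree vl" using choice by (simp add: chart_choice_def)
    then show ?thesis using False that terminal_level by (simp add: chart_vertex_def)
  qed
  have eqv: "tequiv (dual_tree (representative X)) (f (?v m)) (f (?v (m - 1))) \<longleftrightarrow> g m = g (m - 1)" if m:
      "m \<le> len" for m
  proof -
    have m1: "m - 1 \<le> len" using m by simp
    have "tequiv (dual_tree (representative X)) (f (?v m)) (f (?v (m - 1))) \<longleftrightarrow> B.lv (f (?v m)) =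
        B.lv (f (?v (m - 1)))"
      using B.lv_eq_iff[of "f (?v m)" "f (?v (m - 1))"] fV v[OF m] v[OF m1] by simp
    then show ?thesis using g'(1) v[OF m] v[OF m1] gg[OF m] gg[OF m1] by simp
  qed
  have sc: "chart_scale tree pr (representative X) = scale_of tree pr (I_map (representative X))"
    by (intro ext) (simp add: chart_scale_def scale_of_def)
  show ?thesis
  proof
    fix k
    show "\<psi> X k = chart_formula n tree pr g (I_map (representative X)) k"
    proof (cases "k \<in> coords")
      case True
      show ?thesis
      proof (cases k)
        case (Z i j)
        then show ?thesis using True unfolding chart_map_def chart_formula_def Let_def sc
            by (simp add: mlev_def)
      next
        case (T m)
        then have "m \<le> len" using True by (auto simp: chart_coords_def)
        from eqv[OF this] T True show ?thesis
          unfolding chart_map_def chart_formula_def Let_def sc f_def[symmetric] by simp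
      qed
    qed (simp add: chart_map_def chart_formula_def Let_def)
  qed
qed

text \<open>Both integrals in a quotient belong to components on one level of \<open>R\<close>, so
  the factor cancels: for \<open>Z\<close> by the choice of the scale, for \<open>T\<close> because
  the quotient is formed only if \<open>g m = g (m - 1)\<close>. At the top level the scale is fixed
  to \<open>1\<close>, which is why \<open>C\<close> has to be \<open>1\<close> there.\<close>

lemma chart_formula_scale:
  assumes g: "merges n S R g" "stable_line n R" and C: "\<And>m. m \<le> slen R \<Longrightarrow> C m \<noteq> 0" "C (slen R) = 1"
    and I: "\<And>i j. i \<in> {1..n} \<Longrightarrow> j \<in> {1..n} \<Longrightarrow> I' i j = C (slev R i j) * I i j"
  shows "chart_formula n tree pr g I' = chart_formula n tree pr g I"
proof -
  have gle: "g m \<le> slen R" if "m \<le> len" for m using g(1) that unfolding merges_def by blast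
  have I': "I' i j = C (g (lev i j)) * I i j" if "i \<in> {1..n}" "j \<in> {1..n}" for i j
    using I[OF that] g(1) that unfolding merges_def by simp
  have sc: "scale_of tree pr I' m = C (g m) * scale_of tree pr I m" if m: "m \<le> len" for m
  proof (cases "m < len")
    case True
    then show ?thesis using I'[OF pr_in(1)[OF True] pr_in(2)[OF True]] pr_level[OF True]
        by (simp add: scale_of_def)
  next
    case False
    then show ?thesis using m merges_top[OF g] C(2) by (simp add: scale_of_def)
  qed
  show ?thesis
  proof
    fix k
    show "chart_formula n tree pr g I' k = chart_formula n tree pr g I k"
    proof (cases "k \<in> coords")
      case True
      show ?thesis
      proof (cases k)
        case (Z i j)
        then have ij: "i \<in> {1..n}" "j \<in> {1..n}" using True by (auto simp: chart_coords_def)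
        show ?thesis using True Z I'[OF ij] sc[OF mlev_le[OF ij]] C(1)[OF gle[OF mlev_le[OF ij]]]
          by (simp add: chart_formula_def)
      next
        case (T m)
        then have m: "m \<le> len" "m - 1 \<le> len" using True by (auto simp: chart_coords_def)
        show ?thesis using True T sc[OF m(1)] sc[OF m(2)] C(1)[OF gle[OF m(1)]] C(1)[OF gle[OF m(2)]]
          by (simp add: chart_formula_def)
      qed
    qed (simp add: chart_formula_def)
  qed
qed

text \<open>\<open>deform\<close> produces a line with the given positions; its class may have
  another representative, but the coordinates do not see the difference. The last assumption takes
  care of the condition on \<open>Pi_map\<close> in the chart domain.\<close>

lemma realize:
  assumes R: "stable_line n R" and g: "merges n S R g" and y: "positions n (slen R) (slev R) y"
    and I: "I = (\<lambda>i j. y (slev R i j) j - y (slev R i j) i)"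
    and nz: "\<And>i j. i \<in> {1..n} \<Longrightarrow> j \<in> {1..n} \<Longrightarrow> lev i j < len \<Longrightarrow> I i j \<noteq> 0"
  shows "\<exists>X\<in>U. same_levels n R (representative X) \<and> \<psi> X = chart_formula n tree pr g I"
proof -
  obtain par' apt' dpt' where "line n R par' apt' dpt'" using ex_line[OF R] by blast
  then interpret B: line n R par' apt' dpt' .
  from B.deform[OF y] obtain S' where S': "stable_line n S'" "dual_tree S' = dual_tree R"
    "\<And>i j. i \<in> {1..n} \<Longrightarrow> j \<in> {1..n} \<Longrightarrow> I_map S' i j = I i j" unfolding I by blast
  obtain X where X: "X \<in> moduli n" "stable_line n (representative X)" "slen (representative X) = slen R"
    "\<And>i j. i \<in> {1..n} \<Longrightarrow> j \<in> {1..n} \<Longrightarrow> slev (representative X) i j = slev R i j"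
    "\<exists>C. (\<forall>m\<le>slen R. C m \<noteq> 0) \<and> C (slen R) = 1 \<and>
      (\<forall>i\<in>{1..n}. \<forall>j\<in>{1..n}. I_map (representative X) i j = C (slev R i j) * I_map S' i j)"
    using moduli_of_line[OF S'(1)] unfolding S'(2) by blast
  from X(5) obtain C where C': "\<forall>m\<le>slen R. C m \<noteq> 0" "C (slen R) = 1"
    "\<forall>i\<in>{1..n}. \<forall>j\<in>{1..n}. I_map (representative X) i j = C (slev R i j) * I_map S' i j" by blast
  have C: "C m \<noteq> 0" if "m \<le> slen R" for m using C'(1) that by blast
  have CI: "I_map (representative X) i j = C (slev R i j) * I i j" if "i \<in> {1..n}" "j \<in> {1..n}" for i j
    using C'(3) S'(3) that by simp
  have gX: "merges n S (representative X) g" using g X(3,4) unfolding merges_def by simp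
  have "\<psi> X = chart_formula n tree pr g (I_map (representative X))" by (rule chart_map_eq[OF X(1) gX])
  also have "\<dots> = chart_formula n tree pr g I" by (rule chart_formula_scale[OF g R C C'(2) CI])
  finally have "\<psi> X = chart_formula n tree pr g I" .
  moreover have "X \<in> U"
    unfolding domain_iff
  proof (intro conjI ballI impI X(1) exI[of _ g] gX)
    fix i j assume ij: "i \<in> {1..n}" "j \<in> {1..n}" "lev i j < len"
    show "I_map (representative X) i j \<noteq> 0"
      using CI[OF ij(1,2)] nz[OF ij] C[OF B.mlev_le[OF ij(1,2)]] by simp
  qed
  ultimately show ?thesis using X(3,4) unfolding same_levels_def by blast
qed

lemma I_nonzero:
  assumes "stable_line n R" "i \<in> {1..n}" "j \<in> {1..n}" "slev R i j < slen R"
  shows "I_map R i j \<noteq> 0"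
proof -
  obtain par' apt' dpt' where "line n R par' apt' dpt'" using ex_line[OF assms(1)] by blast
  then interpret B: line n R par' apt' dpt' .
  obtain x where x: "positions n (slen R) (slev R) x"
    "\<forall>i\<in>{1..n}. \<forall>j\<in>{1..n}. I_map R i j = x (slev R i j) j - x (slev R i j) i" using B.ex_positions
        by blast
  have "x (slev R i j) i \<noteq> x (slev R i j) j" using x(1) assms(2-4) unfolding positions_def by blast
  moreover have "I_map R i j = x (slev R i j) j - x (slev R i j) i" using x(2) assms(2,3) by blast
  ultimately show ?thesis by simp
qed

text \<open>On the chart domain all scales are nonzero, so the coordinate \<open>T m\<close>
  vanishes only if \<open>g\<close> jumps at \<open>m\<close>. A monotone surjection that jumps at
  every step is the identity.\<close>

lemma same_levels_iff:
  assumes X: "X \<in> moduli n"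
  shows "same_levels n S (representative X) \<longleftrightarrow> X \<in> U \<and> (\<forall>m\<in>{1..len}. \<psi> X (T m) = 0)"
proof
  note st = stable_representative[OF X]
  assume s: "same_levels n S (representative X)"
  have "X \<in> U" unfolding domain_iff
    using X merges_id[OF s] I_nonzero[OF st] s unfolding same_levels_def by auto
  moreover have "\<psi> X (T m) = 0" if "m \<in> {1..len}" for m
    using that unfolding chart_map_eq[OF X merges_id[OF s]] chart_formula_def by auto
  ultimately show "X \<in> U \<and> (\<forall>m\<in>{1..len}. \<psi> X (T m) = 0)" by blast
next
  note st = stable_representative[OF X]
  assume a: "X \<in> U \<and> (\<forall>m\<in>{1..len}. \<psi> X (T m) = 0)"
  then obtain g where g: "merges n S (representative X) g"
    and nz: "\<And>i j. i \<in> {1..n} \<Longrightarrow> j \<in> {1..n} \<Longrightarrow> lev i j < len \<Longrightarrow> slev (representative X) i j =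
        slen (representative X)
      \<Longrightarrow> I_map (representative X) i j \<noteq> 0"
    unfolding domain_iff by blast
  have g1: "mono_on {..len} g" "g ` {..len} = {..slen (representative X)}"
    and g2: "\<And>i j. i \<in> {1..n} \<Longrightarrow> j \<in> {1..n} \<Longrightarrow> slev (representative X) i j = g (lev i j)"
    using g unfolding merges_def by auto
  have sc: "scale_of tree pr (I_map (representative X)) m \<noteq> 0" for m
  proof (cases "m < len")
    case True
    note p = pr_in(1)[OF True] pr_in(2)[OF True]
    have "g m \<in> g ` {..len}" using True by simp
    then have "g m \<in> {..slen (representative X)}" unfolding g1(2) .
    then have "slev (representative X) (fst (pr m)) (snd (pr m)) = slen (representative X) \<or>
        slev (representative X) (fst (pr m)) (snd (pr m)) < slen (representative X)"
      using g2[OF p] pr_level[OF True] by auto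
    then show ?thesis using nz[OF p] I_nonzero[OF st p] pr_level[OF True] True
        by (auto simp: scale_of_def)
  qed (simp add: scale_of_def)
  have jump: "g m \<noteq> g (m - 1)" if m: "m \<in> {1..len}" for m
  proof
    assume "g m = g (m - 1)"
    then have "\<psi> X (T m) \<noteq> 0"
      using m sc unfolding chart_map_eq[OF X g] chart_formula_def by (auto simp: chart_coords_def)
    then show False using a m by blast
  qed
  have "inj_on g {..len}"
  proof (rule inj_onI, rule ccontr)
    fix b c assume bc: "b \<in> {..len}" "c \<in> {..len}" "g b = g c" "b \<noteq> c"
    have *: False if "b < c" "c \<le> len" "g b = g c" for b c
    proof -
      have "g b \<le> g (c - 1)" "g (c - 1) \<le> g c" using mono_onD[OF g1(1), of b
          "c - 1"] mono_onD[OF g1(1), of "c - 1" c] that by auto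
      then show False using jump[of c] that by auto
    qed
    from bc(4) show False using *[of b c] *[of c b] bc by (cases "b < c") auto
  qed
  note id = strict_mono_onto_id[OF g1(1) this g1(2)]
  show "same_levels n S (representative X)" unfolding same_levels_def using id g2 mlev_le by auto
qed

end

section \<open>The image of a stratum in its chart\<close>

lemma openin_nonvanishing:
  assumes "finite K" "K \<subseteq> I"
  shows "openin (zariski I) {x \<in> affine_points I. \<forall>k\<in>K. x k \<noteq> 0}"
proof -
  have "(\<lambda>x. \<Prod>k\<in>K. x k) \<in> poly_funs I"
    using assms
  proof (induction K)
    case (insert k K)
    then have "(\<lambda>x. \<Prod>k\<in>K. x k) \<in> poly_funs I" "k \<in> I" by auto
    then have "(\<lambda>x. x k * (\<Prod>k\<in>K. x k)) \<in> poly_funs I" by (intro poly_mult poly_coord)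
    then show ?case using insert.hyps by simp
  qed (simp add: poly_const)
  then have "{\<lambda>x. \<Prod>k\<in>K. x k} \<subseteq> poly_funs I" by simp
  moreover have "{x \<in> affine_points I. \<forall>k\<in>K. x k \<noteq> 0} =
      {x \<in> affine_points I. \<exists>p\<in>{\<lambda>x. \<Prod>k\<in>K. x k}. p x \<noteq> 0}"
    using assms(1) by auto
  ultimately show ?thesis unfolding openin_zariski zariski_open_def by (intro exI conjI)
qed

text \<open>The coordinates \<open>z_ij\<close> exist for \<open>i < j\<close> only; this is their
  antisymmetric extension, as an integral changes sign when its endpoints are exchanged.\<close>

definition zeta :: "(coord \<Rightarrow> complex) \<Rightarrow> nat \<Rightarrow> nat \<Rightarrow> complex" where
  "zeta x i j = (if i < j then x (Z i j) else if j < i then - x (Z j i) else 0)"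

context chart begin

lemma finite_coords: "finite coords"
proof -
  have "coords \<subseteq> (\<lambda>(i, j). Z i j) ` ({1..n} \<times> {1..n}) \<union> T ` {1..len}"
    by (auto simp: chart_coords_def)
  then show ?thesis by (rule finite_subset) simp
qed

lemma Z_coords: "i \<in> {1..n} \<Longrightarrow> j \<in> {1..n} \<Longrightarrow> i < j \<Longrightarrow> Z i j \<in> coords"
  and T_coords: "m \<in> {1..len} \<Longrightarrow> T m \<in> coords"
  by (auto simp: chart_coords_def)

text \<open>Positions read off from coordinates: on each block of level \<open>m\<close> the least element is the
  origin.\<close>

definition base :: "nat \<Rightarrow> nat \<Rightarrow> nat" where
  "base m i = Min {k \<in> {1..n}. m \<le> lev i k}"

definition ypos :: "(coord \<Rightarrow> complex) \<Rightarrow> nat \<Rightarrow> nat \<Rightarrow> complex" where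
  "ypos x m i = (if lev (base m i) i = m then zeta x (base m i) i else 0)"

lemma base_in:
  assumes "i \<in> {1..n}" "m \<le> len"
  shows "base m i \<in> {1..n}" "m \<le> lev i (base m i)"
proof -
  have "i \<in> {k \<in> {1..n}. m \<le> lev i k}" using assms mlev_self[OF assms(1)] by simp
  moreover have "finite {k \<in> {1..n}. m \<le> lev i k}" by simp
  ultimately have "base m i \<in> {k \<in> {1..n}. m \<le> lev i k}" unfolding base_def by (intro Min_in) blast+
  then show "base m i \<in> {1..n}" "m \<le> lev i (base m i)" by auto
qed

lemma base_eq:
  assumes ij: "i \<in> {1..n}" "j \<in> {1..n}" and m: "m \<le> lev i j"
  shows "base m i = base m j"
proof -
  have "{k \<in> {1..n}. m \<le> lev i k} = {k \<in> {1..n}. m \<le> lev j k}"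
  proof (rule Collect_cong)
    fix k
    show "k \<in> {1..n} \<and> m \<le> lev i k \<longleftrightarrow> k \<in> {1..n} \<and> m \<le> lev j k"
      using mlev_ultra[OF ij(2,1), of k m] mlev_ultra[OF ij, of k m] mlev_sym[OF ij] m by auto
  qed
  then show ?thesis by (simp add: base_def)
qed

text \<open>On the chart domain these equations already cut out the stratum; the other three
  families describe which coordinate vectors are attained there.\<close>

definition eqs1 :: "((coord \<Rightarrow> complex) \<Rightarrow> complex) set" where
  "eqs1 = (\<lambda>m x. x (T m)) ` {1..len}"

text \<open>The integral of a chosen pair is the unit of length on its level, so its coordinate is
  \<open>1\<close>.\<close>

definition eqs2 :: "((coord \<Rightarrow> complex) \<Rightarrow> complex) set" where
  "eqs2 = (\<lambda>m x. zeta x (fst (pr m)) (snd (pr m)) - 1) ` {..<len}"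

text \<open>Additivity of integrals: a coordinate is the difference of two positions, which
  \<open>ypos\<close> measures from a common base point.\<close>

definition eqs3 :: "((coord \<Rightarrow> complex) \<Rightarrow> complex) set" where
  "eqs3 = (\<lambda>(i, j) x. x (Z i j) - (ypos x (lev i j) j - ypos x (lev i j) i)) ` {(i, j) \<in> {1..n} \<times> {1..n}. i < j}"

text \<open>Marks that separate only above level \<open>m\<close> lie on the same branch there and
  must have the same position.\<close>

definition eqs4 :: "((coord \<Rightarrow> complex) \<Rightarrow> complex) set" where
  "eqs4 = (\<lambda>(m, i, j) x. ypos x m i - ypos x m j) ` {(m, i, j) \<in> {..len} \<times> {1..n} \<times> {1..n}. m < lev i j}"

definition eqs :: "((coord \<Rightarrow> complex) \<Rightarrow> complex) set" where
  "eqs = eqs1 \<union> eqs2 \<union> eqs3 \<union> eqs4"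

lemma finite_eqs: "finite eqs"
proof -
  have "finite {(i, j) \<in> {1..n} \<times> {1..n}. i < j}" by (rule finite_subset[of _ "{1..n} \<times> {1..n}"]) auto
  moreover have "finite {(m, i, j) \<in> {..len} \<times> {1..n} \<times> {1..n}. m < lev i j}"
    by (rule finite_subset[of _ "{..len} \<times> {1..n} \<times> {1..n}"]) auto
  ultimately show ?thesis unfolding eqs_def eqs1_def eqs2_def eqs3_def eqs4_def by auto
qed

lemma zeta_form: "i \<in> {1..n} \<Longrightarrow> j \<in> {1..n} \<Longrightarrow> affine_form coords (\<lambda>x. zeta x i j)"
  unfolding zeta_def using Z_coords[of i j] Z_coords[of j i] finite_coords
  by (cases i j rule: linorder_cases) (auto intro!: affine_form_coord affine_form_neg affine_form_const)

lemma ypos_form: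
  assumes "i \<in> {1..n}" "m \<le> len" shows "affine_form coords (\<lambda>x. ypos x m i)"
  unfolding ypos_def using zeta_form[OF base_in(1)[OF assms] assms(1)] affine_form_const
  by (cases "lev (base m i) i = m") simp_all

lemma eqs_form: "L \<in> eqs \<Longrightarrow> affine_form coords L"
proof -
  have 1: "affine_form coords (\<lambda>x. x (T m))" if "m \<in> {1..len}" for m
    by (rule affine_form_coord[OF finite_coords T_coords[OF that]])
  have 2: "affine_form coords (\<lambda>x. zeta x (fst (pr m)) (snd (pr m)) - 1)" if "m \<in> {..<len}" for m
    using that by (intro affine_form_diff zeta_form affine_form_const pr_in) simp_all
  have 3: "affine_form coords (\<lambda>x. x (Z i j) - (ypos x (lev i j) j - ypos x (lev i j) i))"
    if "i \<in> {1..n}" "j \<in> {1..n}" "i < j" for i j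
    by (intro affine_form_diff ypos_form affine_form_coord finite_coords Z_coords mlev_le that)
  have 4: "affine_form coords (\<lambda>x. ypos x m i - ypos x m j)"
    if "m \<le> len" "i \<in> {1..n}" "j \<in> {1..n}" for m i j
    by (intro affine_form_diff ypos_form that)
  assume "L \<in> eqs"
  then show ?thesis
    unfolding eqs_def
  proof (elim UnE)
    assume "L \<in> eqs1" then show ?thesis unfolding eqs1_def by (elim imageE) (simp only: 1)
  next
    assume "L \<in> eqs2" then show ?thesis unfolding eqs2_def by (elim imageE) (simp only: 2)
  next
    assume "L \<in> eqs3" then show ?thesis unfolding eqs3_def by (elim imageE) (use 3 in auto)
  next
    assume "L \<in> eqs4" then show ?thesis unfolding eqs4_def by (elim imageE) (use 4 in auto)
  qed
qed

lemma eqs_iff: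
  "(\<forall>L\<in>eqs. L x = 0) \<longleftrightarrow> (\<forall>m\<in>{1..len}. x (T m) = 0) \<and>
    (\<forall>m<len. zeta x (fst (pr m)) (snd (pr m)) = 1) \<and>
    (\<forall>i\<in>{1..n}. \<forall>j\<in>{1..n}. i < j \<longrightarrow> x (Z i j) = ypos x (lev i j) j - ypos x (lev i j) i) \<and>
    (\<forall>i\<in>{1..n}. \<forall>j\<in>{1..n}. \<forall>m<lev i j. ypos x m i = ypos x m j)"
  (is "?E \<longleftrightarrow> ?A \<and> ?B \<and> ?C \<and> ?D")
proof -
  have "(\<forall>L\<in>eqs1. L x = 0) \<longleftrightarrow> ?A" by (auto simp: eqs1_def)
  moreover have "(\<forall>L\<in>eqs2. L x = 0) \<longleftrightarrow> ?B" by (auto simp: eqs2_def)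
  moreover have "(\<forall>L\<in>eqs3. L x = 0) \<longleftrightarrow> ?C" unfolding eqs3_def by fastforce
  moreover have "(\<forall>L\<in>eqs4. L x = 0) \<longleftrightarrow> ?D"
  proof
    assume e: "\<forall>L\<in>eqs4. L x = 0"
    show ?D
    proof (intro ballI allI impI)
      fix i j m assume ij: "i \<in> {1..n}" "j \<in> {1..n}" "m < lev i j"
      then have "m \<le> len" using mlev_le[OF ij(1,2)] by simp
      then have "(\<lambda>x. ypos x m i - ypos x m j) \<in> eqs4"
        unfolding eqs4_def using ij by (intro image_eqI[of _ _ "(m, i, j)"]) auto
      from bspec[OF e this] show "ypos x m i = ypos x m j" by simp
    qed
  next
    assume ?D
    then show "\<forall>L\<in>eqs4. L x = 0" unfolding eqs4_def by auto
  qed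
  ultimately show ?thesis unfolding eqs_def by blast
qed

lemma target_iff:
  "x \<in> chart_target n tree \<longleftrightarrow> x \<in> affine_points coords \<and>
    (\<forall>i\<in>{1..n}. \<forall>j\<in>{1..n}. i < j \<longrightarrow> lev i j < len \<longrightarrow> x (Z i j) \<noteq> 0)"
proof -
  have "tmark tree i \<noteq> tmark tree j \<longleftrightarrow> lev i j < len" if ij: "i \<in> {1..n}" "j \<in> {1..n}" for i j
    unfolding mlev_top[OF ij, symmetric] using mlev_le[OF ij] by linarith
  note tn = this
  have "(\<forall>i j. 1 \<le> i \<and> i < j \<and> j \<le> n \<and> tmark tree i \<noteq> tmark tree j \<longrightarrow> x (Z i j) \<noteq> 0) \<longleftrightarrow>
      (\<forall>i\<in>{1..n}. \<forall>j\<in>{1..n}. i < j \<longrightarrow> lev i j < len \<longrightarrow> x (Z i j) \<noteq> 0)" (is "?P \<longleftrightarrow> ?Q")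
  proof
    assume P: ?P
    show ?Q
    proof (intro ballI impI)
      fix i j assume "i \<in> {1..n}" "j \<in> {1..n}" "i < j" "lev i j < len"
      then show "x (Z i j) \<noteq> 0" using P[rule_format, of i j] tn[of i j] by simp
    qed
  next
    assume Q: ?Q
    show ?P
    proof (intro allI impI)
      fix i j assume "1 \<le> i \<and> i < j \<and> j \<le> n \<and> tmark tree i \<noteq> tmark tree j"
      then show "x (Z i j) \<noteq> 0" using Q[rule_format, of i j] tn[of i j] by simp
    qed
  qed
  then show ?thesis unfolding chart_target_def mem_Collect_eq by simp
qed

lemma target_open: "openin (zariski coords) (chart_target n tree)"
proof -
  let ?K = "{Z i j | i j. i \<in> {1..n} \<and> j \<in> {1..n} \<and> i < j \<and> lev i j < len}"
  have K: "?K \<subseteq> coords" using Z_coords by blast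
  have "chart_target n tree = {x \<in> affine_points coords. \<forall>k\<in>?K. x k \<noteq> 0}"
    by (intro set_eqI) (auto simp only: target_iff mem_Collect_eq)
  then show ?thesis using openin_nonvanishing[OF finite_subset[OF K finite_coords] K] by simp
qed

text \<open>For a line of the stratum, \<open>ypos\<close> returns its positions measured from the
  base of the block in units of the scale, so all equations hold. Conversely, for a solution
  \<open>ypos\<close> is itself an admissible family of positions, and the class realizing it has
  the given coordinates because the chosen pairs have difference \<open>1\<close>.\<close>

lemma stratum_image:
  "\<psi> ` {X \<in> moduli n. same_levels n S (representative X)} = {x \<in> chart_target n tree. \<forall>L\<in>eqs. L x = 0}"
proof (intro equalityI subsetI)
  fix x assume "x \<in> \<psi> ` {X \<in> moduli n. same_levels n S (representative X)}"
  then obtain X where X: "X \<in> moduli n" and s: "same_levels n S (representative X)" and x: "x = \<psi> X"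
      by blast
  note st = stable_representative[OF X]
  obtain par' apt' dpt' where "line n (representative X) par' apt' dpt'" using ex_line[OF st] by blast
  then interpret B: line n "representative X" par' apt' dpt' .
  define R where "R = representative X"
  have lR: "slen R = len" "\<And>i j. i \<in> {1..n} \<Longrightarrow> j \<in> {1..n} \<Longrightarrow> slev R i j = lev i j"
    using s unfolding same_levels_def R_def by auto
  obtain p where p: "positions n (slen R) (slev R) p"
    and pI: "\<And>i j. i \<in> {1..n} \<Longrightarrow> j \<in> {1..n} \<Longrightarrow> I_map R i j = p (slev R i j) j - p (slev R i j) i"
    using B.ex_positions unfolding R_def by blast
  have I: "I_map R i j = p (lev i j) j - p (lev i j) i" if "i \<in> {1..n}" "j \<in> {1..n}" for i j
    using pI[OF that] lR(2)[OF that] by simp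
  have pne: "p (lev i j) i \<noteq> p (lev i j) j" if "i \<in> {1..n}" "j \<in> {1..n}" "lev i j < len" for i j
    using p that lR unfolding positions_def by metis
  have peq: "p m i = p m j" if "i \<in> {1..n}" "j \<in> {1..n}" "m < lev i j" for i j m
    using p that lR(2)[OF that(1,2)] unfolding positions_def by metis
  define sc where "sc = scale_of tree pr (I_map R)"
  have scI: "sc m = I_map R (fst (pr m)) (snd (pr m))" if "m < len" for m using that
      by (simp add: sc_def scale_of_def)
  have sc0: "sc m \<noteq> 0" for m
  proof (cases "m < len")
    case True
    then show ?thesis using scI[OF True] I[OF pr_in(1)[OF True] pr_in(2)[OF True]]
        pne[OF pr_in(1)[OF True] pr_in(2)[OF True]] pr_level[OF True] by auto
  qed (simp add: sc_def scale_of_def)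
  have xf: "x = chart_formula n tree pr (\<lambda>m. m) (I_map R)"
    unfolding x R_def by (rule chart_map_eq[OF X merges_id[OF s]])
  have xZ: "x (Z i j) = I_map R i j / sc (lev i j)" if "i \<in> {1..n}" "j \<in> {1..n}" "i < j" for i j
    using Z_coords[OF that] by (simp add: xf chart_formula_def sc_def)
  have xT: "x (T m) = 0" if "m \<in> {1..len}" for m
    using that by (auto simp: xf chart_formula_def)
  have z: "zeta x i j = (p (lev i j) j - p (lev i j) i) / sc (lev i j)" if ij: "i \<in> {1..n}"
      "j \<in> {1..n}" for i j
    using xZ[of i j] xZ[of j i] I[OF ij] I[OF ij(2,1)] mlev_sym[OF ij] ij
    by (cases i j rule: linorder_cases) (simp_all add: zeta_def minus_divide_left)
  have y: "ypos x m i = (p m i - p m (base m i)) / sc m" if i: "i \<in> {1..n}" and m: "m \<le> len" for m i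
  proof (cases "lev (base m i) i = m")
    case True
    then show ?thesis using z[OF base_in(1)[OF i m] i] by (simp add: ypos_def)
  next
    case False
    \<comment> \<open>The base and \<open>i\<close> separate only above \<open>m\<close>, so they
      have equal positions and the value \<open>0\<close> in \<open>ypos\<close> is correct.\<close>
    then have "m < lev i (base m i)" using base_in[OF i m] mlev_sym[OF i base_in(1)[OF i m]] by simp
    then have "p m i = p m (base m i)" by (rule peq[OF i base_in(1)[OF i m]])
    then show ?thesis using False by (simp add: ypos_def)
  qed
  have "x (Z i j) = ypos x (lev i j) j - ypos x (lev i j) i" if ij: "i \<in> {1..n}" "j \<in> {1..n}" "i < j"
      for i j
    using xZ[OF ij] I[OF ij(1,2)] y[OF ij(1) mlev_le[OF ij(1,2)]] y[OF ij(2) mlev_le[OF ij(1,2)]]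
      base_eq[OF ij(1,2) order_refl] by (simp add: diff_divide_distrib)
  moreover have "ypos x m i = ypos x m j" if ij: "i \<in> {1..n}" "j \<in> {1..n}" "m < lev i j" for i j m
  proof -
    have m: "m \<le> len" using ij mlev_le[OF ij(1,2)] by simp
    have "base m i = base m j" using base_eq[OF ij(1,2)] ij(3) by simp
    then show ?thesis using y[OF ij(1) m] y[OF ij(2) m] peq[OF ij] by simp
  qed
  moreover have "zeta x (fst (pr m)) (snd (pr m)) = 1" if m: "m < len" for m
    using z[OF pr_in(1)[OF m] pr_in(2)[OF m]] I[OF pr_in(1)[OF m] pr_in(2)[OF m]] pr_level[OF m] scI[OF m] sc0[of m] by simp
  ultimately have "\<forall>L\<in>eqs. L x = 0" unfolding eqs_iff using xT by blast
  moreover have "x \<in> chart_target n tree" unfolding target_iff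
  proof (intro conjI ballI impI)
    show "x \<in> affine_points coords" by (simp add: xf affine_points_def chart_formula_def)
    show "x (Z i j) \<noteq> 0" if "i \<in> {1..n}" "j \<in> {1..n}" "i < j" "lev i j < len" for i j
      using xZ[OF that(1-3)] I[OF that(1,2)] pne[OF that(1,2,4)] sc0 by simp
  qed
  ultimately show "x \<in> {x \<in> chart_target n tree. \<forall>L\<in>eqs. L x = 0}" by blast
next
  fix x assume x: "x \<in> {x \<in> chart_target n tree. \<forall>L\<in>eqs. L x = 0}"
  then have aff: "x \<in> affine_points coords"
    and nz: "\<And>i j. i \<in> {1..n} \<Longrightarrow> j \<in> {1..n} \<Longrightarrow> i < j \<Longrightarrow> lev i j < len \<Longrightarrow> x (Z i j) \<noteq> 0"
    unfolding target_iff by auto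
  from x have e: "\<And>m. m \<in> {1..len} \<Longrightarrow> x (T m) = 0"
    "\<And>m. m < len \<Longrightarrow> zeta x (fst (pr m)) (snd (pr m)) = 1"
    "\<And>i j. i \<in> {1..n} \<Longrightarrow> j \<in> {1..n} \<Longrightarrow> i < j \<Longrightarrow> x (Z i j) = ypos x (lev i j) j - ypos x (lev i j) i"
    "\<And>i j m. i \<in> {1..n} \<Longrightarrow> j \<in> {1..n} \<Longrightarrow> m < lev i j \<Longrightarrow> ypos x m i = ypos x m j"
    using eqs_iff[of x] by auto
  have z: "zeta x i j = ypos x (lev i j) j - ypos x (lev i j) i" if ij: "i \<in> {1..n}" "j \<in> {1..n}"
      for i j
    using e(3)[of i j] e(3)[of j i] ij mlev_sym[OF ij]
    by (cases i j rule: linorder_cases) (simp_all add: zeta_def)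
  have zne: "zeta x i j \<noteq> 0" if ij: "i \<in> {1..n}" "j \<in> {1..n}" "lev i j < len" for i j
    using nz[of i j] nz[of j i] ij mlev_sym[OF ij(1,2)] mlev_self[OF ij(1)]
    by (cases i j rule: linorder_cases) (simp_all add: zeta_def)
  have ss: "same_levels n S S" by (simp add: same_levels_def)
  define I where "I = (\<lambda>i j. ypos x (lev i j) j - ypos x (lev i j) i)"
  have pos: "positions n len lev (ypos x)"
    unfolding positions_def
  proof (intro ballI conjI impI allI)
    show "ypos x (lev i j) i \<noteq> ypos x (lev i j) j" if "i \<in> {1..n}" "j \<in> {1..n}" "lev i j < len" for i j
      using zne[OF that] z[OF that(1,2)] by auto
  qed (use e(4) in blast)
  have "\<exists>X\<in>U. same_levels n S (representative X) \<and> \<psi> X = chart_formula n tree pr (\<lambda>m. m) I"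
    by (rule realize[OF stable merges_id[OF ss] pos I_def]) (use zne z I_def in auto)
  then obtain X where X: "X \<in> U" "same_levels n S (representative X)"
      "\<psi> X = chart_formula n tree pr (\<lambda>m. m) I"
    by blast
  have Iz: "I i j = zeta x i j" if "i \<in> {1..n}" "j \<in> {1..n}" for i j using z[OF that]
      by (simp add: I_def)
  \<comment> \<open>By the normalization equations all scales are \<open>1\<close>, so dividing by
    them changes nothing.\<close>
  have sc1: "scale_of tree pr I m = 1" for m
    using e(2)[of m] Iz[OF pr_in(1)[of m] pr_in(2)[of m]] by (cases
        "m < len") (simp_all add: scale_of_def)
  have "\<psi> X = x"
  proof
    fix k
    show "\<psi> X k = x k"
    proof (cases "k \<in> coords")
      case True
      show ?thesis
      proof (cases k)
        case (Z i j)
        then have "i \<in> {1..n}" "j \<in> {1..n}" "i < j" using True by (auto simp: chart_coords_def)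
        then show ?thesis using Z True Iz[of i j] unfolding X(3)
            by (simp add: chart_formula_def sc1 zeta_def)
      next
        case (T m)
        then have "m \<in> {1..len}" using True by (auto simp: chart_coords_def)
        then show ?thesis using T e(1)[of m] unfolding X(3) by (auto simp: chart_formula_def)
      qed
    next
      case False
      then show ?thesis using aff unfolding X(3) by (simp add: chart_formula_def affine_points_def)
    qed
  qed
  moreover have "X \<in> moduli n" using X(1) by (simp add: chart_domain_def)
  ultimately show "x \<in> \<psi> ` {X \<in> moduli n. same_levels n S (representative X)}" using X(2) by blast
qed

end

lemma reindexed_cut:
  fixes V :: "'a fspace"
  assumes C: "finite C" and E: "finite E" "\<And>L. L \<in> E \<Longrightarrow> affine_form C L"
    and W: "openin (zariski C) W" and ne: "{x \<in> W. \<forall>L\<in>E. L x = 0} \<noteq> {}"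
    and iso: "isomorphism V (subspace_of (affine_space C) {x \<in> W. \<forall>L\<in>E. L x = 0}) f"
  shows "smooth_variety V" "quasi_affine_variety V"
proof -
  obtain e where e: "bij_betw e C {..<card C}"
    using ex_bij_betw_finite_nat[OF C] by (auto simp: lessThan_atLeast0)
  define N where "N = card C"
  have e: "bij_betw e C {..<N}" using e by (simp add: N_def)
  let ?P = "{x \<in> W. \<forall>L\<in>E. L x = 0}"
  let ?r = "reindex {..<N} (inv_into C e)"
  have WA: "W \<subseteq> affine_points C" using openin_subset[OF W] by simp
  have eI: "e ` C \<subseteq> {..<N}" "inv_into C e ` {..<N} \<subseteq> C"
    using e by (auto simp: bij_betw_def inv_into_into)
  have inv1: "reindex C e (?r x) = x" if "x \<in> affine_points C" for x
    using that e eI by (auto simp: reindex_def affine_points_def bij_betw_def fun_eq_iff)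
  have inv2: "?r (reindex C e y) = y" if "y \<in> affine_points {..<N}" for y
  proof
    fix j
    show "?r (reindex C e y) j = y j"
    proof (cases "j < N")
      case True
      then have "inv_into C e j \<in> C" "e (inv_into C e j) = j"
        using e eI by (auto simp: bij_betw_def f_inv_into_f)
      then show ?thesis using True by (simp add: reindex_def)
    next
      case False
      then show ?thesis using that by (simp add: reindex_def affine_points_def)
    qed
  qed
  define W' where "W' = {y \<in> affine_points {..<N}. reindex C e y \<in> W}"
  define E' where "E' = (\<lambda>L y. L (reindex C e y)) ` E"
  have W'o: "openin (zariski {..<N}) W'" unfolding W'_def by (rule reindex_open[OF W eI(1)])
  have E'f: "finite E'" using E(1) by (simp add: E'_def)
  have E'a: "affine_form {..<N} L" if "L \<in> E'" for L
    using that affine_form_reindex[OF e E(2) C] by (auto simp: E'_def)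
  have img: "?r ` ?P = {y \<in> W'. \<forall>L\<in>E'. L y = 0}"
  proof (intro equalityI subsetI)
    fix y assume "y \<in> ?r ` ?P"
    then obtain x where x: "x \<in> ?P" "y = ?r x" by blast
    then have "reindex C e y = x" using inv1 WA by auto
    moreover have "y \<in> affine_points {..<N}" unfolding x(2) by (simp add: reindex_def affine_points_def)
    ultimately show "y \<in> {y \<in> W'. \<forall>L\<in>E'. L y = 0}" using x(1) by (auto simp: W'_def E'_def)
  next
    fix y assume y: "y \<in> {y \<in> W'. \<forall>L\<in>E'. L y = 0}"
    then have "reindex C e y \<in> ?P" by (auto simp: W'_def E'_def)
    moreover have "y = ?r (reindex C e y)" using inv2 y by (auto simp: W'_def)
    ultimately show "y \<in> ?r ` ?P" by (intro image_eqI[where f = ?r and x = "reindex C e y"])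
  qed
  have PA: "?P \<subseteq> topspace (ftop (affine_space C))" using WA by auto
  have "isomorphism (subspace_of (affine_space C) ?P) (subspace_of (affine_space {..<N}) {y \<in> W'. \<forall>L\<in>E'. L y = 0}) ?r"
    using isomorphism_restrict[OF reindex_isomorphism[OF e] PA] unfolding img .
  from isomorphism_comp[OF iso this]
  have iso': "isomorphic V (subspace_of (affine_space {..<N}) {y \<in> W'. \<forall>L\<in>E'. L y = 0})"
    unfolding isomorphic_def by blast
  have ne': "{y \<in> W'. \<forall>L\<in>E'. L y = 0} \<noteq> {}" unfolding img[symmetric] using ne by simp
  show "smooth_variety V" "quasi_affine_variety V"
    using affine_forms_cut_smooth[OF E'f E'a W'o iso' ne'] by blast+
qed

section \<open>Approaching a point from a bigger stratum\<close>

context chart begin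

text \<open>A point of a bigger stratum whose level tree is merged along \<open>g\<close> is approached by blowing up
  the positions on level \<open>k\<close> by the factor \<open>(1/s)^(len - k)\<close> and adding those of merged levels:
  all chart coordinates converge to those of \<open>S\<close> as \<open>s\<close> tends to \<open>0\<close>.\<close>

lemma approximate_stratum:
  assumes R: "stable_line n R" and g: "merges n S R g"
    and p: "p \<in> poly_funs coords" "p (chart_formula n tree pr (\<lambda>m. m) (I_map S)) \<noteq> 0"
  shows "\<exists>Y\<in>U. same_levels n R (representative Y) \<and> p (\<psi> Y) \<noteq> 0"
proof -
  have g1: "mono_on {..len} g"
    and g2: "\<And>i j. i \<in> {1..n} \<Longrightarrow> j \<in> {1..n} \<Longrightarrow> slev R i j = g (lev i j)"
    using g unfolding merges_def by auto
  have gtop: "g len = slen R" by (rule merges_top[OF g R])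
  obtain x where x: "positions n len lev x"
    and xI: "\<And>i j. i \<in> {1..n} \<Longrightarrow> j \<in> {1..n} \<Longrightarrow> I_map S i j = x (lev i j) j - x (lev i j) i"
    using ex_positions by blast
  have xeq: "x m i = x m j" if "i \<in> {1..n}" "j \<in> {1..n}" "m < lev i j" for i j m
    using x that unfolding positions_def by blast
  define u where "u = (\<lambda>s m' i. \<Sum>k\<in>{k \<in> {..len}. g k = m'}. (1 / s) ^ (len - k) * x k i)"
  define J where "J = (\<lambda>s i j. u s (slev R i j) j - u s (slev R i j) i)"
  \<comment> \<open>The integral \<open>J\<close> rescaled so as to tend to the integral on
    \<open>S\<close>: positions on the level where \<open>i\<close> and \<open>j\<close> separate
    were blown up by the inverse of this factor.\<close>
  define D where "D = (\<lambda>s i j. s ^ (len - lev i j) * J s i j)"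
  \<comment> \<open>On lower levels \<open>i\<close> and \<open>j\<close> have the same position, so
    negative powers of \<open>s\<close> do not occur.\<close>
  have Dsum: "D s i j = (\<Sum>k\<in>{k \<in> {..len}. g k = g (lev i j)}.
      if k < lev i j then 0 else s ^ (k - lev i j) * (x k j - x k i))"
    if ij: "i \<in> {1..n}" "j \<in> {1..n}" and s: "s \<noteq> 0" for s i j
  proof -
    have "D s i j = (\<Sum>k\<in>{k \<in> {..len}. g k =
        g (lev i j)}. s ^ (len - lev i j) * ((1 / s) ^ (len - k) * (x k j - x k i)))"
      unfolding D_def J_def u_def g2[OF ij]
          by (simp add: sum_distrib_left sum_subtractf right_diff_distrib)
    also have "\<dots> = (\<Sum>k\<in>{k \<in> {..len}. g k = g (lev i j)}.
      if k < lev i j then 0 else s ^ (k - lev i j) * (x k j - x k i))"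
    proof (rule sum.cong[OF refl])
      fix k assume k: "k \<in> {k \<in> {..len}. g k = g (lev i j)}"
      show "s ^ (len - lev i j) * ((1 / s) ^ (len - k) * (x k j - x k i)) =
          (if k < lev i j then 0 else s ^ (k - lev i j) * (x k j - x k i))"
      proof (cases "k < lev i j")
        case True
        then show ?thesis using xeq[OF ij True] by simp
      next
        case False
        then have "len - lev i j = (len - k) + (k - lev i j)" using k by simp
        then have "s ^ (len - lev i j) * (1 / s) ^ (len - k) = s ^ (k - lev i j)"
          using s by (simp add: power_add power_divide)
        then show ?thesis using False by (simp add: mult.assoc[symmetric])
      qed
    qed
    finally show ?thesis .
  qed
  have s0: "\<forall>\<^sub>F s in at (0::complex). s \<noteq> 0" by (simp add: eventually_at_filter)
  have Dlim: "((\<lambda>s. D s i j) \<longlongrightarrow> I_map S i j) (at 0)" if ij: "i \<in> {1..n}" "j \<in> {1..n}" for i j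
  proof -
    let ?K = "{k \<in> {..len}. g k = g (lev i j)}"
    have "((\<lambda>s. \<Sum>k\<in>?K. if k < lev i j then 0 else s ^ (k - lev i j) * (x k j - x k i)) \<longlongrightarrow>
        (\<Sum>k\<in>?K. if k < lev i j then 0 else 0 ^ (k - lev i j) * (x k j - x k i))) (at 0)"
    proof (rule tendsto_sum)
      fix k
      show "((\<lambda>s. if k < lev i j then 0 else s ^ (k - lev i j) * (x k j - x k i)) \<longlongrightarrow>
        (if k < lev i j then 0 else 0 ^ (k - lev i j) * (x k j - x k i))) (at 0)"
        by (cases "k < lev i j") (auto intro!: tendsto_intros)
    qed
    \<comment> \<open>Only \<open>k = lev i j\<close> survives, since \<open>0 ^ 0 = 1\<close> and
      all higher powers vanish.\<close>
    also have "(\<Sum>k\<in>?K. if k < lev i j then 0 else 0 ^ (k - lev i j) * (x k j - x k i)) =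
        (\<Sum>k\<in>?K. if k = lev i j then x k j - x k i else 0)"
      by (rule sum.cong) auto
    also have "\<dots> = I_map S i j" using mlev_le[OF ij] xI[OF ij] by (subst sum.delta) auto
    finally have lim: "((\<lambda>s. \<Sum>k\<in>?K. if k < lev i j then 0 else s ^ (k - lev i j) * (x k j - x k i)) \<longlongrightarrow> I_map S i j) (at 0)" .
    have "\<forall>\<^sub>F s in at 0. (\<Sum>k\<in>?K. if k < lev i j then 0 else s ^ (k - lev i j) * (x k j - x k i)) =
        D s i j"
      using s0 by eventually_elim (rule Dsum[OF ij, symmetric])
    from Lim_transform_eventually[OF lim this] show ?thesis .
  qed
  \<comment> \<open>Marks that lie on different components of \<open>S\<close> but on one terminal
    component of \<open>R\<close> have to stay apart as well, as the chart domain demands; the limit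
    on \<open>S\<close> is nonzero by \<open>I_nonzero\<close>.\<close>
  have Dne: "\<forall>\<^sub>F s in at 0. \<forall>i\<in>{1..n}. \<forall>j\<in>{1..n}. lev i j < len \<longrightarrow> D s i j \<noteq> 0"
  proof (intro eventually_ball_finite ballI finite_atLeastAtMost)
    fix i j assume ij: "i \<in> {1..n}" "j \<in> {1..n}"
    show "\<forall>\<^sub>F s in at 0. lev i j < len \<longrightarrow> D s i j \<noteq> 0"
    proof (cases "lev i j < len")
      case True
      have "I_map S i j \<noteq> 0" by (rule I_nonzero[OF stable ij True])
      from tendsto_imp_eventually_ne[OF Dlim[OF ij] this] show ?thesis by (rule eventually_mono) simp
    qed simp
  qed
  \<comment> \<open>The scales of the new line with the same rescaling; at level \<open>len\<close>
    the factor is \<open>s ^ 0\<close>, in agreement with the fixed scale \<open>1\<close>.\<close>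
  define sig where "sig = (\<lambda>s m. s ^ (len - m) * scale_of tree pr (J s) m)"
  have siglim: "((\<lambda>s. sig s m) \<longlongrightarrow> scale_of tree pr (I_map S) m) (at 0)" if m: "m \<le> len" for m
  proof (cases "m < len")
    case True
    have "sig s m = D s (fst (pr m)) (snd (pr m))" for s
      using True pr_level[OF True] by (simp add: sig_def D_def scale_of_def)
    then show ?thesis using Dlim[OF pr_in(1)[OF True] pr_in(2)[OF True]] True
        by (simp add: scale_of_def)
  next
    case False
    then show ?thesis using m by (simp add: sig_def scale_of_def)
  qed
  have sigS: "scale_of tree pr (I_map S) m \<noteq> 0" for m
    using I_nonzero[OF stable pr_in(1)[of m] pr_in(2)[of m]] pr_level[of m]
    by (cases "m < len") (auto simp: scale_of_def)
  have clim: "((\<lambda>s. chart_formula n tree pr g (J s) k) \<longlongrightarrow> chart_formula n tree pr (\<lambda>m. m) (I_map S) k) (at 0)"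
    if k: "k \<in> coords" for k
  proof (cases k)
    case (Z i j)
    then have ij: "i \<in> {1..n}" "j \<in> {1..n}" using k by (auto simp: chart_coords_def)
    note l = mlev_le[OF ij]
    have "((\<lambda>s. D s i j / sig s (lev i j)) \<longlongrightarrow> I_map S i j / scale_of tree pr (I_map S) (lev i j)) (at 0)"
      by (rule tendsto_divide[OF Dlim[OF ij] siglim[OF l] sigS])
    moreover have "\<forall>\<^sub>F s in at 0. D s i j / sig s (lev i j) =
        J s i j / scale_of tree pr (J s) (lev i j)"
      using s0 by eventually_elim (simp add: D_def sig_def)
    ultimately have "((\<lambda>s. J s i j / scale_of tree pr (J s) (lev i j)) \<longlongrightarrow>
        I_map S i j / scale_of tree pr (I_map S) (lev i j)) (at 0)"
      by (rule Lim_transform_eventually)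
    then show ?thesis using k by (simp add: Z chart_formula_def)
  next
    case (T m)
    then have m: "m \<le> len" "m - 1 \<le> len" "1 \<le> m" using k by (auto simp: chart_coords_def)
    have rhs: "chart_formula n tree pr (\<lambda>m. m) (I_map S) k = 0" using m(3)
        by (auto simp: T chart_formula_def)
    show ?thesis
    proof (cases "g m = g (m - 1)")
      case True
      \<comment> \<open>Consecutive levels are rescaled by powers that differ by one, so a factor
        \<open>s\<close> is left over and sends the coordinate to \<open>0\<close>.\<close>
      have "((\<lambda>s. s * (sig s m / sig s (m - 1))) \<longlongrightarrow>
          0 * (scale_of tree pr (I_map S) m / scale_of tree pr (I_map S) (m - 1))) (at 0)"
        by (intro tendsto_mult tendsto_divide siglim m sigS tendsto_ident_at)
      moreover have "\<forall>\<^sub>F s in at 0. s * (sig s m / sig s (m - 1)) =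
          scale_of tree pr (J s) m / scale_of tree pr (J s) (m - 1)"
        using s0
      proof eventually_elim
        case (elim s)
        have "len - (m - 1) = Suc (len - m)" using m by simp
        then show ?case using elim by (simp add: sig_def)
      qed
      ultimately have "((\<lambda>s. scale_of tree pr (J s) m / scale_of tree pr (J s) (m - 1)) \<longlongrightarrow>
          0 * (scale_of tree pr (I_map S) m / scale_of tree pr (I_map S) (m - 1))) (at 0)"
        by (rule Lim_transform_eventually)
      then show ?thesis unfolding rhs using k True by (simp add: T chart_formula_def)
    next
      case False
      then have "chart_formula n tree pr g (J s) k = 0" for s by (simp add: T chart_formula_def)
      then show ?thesis unfolding rhs by simp
    qed
  qed
  have "((\<lambda>s. p (chart_formula n tree pr g (J s))) \<longlongrightarrow> p (chart_formula n tree pr (\<lambda>m. m) (I_map S))) (at 0)"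
    by (rule poly_tendsto[OF p(1) clim])
  from tendsto_imp_eventually_ne[OF this p(2)]
  have "\<forall>\<^sub>F s in at 0. p (chart_formula n tree pr g (J s)) \<noteq> 0" .
  with Dne s0 have "\<forall>\<^sub>F s in at 0. (\<forall>i\<in>{1..n}. \<forall>j\<in>{1..n}. lev i j < len \<longrightarrow> D s i j \<noteq> 0) \<and> s \<noteq> 0 \<and>
      p (chart_formula n tree pr g (J s)) \<noteq> 0"
    by eventually_elim blast
  then have "\<exists>s. (\<forall>i\<in>{1..n}. \<forall>j\<in>{1..n}. lev i j < len \<longrightarrow> D s i j \<noteq> 0) \<and> s \<noteq> 0 \<and>
      p (chart_formula n tree pr g (J s)) \<noteq> 0"
    by (rule eventually_happens'[rotated]) simp
  then obtain s where Ds: "\<forall>i\<in>{1..n}. \<forall>j\<in>{1..n}. lev i j < len \<longrightarrow> D s i j \<noteq> 0"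
    and ps: "p (chart_formula n tree pr g (J s)) \<noteq> 0"
    by (elim exE conjE)
  have Jne: "J s i j \<noteq> 0" if "i \<in> {1..n}" "j \<in> {1..n}" "lev i j < len" for i j
    using Ds that unfolding D_def by fastforce
  have "positions n (slen R) (slev R) (u s)"
    unfolding positions_def
  proof (intro ballI conjI impI allI)
    fix i j assume ij: "i \<in> {1..n}" "j \<in> {1..n}"
    show "u s (slev R i j) i \<noteq> u s (slev R i j) j" if l: "slev R i j < slen R"
    proof -
      have "lev i j \<noteq> len" using l g2[OF ij] gtop by auto
      then have "lev i j < len" using mlev_le[OF ij] by simp
      from Jne[OF ij this] show ?thesis by (auto simp: J_def)
    qed
    show "u s m' i = u s m' j" if l: "m' < slev R i j" for m'
      unfolding u_def
    proof (rule sum.cong[OF refl])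
      fix k assume k: "k \<in> {k \<in> {..len}. g k = m'}"
      \<comment> \<open>By monotonicity of \<open>g\<close>, a level merged into
        \<open>m' < slev R i j\<close> lies below the level where \<open>i\<close> and
        \<open>j\<close> separate on \<open>S\<close>.\<close>
      have "k < lev i j"
      proof (rule ccontr)
        assume "\<not> k < lev i j"
        then have "g (lev i j) \<le> g k" using mono_onD[OF g1, of "lev i j" k] k mlev_le[OF ij] by simp
        then show False using l g2[OF ij] k by simp
      qed
      then show "(1 / s) ^ (len - k) * x k i = (1 / s) ^ (len - k) * x k j" using xeq[OF ij] by simp
    qed
  qed
  from realize[OF R g this, of "J s"] Jne
  obtain Y where "Y \<in> U" "same_levels n R (representative Y)" "\<psi> Y = chart_formula n tree pr g (J s)"
    unfolding J_def by blast
  with ps show ?thesis by auto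
qed

end

lemma ex_chart_choice:
  assumes "line n S par apt dpt"
  shows "\<exists>pr vl. chart n S par apt dpt pr vl"
proof -
  interpret line n S par apt dpt by fact
  have "\<forall>m. \<exists>q. m < len \<longrightarrow> q \<in> {1..n} \<times> {1..n} \<and> slev S (fst q) (snd q) = m"
  proof
    fix m
    show "\<exists>q. m < len \<longrightarrow> q \<in> {1..n} \<times> {1..n} \<and> slev S (fst q) (snd q) = m"
    proof (cases "m < len")
      case True
      then obtain i j where "i \<in> {1..n}" "j \<in> {1..n}" "slev S i j = m" using mlev_attained[of m] by auto
      then show ?thesis by (intro exI[of _ "(i, j)"]) simp
    qed simp
  qed
  then obtain pr where pr: "\<And>m. m < len \<Longrightarrow> pr m \<in> {1..n} \<times> {1..n} \<and> slev S (fst (pr m)) (snd (pr m)) =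
      m" by metis
  obtain vl where vl: "terminal (dual_tree S) vl" using ex_terminal_above[OF root_in] by blast
  have "chart_choice n (dual_tree S) pr vl"
    unfolding chart_choice_def chart_vertex_def using pr vl by (simp add: mlev_def)
  then have "chart n S par apt dpt pr vl" by unfold_locales
  then show ?thesis by blast
qed

section \<open>Strata\<close>

lemma isomorphism_open_image:
  assumes "isomorphism V W f" "openin (ftop V) Q"
  shows "\<exists>G. openin (ftop W) G \<and> (\<forall>x\<in>topspace (ftop V). f x \<in> G \<longleftrightarrow> x \<in> Q)"
proof -
  obtain f' where f': "morphism W V f'" "\<forall>x\<in>topspace (ftop V). f' (f x) = x"
    and f: "morphism V W f" using assms(1) by (auto simp: isomorphism_def)
  have "openin (ftop W) {y \<in> topspace (ftop W). f' y \<in> Q}"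
    using f'(1) assms(2) by (auto simp: morphism_def continuous_map_def)
  moreover have "f x \<in> topspace (ftop W)" if "x \<in> topspace (ftop V)" for x
    using f that by (auto simp: morphism_def continuous_map_def)
  ultimately show ?thesis using f'(2)
    by (intro exI[of _ "{y \<in> topspace (ftop W). f' y \<in> Q}"]) auto
qed

section \<open>Charts of the moduli variety\<close>

locale moduli_chart = chart n S par apt dpt pr vl for n S par apt dpt pr vl +
  fixes A :: "mline set fspace"
  assumes mv: "moduli_variety n A"
begin

lemma top: "topspace (ftop A) = moduli n"
  and restrA: "restricting A"
  and U_open: "openin (ftop A) U"
  and immersion: "closed_immersion (subspace_of A U)
             (subspace_of (affine_space coords) (chart_target n tree)) \<psi>"
proof -
  have "dual_level_tree n tree" unfolding dual_level_tree_def using stable by blast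
  then show "openin (ftop A) U" "closed_immersion (subspace_of A U)
             (subspace_of (affine_space coords) (chart_target n tree)) \<psi>"
    using mv choice unfolding moduli_variety_def by auto
  show "topspace (ftop A) = moduli n" "restricting A"
    using mv restricting_function_space unfolding moduli_variety_def variety_def by auto
qed

lemma U_top: "topspace (ftop (subspace_of A U)) = U"
  using openin_subset[OF U_open] by auto

lemma image_in_target: "\<psi> ` U \<subseteq> chart_target n tree"
  using immersion closedin_subset unfolding closed_immersion_def U_top by fastforce

lemma chart_iso:
  "isomorphism (subspace_of A U)
     (subspace_of (subspace_of (affine_space coords) (chart_target n tree)) (\<psi> ` U)) \<psi>"
  using immersion unfolding closed_immersion_def U_top by blast

lemma stratum_in_U: "{X \<in> moduli n. same_levels n S (representative X)} \<subseteq> U"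
  using same_levels_iff by blast

lemma stratum_smooth:
  assumes "{X \<in> moduli n. same_levels n S (representative X)} \<noteq> {}"
  shows "smooth_variety (subspace_of A {X \<in> moduli n. same_levels n S (representative X)})"
    "quasi_affine_variety (subspace_of A {X \<in> moduli n. same_levels n S (representative X)})"
proof -
  let ?S = "{X \<in> moduli n. same_levels n S (representative X)}"
  have Ut: "U \<subseteq> topspace (ftop A)" using openin_subset[OF U_open] .
  have iso: "isomorphism (subspace_of A ?S)
      (subspace_of (affine_space coords) {x \<in> chart_target n tree. \<forall>L\<in>eqs. L x = 0}) \<psi>"
    using isomorphism_chart_restrict[OF restrA restricting_affine Ut stratum_in_U chart_iso image_in_target]
    unfolding stratum_image .
  have ne: "{x \<in> chart_target n tree. \<forall>L\<in>eqs. L x = 0} \<noteq> {}"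
    unfolding stratum_image[symmetric] using assms by simp
  show "smooth_variety (subspace_of A ?S)" "quasi_affine_variety (subspace_of A ?S)"
    using reindexed_cut[OF finite_coords finite_eqs eqs_form target_open ne iso] by blast+
qed

lemma stratum_locally_closed:
  "locally_closed_in (ftop A) {X \<in> moduli n. same_levels n S (representative X)}"
proof -
  have cm: "continuous_map (subtopology (ftop A) U)
      (subtopology (subtopology (zariski coords) (chart_target n tree)) (\<psi> ` U)) \<psi>"
    using chart_iso unfolding isomorphism_def morphism_def by simp
  have "continuous_map (subtopology (ftop A) U) (zariski coords) \<psi>"
    using cm by (simp add: continuous_map_in_subtopology)
  moreover have o: "openin (zariski coords) {x \<in> affine_points coords. \<exists>m\<in>{1..len}. x (T m) \<noteq> 0}"
    unfolding openin_zariski zariski_open_def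
  proof (intro exI conjI)
    show "(\<lambda>m x. x (T m)) ` {1..len} \<subseteq> poly_funs coords"
      by (intro image_subsetI poly_coord T_coords)
  qed simp
  ultimately have "openin (subtopology (ftop A) U)
      {X \<in> topspace (subtopology (ftop A) U). \<psi> X \<in> {x \<in> affine_points coords. \<exists>m\<in>{1..len}. x (T m) \<noteq> 0}}"
    by (rule openin_continuous_map_preimage)
  then have G: "openin (ftop A) {X \<in> U. \<psi> X \<in> {x \<in> affine_points coords. \<exists>m\<in>{1..len}. x (T m) \<noteq> 0}}" (is "openin _ ?G")
    unfolding U_top[unfolded ftop_subspace] openin_open_subtopology[OF U_open] by (rule conjunct1)
  have "closedin (ftop A) (topspace (ftop A) - ?G)" using G by blast
  moreover have "{X \<in> moduli n. same_levels n S (representative X)} = U \<inter> (topspace (ftop A) - ?G)"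
  proof -
    have "\<psi> X \<in> affine_points coords" if "X \<in> U" for X
      using image_in_target that unfolding target_iff subset_iff by blast
    moreover have "U \<subseteq> moduli n" unfolding chart_domain_def by blast
    ultimately show ?thesis using same_levels_iff unfolding top by blast
  qed
  ultimately show ?thesis unfolding locally_closed_in_def using U_open by blast
qed

text \<open>Open sets of the chart domain come from Zariski open sets of affine space, and around a
  point these contain the nonvanishing locus of a single polynomial. To land in a neighbourhood it
  thus suffices to keep one polynomial nonzero.\<close>

lemma ex_separating_polynomial:
  assumes X: "X \<in> U" and Q: "openin (ftop A) Q" "X \<in> Q"
  shows "\<exists>p\<in>poly_funs coords. p (\<psi> X) \<noteq> 0 \<and> (\<forall>Y\<in>U. p (\<psi> Y) \<noteq> 0 \<longrightarrow> Y \<in> Q)"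
proof -
  have "openin (ftop (subspace_of A U)) (U \<inter> Q)"
    using U_open Q(1) openin_open_subtopology[OF U_open] by auto
  from isomorphism_open_image[OF chart_iso this, unfolded U_top] obtain G where
    G': "openin (ftop (subspace_of (subspace_of (affine_space coords) (chart_target n tree)) (\<psi> ` U))) G"
      "\<forall>Y\<in>U. \<psi> Y \<in> G \<longleftrightarrow> Y \<in> U \<inter> Q" by blast
  have G: "openin (subtopology (subtopology (zariski coords) (chart_target n tree)) (\<psi> ` U)) G"
    "\<psi> Y \<in> G \<longleftrightarrow> Y \<in> Q" if "Y \<in> U" for Y
    using G' that by simp_all
  obtain G0 where G0: "openin (zariski coords) G0" "G = G0 \<inter> chart_target n tree \<inter> \<psi> ` U"
    using G(1)[OF X] by (auto simp: openin_subtopology)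
  obtain F where F: "F \<subseteq> poly_funs coords" "G0 = {x \<in> affine_points coords. \<exists>p\<in>F. p x \<noteq> 0}"
    using G0(1) unfolding openin_zariski zariski_open_def by blast
  have "\<psi> X \<in> G0" using G(2)[OF X] Q(2) G0(2) by blast
  then obtain p where p: "p \<in> F" "p (\<psi> X) \<noteq> 0" unfolding F(2) by blast
  have "Y \<in> Q" if Y: "Y \<in> U" "p (\<psi> Y) \<noteq> 0" for Y
  proof -
    have t: "\<psi> Y \<in> chart_target n tree" using image_in_target Y(1) by blast
    then have "\<psi> Y \<in> affine_points coords" unfolding target_iff by blast
    then have "\<psi> Y \<in> G0" unfolding F(2) using p(1) Y(2) by blast
    then have "\<psi> Y \<in> G" unfolding G0(2) using t Y(1) by blast
    then show ?thesis using G(2)[OF Y(1)] by blast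
  qed
  with p F(1) show ?thesis by blast
qed

end

lemma ex_moduli_chart:
  assumes "moduli_variety n A" "X \<in> moduli n"
  shows "\<exists>par apt dpt pr vl. moduli_chart n (representative X) par apt dpt pr vl A"
proof -
  obtain par apt dpt where "line n (representative X) par apt dpt"
    using ex_line[OF stable_representative[OF assms(2)]] by blast
  moreover from ex_chart_choice[OF this] obtain pr vl where
    "chart n (representative X) par apt dpt pr vl" by blast
  ultimately show ?thesis using assms(1) unfolding moduli_chart_def moduli_chart_axioms_def by blast
qed

section \<open>Closures of strata and the conclusion\<close>

lemma stratum_eq:
  assumes "X \<in> stratum n i"
  shows "stratum n i = {Y \<in> moduli n. same_levels n (representative X) (representative Y)}"
proof (intro set_eqI)
  fix Y
  have X: "X \<in> moduli n" "key n X = i" using assms by (auto simp: stratum_iff)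
  show "Y \<in> stratum n i \<longleftrightarrow> Y \<in> {Y \<in> moduli n. same_levels n (representative X) (representative Y)}"
    using key_eq_iff[OF X(1), of Y] X(2) unfolding stratum_iff by auto
qed

text \<open>A chart at a point of stratum \<open>i\<close> that meets stratum \<open>j\<close>
  yields a merging of level functions, and the same merging serves all points of stratum
  \<open>i\<close>. So one point in the closure brings all of them along.\<close>

lemma stratum_closure:
  assumes mv: "moduli_variety n A" and meet: "stratum n i \<inter> (ftop A closure_of stratum n j) \<noteq> {}"
  shows "stratum n i \<subseteq> ftop A closure_of stratum n j"
proof
  obtain X1 where X1: "X1 \<in> stratum n i" "X1 \<in> ftop A closure_of stratum n j" using meet by blast
  have X1m: "X1 \<in> moduli n" using X1(1) by (simp add: stratum_iff)
  obtain par apt dpt pr vl where "moduli_chart n (representative X1) par apt dpt pr vl A"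
    using ex_moduli_chart[OF mv X1m] by blast
  then interpret C1: moduli_chart n "representative X1" par apt dpt pr vl A .
  have "X1 \<in> C1.U" using C1.stratum_in_U X1m by (auto simp: same_levels_def)
  then obtain Y where Y: "Y \<in> stratum n j" "Y \<in> C1.U"
    using X1(2) C1.U_open unfolding in_closure_of by blast
  then obtain g where g: "merges n (representative X1) (representative Y) g" unfolding C1.domain_iff
      by blast
  have Ym: "Y \<in> moduli n" using Y(1) by (simp add: stratum_iff)
  fix X assume X: "X \<in> stratum n i"
  have Xm: "X \<in> moduli n" using X by (simp add: stratum_iff)
  have "same_levels n (representative X1) (representative X)" using X unfolding stratum_eq[OF X1(1)]
      by blast
  then have g': "merges n (representative X) (representative Y) g"
    using g unfolding merges_def same_levels_def by simp
  obtain par' apt' dpt' pr' vl' where "moduli_chart n (representative X) par' apt' dpt' pr' vl' A"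
    using ex_moduli_chart[OF mv Xm] by blast
  then interpret C: moduli_chart n "representative X" par' apt' dpt' pr' vl' A .
  have ss: "same_levels n (representative X) (representative X)" by (simp add: same_levels_def)
  have XU: "X \<in> C.U" using C.stratum_in_U Xm ss by blast
  show "X \<in> ftop A closure_of stratum n j"
    unfolding in_closure_of
  proof (intro conjI allI impI)
    show "X \<in> topspace (ftop A)" using Xm C.top by simp
    fix Q assume Q: "X \<in> Q \<and> openin (ftop A) Q"
    from C.ex_separating_polynomial[OF XU Q[THEN conjunct2] Q[THEN conjunct1]]
    obtain p where p: "p \<in> poly_funs C.coords" "p (C.\<psi> X) \<noteq> 0" "\<forall>W\<in>C.U. p (C.\<psi> W) \<noteq> 0 \<longrightarrow> W \<in> Q"
      by (elim bexE conjE)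
    have "p (chart_formula n C.tree pr' (\<lambda>m. m) (I_map (representative X))) \<noteq> 0"
      using p(2) C.chart_map_eq[OF Xm C.merges_id[OF ss]] by simp
    from C.approximate_stratum[OF stable_representative[OF Ym] g' p(1) this]
    obtain W where W: "W \<in> C.U" "same_levels n (representative Y) (representative W)" "p (C.\<psi> W) \<noteq> 0"
        by blast
    have "W \<in> moduli n" using W(1) unfolding C.domain_iff by blast
    then have "W \<in> stratum n j" unfolding stratum_eq[OF Y(1)] using W(2) by blast
    moreover have "W \<in> Q" using p(3) W by blast
    ultimately show "\<exists>y. y \<in> stratum n j \<and> y \<in> Q" by blast
  qed
qed

text \<open>The other lemmas on strata work in a chart at one of the points, so an index without
  points is treated separately.\<close>

lemma empty_subspace:
  "smooth_variety (subspace_of V {})" "quasi_affine_variety (subspace_of V {})"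
proof -
  show "smooth_variety (subspace_of V {})" by (simp add: smooth_variety_def)
  have m: "morphism (subspace_of V {}) (subspace_of W {}) f" for V :: "'c fspace" and W :: "'d fspace"
      and f
    unfolding morphism_def by (auto simp: continuous_map_def freg_subspace)
  have "isomorphic (subspace_of V {}) (subspace_of (affine_space {..<0}) {})"
    unfolding isomorphic_def isomorphism_def using m[of V "affine_space {..<0}"] m[of
        "affine_space {..<0}" V] by auto
  moreover have "locally_closed_in (zariski {..<0}) {}"
    unfolding locally_closed_in_def by (intro exI[of _ "{}"]) auto
  ultimately show "quasi_affine_variety (subspace_of V {})" unfolding quasi_affine_variety_def by blast
qed

theorem proposition3p19:
  fixes n :: nat and \<A> :: "mline set fspace"
  assumes "n \<ge> 1"
    and "moduli_variety n \<A>"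
  shows "quasi_affine_stratification \<A> (strata_index n) (stratum n) \<and>
    (\<forall>i\<in>strata_index n. smooth_variety (subspace_of \<A> (stratum n i)))"
proof -
  have local: "locally_closed_in (ftop \<A>) (stratum n i) \<and>
      quasi_affine_variety (subspace_of \<A> (stratum n i)) \<and>
      smooth_variety (subspace_of \<A> (stratum n i))" for i
  proof (cases "stratum n i = {}")
    case True
    have "locally_closed_in (ftop \<A>) {}" unfolding locally_closed_in_def by (intro exI[of _ "{}"]) auto
    then show ?thesis unfolding True using empty_subspace by blast
  next
    case False
    then obtain X where X: "X \<in> stratum n i" by blast
    then have "X \<in> moduli n" by (simp add: stratum_iff)
    from ex_moduli_chart[OF assms(2) this] obtain par apt dpt pr vl where
      "moduli_chart n (representative X) par apt dpt pr vl \<A>" by blast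
    then interpret C: moduli_chart n "representative X" par apt dpt pr vl \<A> .
    show ?thesis
      using C.stratum_smooth C.stratum_locally_closed False unfolding stratum_eq[OF X] by blast
  qed
  have top: "topspace (ftop \<A>) = moduli n" using assms(2) by (simp add: moduli_variety_def)
  have "(\<Union>i\<in>strata_index n. stratum n i) = topspace (ftop \<A>)"
    unfolding top using key_in_index by (auto simp: stratum_iff)
  moreover have "\<forall>i\<in>strata_index n. \<forall>j\<in>strata_index n. i \<noteq> j \<longrightarrow> stratum n i \<inter> stratum n j = {}"
    by (auto simp: stratum_iff)
  ultimately have "stratification (ftop \<A>) (strata_index n) (stratum n)"
    unfolding stratification_def using local stratum_closure[OF assms(2)] by blast
  then show ?thesis unfolding quasi_affine_stratification_def using local by blast
qed

end
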